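(* Let $d\ge1$ and for each $n$ consider the proper $q$-coloring model on a box $\Lambda\subset\mathbb{Z}^d$ of side-length $n$ with $q\ge4d(d+1)$ colors and an arbitrary boundary condition. Then the heat-bath dynamics has cutoff with window $O(\log\log n)$.
   Context: The proper $q$-coloring model on $\Lambda$ is the uniform measure $\mu$ on colorings $\sigma\in\{1,\dots,q\}^\Lambda$ in which adjacent sites receive distinct colors (including adjacency with outer boundary sites whose colors are fixed by the boundary condition). A boundary condition assigns a color to each site outside $\Lambda$ neighbouring $\Lambda$, or leaves it free. Heat-bath dynamics is the continuous-time chain on proper colorings where each site has an independent rate-one Poisson clock and when the clock at $x$ rings the color at $x$ is resampled from its conditional distribution under $\mu$ given all other colors. $t_{\mathrm{mix}}(\epsilon)=\inf\{t:\max_{\sigma_0}\|\mathbb{P}_{\sigma_0}(X_t\in\cdot)-\mu\|_{\mathrm{TV}}\le\epsilon\}$. Cutoff: $t_{\mathrm{mix}}(\epsilon)/t_{\mathrm{mix}}(1-\epsilon)\to1$ as $n\to\infty$ for every $0<\epsilon<1$. Window $O(\log\log n)$: $\log\log n=o(t_{\mathrm{mix}}(1/e))$ and $t_{\mathrm{mix}}(\epsilon)=t_{\mathrm{mix}}(1-\epsilon)+O(\log\log n)$ for every $0<\epsilon<1$, with implicit constant that may depend on $\epsilon$. *)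

theory Defs
  imports "HOL-Probability.Probability" "HOL-Library.Landau_Symbols"
begin

definition lattice_adj :: "int ^ 'd \<Rightarrow> int ^ 'd \<Rightarrow> bool" where
  "lattice_adj x y \<longleftrightarrow> (\<Sum>i\<in>UNIV. \<bar>x $ i - y $ i\<bar>) = 1"

definition lattice_box :: "int ^ 'd \<Rightarrow> nat \<Rightarrow> (int ^ 'd) set" where
  "lattice_box a n = {x. \<forall>i. a $ i \<le> x $ i \<and> x $ i < a $ i + int n}"

definition outer_boundary :: "(int ^ 'd) set \<Rightarrow> (int ^ 'd) set" where
  "outer_boundary \<Lambda> = {y. y \<notin> \<Lambda> \<and> (\<exists>x\<in>\<Lambda>. lattice_adj x y)}"

(* A boundary site outside the domain of the partial map is free. *)
definition boundary_condition :: "nat \<Rightarrow> (int ^ 'd) set \<Rightarrow> (int ^ 'd \<rightharpoonup> nat) \<Rightarrow> bool" where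
  "boundary_condition q \<Lambda> \<tau> \<longleftrightarrow> dom \<tau> \<subseteq> outer_boundary \<Lambda> \<and> ran \<tau> \<subseteq> {1..q}"

definition proper_colorings ::
    "nat \<Rightarrow> (int ^ 'd) set \<Rightarrow> (int ^ 'd \<rightharpoonup> nat) \<Rightarrow> (int ^ 'd \<Rightarrow> nat) set" where
  "proper_colorings q \<Lambda> \<tau> = {\<sigma> \<in> \<Lambda> \<rightarrow>\<^sub>E {1..q}.
     (\<forall>x\<in>\<Lambda>. \<forall>y\<in>\<Lambda>. lattice_adj x y \<longrightarrow> \<sigma> x \<noteq> \<sigma> y) \<and>
     (\<forall>x\<in>\<Lambda>. \<forall>y\<in>outer_boundary \<Lambda>. lattice_adj x y \<longrightarrow> \<tau> y \<noteq> Some (\<sigma> x))}"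

definition coloring_measure ::
    "nat \<Rightarrow> (int ^ 'd) set \<Rightarrow> (int ^ 'd \<rightharpoonup> nat) \<Rightarrow> (int ^ 'd \<Rightarrow> nat) pmf" where
  "coloring_measure q \<Lambda> \<tau> = pmf_of_set (proper_colorings q \<Lambda> \<tau>)"


section \<open>Heat-bath dynamics\<close>

(* One independent rate-one Poisson clock per site, given by its i.i.d. Exp(1) gaps:
   coordinate (x, k) is the waiting time for the k-th ring (counted from 0) of the clock at x. *)
definition poisson_clocks :: "'v set \<Rightarrow> ('v \<times> nat \<Rightarrow> real) measure" where
  "poisson_clocks \<Lambda> = (\<Pi>\<^sub>M p\<in>\<Lambda> \<times> UNIV. density lborel (exponential_density 1))"

definition ring_time :: "('v \<times> nat \<Rightarrow> real) \<Rightarrow> 'v \<times> nat \<Rightarrow> real" where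
  "ring_time \<omega> p = (\<Sum>j\<le>snd p. \<omega> (fst p, j))"

definition rings :: "'v set \<Rightarrow> real \<Rightarrow> ('v \<times> nat \<Rightarrow> real) \<Rightarrow> ('v \<times> nat) set" where
  "rings \<Lambda> t \<omega> = {p \<in> \<Lambda> \<times> UNIV. ring_time \<omega> p \<le> t}"

(* The sites that ring during [0, t], in chronological order. For finite \<Lambda> the described list
   exists almost surely (finitely many rings, no two simultaneous) and is then unique. *)
definition ring_sequence :: "'v set \<Rightarrow> real \<Rightarrow> ('v \<times> nat \<Rightarrow> real) \<Rightarrow> 'v list" where
  "ring_sequence \<Lambda> t \<omega> =
     map fst (THE ps. set ps = rings \<Lambda> t \<omega> \<and> sorted_wrt (<) (map (ring_time \<omega>) ps))"

(* Resample the value at x from its conditional law under \<mu> given the values at all other sites. *)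
definition resample :: "('v \<Rightarrow> 'c) pmf \<Rightarrow> 'v set \<Rightarrow> 'v \<Rightarrow> ('v \<Rightarrow> 'c) \<Rightarrow> ('v \<Rightarrow> 'c) pmf" where
  "resample \<mu> \<Lambda> x \<sigma> = cond_pmf \<mu> {\<eta>. \<forall>y\<in>\<Lambda> - {x}. \<eta> y = \<sigma> y}"

primrec resample_seq ::
    "('v \<Rightarrow> 'c) pmf \<Rightarrow> 'v set \<Rightarrow> 'v list \<Rightarrow> ('v \<Rightarrow> 'c) \<Rightarrow> ('v \<Rightarrow> 'c) pmf" where
  "resample_seq \<mu> \<Lambda> [] \<sigma> = return_pmf \<sigma>"
| "resample_seq \<mu> \<Lambda> (x # xs) \<sigma> = bind_pmf (resample \<mu> \<Lambda> x \<sigma>) (resample_seq \<mu> \<Lambda> xs)"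

(* The law of the state at time t of the dynamics started from \<sigma>. *)
definition heat_bath_law ::
    "('v \<Rightarrow> 'c) pmf \<Rightarrow> 'v set \<Rightarrow> real \<Rightarrow> ('v \<Rightarrow> 'c) \<Rightarrow> ('v \<Rightarrow> 'c) measure" where
  "heat_bath_law \<mu> \<Lambda> t \<sigma> =
     poisson_clocks \<Lambda> \<bind> (\<lambda>\<omega>. measure_pmf (resample_seq \<mu> \<Lambda> (ring_sequence \<Lambda> t \<omega>) \<sigma>))"

(* The bind above is a genuine mixture: its kernel is measurable. *)
lemma ring_sequence_measurable [measurable]:
  fixes \<Lambda> :: "('v::countable) set"
  shows "ring_sequence \<Lambda> t \<in> poisson_clocks \<Lambda> \<rightarrow>\<^sub>M count_space UNIV"
proof -
  let ?P = "\<lambda>ps \<omega>. set ps = rings \<Lambda> t \<omega> \<and> sorted_wrt (<) (map (ring_time \<omega>) ps)"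
  have sp: "\<And>\<omega> p. \<omega> \<in> space (poisson_clocks \<Lambda>) \<Longrightarrow> fst p \<notin> \<Lambda> \<Longrightarrow> \<omega> p = undefined"
    by (auto simp: poisson_clocks_def space_PiM PiE_def extensional_def)
  have c: "(\<lambda>\<omega>. \<omega> p) \<in> borel_measurable (poisson_clocks \<Lambda>)" for p
  proof (cases "fst p \<in> \<Lambda>")
    case True
    then have "p \<in> \<Lambda> \<times> UNIV" by (cases p) auto
    then have "(\<lambda>\<omega>. \<omega> p) \<in> poisson_clocks \<Lambda> \<rightarrow>\<^sub>M density lborel (exponential_density 1)"
      unfolding poisson_clocks_def by (rule measurable_component_singleton)
    then show ?thesis by simp
  next
    case False
    then show ?thesis using sp by (subst measurable_cong[where g="\<lambda>_. undefined"]) auto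
  qed
  have rt [measurable]: "(\<lambda>\<omega>. ring_time \<omega> p) \<in> borel_measurable (poisson_clocks \<Lambda>)" for p
    unfolding ring_time_def by (intro borel_measurable_sum c)
  have eq: "?P ps \<omega> \<longleftrightarrow> (\<forall>p. (p \<in> set ps) = (p \<in> \<Lambda> \<times> UNIV \<and> ring_time \<omega> p \<le> t)) \<and>
     (\<forall>i<length ps. \<forall>j<i. ring_time \<omega> (ps!j) < ring_time \<omega> (ps!i))" for ps \<omega>
    by (auto simp: rings_def sorted_wrt_iff_nth_less set_eq_iff)
  have m: "Measurable.pred (poisson_clocks \<Lambda>) (?P ps)" for ps
    unfolding eq by measurable
  have u: "ps = qs" if "?P ps \<omega>" "?P qs \<omega>" for ps qs \<omega>
  proof -
    have "map (ring_time \<omega>) ps = map (ring_time \<omega>) qs"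
      using that strict_sorted_equal[of "map (ring_time \<omega>) ps" "map (ring_time \<omega>) qs"] by (metis list.set_map)
    moreover have "inj_on (ring_time \<omega>) (set ps \<union> set qs)"
      using that by (metis Un_absorb distinct_map strict_sorted_iff)
    ultimately show ?thesis by (metis map_inj_on)
  qed
  have "(\<lambda>\<omega>. THE ps. ?P ps \<omega>) \<in> poisson_clocks \<Lambda> \<rightarrow>\<^sub>M count_space UNIV"
    by (rule measurable_THE[where I=UNIV]) (use m u in auto)
  then show ?thesis unfolding ring_sequence_def
    by (rule measurable_compose) auto
qed

lemma prob_space_heat_bath_law:
  fixes \<Lambda> :: "('v::countable) set"
  shows "prob_space (heat_bath_law \<mu> \<Lambda> t \<sigma>)"
proof -
  interpret P: prob_space "poisson_clocks \<Lambda>" unfolding poisson_clocks_def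
    by (intro prob_space_PiM prob_space_exponential_density) auto
  have "(\<lambda>xs. measure_pmf (resample_seq \<mu> \<Lambda> xs \<sigma>)) \<in> count_space UNIV \<rightarrow>\<^sub>M subprob_algebra (count_space UNIV)"
    by (auto simp: space_subprob_algebra measure_pmf.subprob_space_axioms)
  then show ?thesis unfolding heat_bath_law_def
    by (intro P.prob_space_bind[where S="count_space UNIV"] AE_I2 measurable_compose[OF ring_sequence_measurable] prob_space_measure_pmf)
qed


section \<open>Mixing times and cutoff\<close>

definition tv_dist :: "'a measure \<Rightarrow> 'a measure \<Rightarrow> real" where
  "tv_dist M N = (SUP A\<in>sets M. \<bar>measure M A - measure N A\<bar>)"

definition mixing_time ::
    "(real \<Rightarrow> 's \<Rightarrow> 's measure) \<Rightarrow> 's set \<Rightarrow> 's measure \<Rightarrow> real \<Rightarrow> real" where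
  "mixing_time P S \<mu> \<epsilon> = Inf {t. 0 \<le> t \<and> (MAX \<sigma>\<in>S. tv_dist (P t \<sigma>) \<mu>) \<le> \<epsilon>}"

definition has_cutoff :: "(nat \<Rightarrow> real \<Rightarrow> real) \<Rightarrow> bool" where
  "has_cutoff tmix \<longleftrightarrow>
     (\<forall>\<epsilon>. 0 < \<epsilon> \<and> \<epsilon> < 1 \<longrightarrow> (\<lambda>n. tmix n \<epsilon> / tmix n (1 - \<epsilon>)) \<longlonglongrightarrow> 1)"

definition has_cutoff_window :: "(nat \<Rightarrow> real \<Rightarrow> real) \<Rightarrow> (nat \<Rightarrow> real) \<Rightarrow> bool" where
  "has_cutoff_window tmix w \<longleftrightarrow>
     w \<in> o(\<lambda>n. tmix n (exp (- 1))) \<and>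
     (\<forall>\<epsilon>. 0 < \<epsilon> \<and> \<epsilon> < 1 \<longrightarrow> (\<lambda>n. tmix n \<epsilon> - tmix n (1 - \<epsilon>)) \<in> O(w))"

definition coloring_mixing_time ::
    "nat \<Rightarrow> (int ^ 'd) set \<Rightarrow> (int ^ 'd \<rightharpoonup> nat) \<Rightarrow> real \<Rightarrow> real" where
  "coloring_mixing_time q \<Lambda> \<tau> =
     mixing_time (heat_bath_law (coloring_measure q \<Lambda> \<tau>) \<Lambda>)
       (proper_colorings q \<Lambda> \<tau>) (measure_pmf (coloring_measure q \<Lambda> \<tau>))"

end

(* Let nu be the law at time t started from some colouring, and suppose that its distance to mu is at
   most 1 - eps. Then nu and mu have a common part of mass at least eps, which after normalisation is a
   law rho with density at most 1/eps with respect to both. So it suffices that the further s = O(log log n)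
   time units bring rho close to any law nu of which it is a reweighting by a bounded density, where nu is
   itself the law of the dynamics at a time O(log n).

   Conditionally on the updates W performed during the further time s, the final state depends on the
   updates performed before only through those in a random set S(W) of sites, up to an event of negligible
   probability: with q >= Delta (Delta + 2) colours and a grand coupling of all initial states, the sites whose
   final colour is not determined by W have density (log n)^(-c), and information travels at most O(log n)
   far. Hence every site lies in S(W) with a probability delta that is as small a power of log n as desired.
   The earlier updates are independent between sites, so an L2 version of Shearer's inequality shows that the
   average over W of the variance of the density projected on S(W) is at most 2 delta / eps.

   The lower bound of order log n on the mixing time comes from the number of sites that agree with the
   initial state: by reversibility its mean is off by at least n^d e^(-t) / 2 for some initial state, and its
   variance is n^d up to powers of log n.

   To have independent updates, time is cut into slots of length 1/m, in each of which at most one site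
   is updated; the continuous-time dynamics is recovered in the limit m -> oo. *)
theory Submission
  imports Defs "HOL-Combinatorics.Combinatorics" "HOL-Real_Asymp.Real_Asymp"
begin

section \<open>The law of the ring sequence\<close>

text \<open>The independent coordinates of the variance inequality are the slots, not the sites: a
  slot is empty or carries a random site and a random permutation of the colours. An update outside
  the visible set is replaced by an empty slot, and since a slot is empty with probability at least
  1/2, the value at \<open>None\<close> is a good reference point in each coordinate. The
  permutation couples all initial states: the new colour is its first entry that no neighbour
  blocks, hence among its first Delta + 1 entries whatever the state. A neighbour of unknown colour
  thus threatens at most Delta + 1 colours out of at least q - Delta + 1, and Delta (Delta + 1) < q
  - Delta + 1 makes the spread of ignorance subcritical. With Delta = 2d, q >= Delta (Delta + 2) is
  the assumption of the theorem. The stationary law is not itself a function of independent slots.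
  In the drop and in the lower bound it is replaced by the law at a time B log n, which is close
  enough to it. The location of the cutoff is never identified: it suffices that the distance drops
  from 1 - eps to eps within O(log log n), and that mixing takes a time of order log n.\<close>

abbreviation unit_exp :: "real measure" where
  "unit_exp \<equiv> density lborel (exponential_density 1)"

lemma prob_unit_exp: "prob_space unit_exp"
  by (rule prob_space_exponential_density) simp

lemma unit_exp_memoryless:
  assumes "0 \<le> u" and [measurable]: "A \<in> sets borel"
  shows "emeasure unit_exp {v. u < v \<and> v - u \<in> A} = ennreal (exp (- u)) * emeasure unit_exp A"
proof -
  have [measurable]: "{v. u < v \<and> v - u \<in> A} \<in> sets borel" by measurable
  have "emeasure unit_exp {v. u < v \<and> v - u \<in> A} =
      (\<integral>\<^sup>+v. ennreal (exponential_density 1 v) * indicator {v. u < v \<and> v - u \<in> A} v \<partial>lborel)"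
    by (subst emeasure_density) auto
  also have "\<dots> = (\<integral>\<^sup>+w. ennreal (exponential_density 1 (u + w)) * indicator {v. u < v \<and> v - u \<in> A} (u + w) \<partial>lborel)"
    by (subst nn_integral_real_affine[of _ 1 u]) auto
  also have "\<dots> = (\<integral>\<^sup>+w. ennreal (exp (- u)) * (ennreal (exponential_density 1 w) * indicator A w) \<partial>lborel)"
  proof (rule nn_integral_cong_AE)
    show "AE w in lborel. ennreal (exponential_density 1 (u + w)) * indicator {v. u < v \<and> v - u \<in> A} (u + w) =
      ennreal (exp (- u)) * (ennreal (exponential_density 1 w) * indicator A w)"
      \<comment> \<open>The event on the left excludes \<open>w = 0\<close>, while \<open>A\<close>
        may contain it; this is a null set.\<close>
      using AE_lborel_singleton[of 0]
    proof eventually_elim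
      case (elim w)
      then show ?case using assms(1)
        by (auto simp: exponential_density_def indicator_def exp_diff exp_minus field_simps ennreal_mult'[symmetric]
              simp flip: exp_add)
    qed
  qed
  also have "\<dots> = ennreal (exp (- u)) * emeasure unit_exp A"
    by (subst nn_integral_cmult) (auto simp: emeasure_density)
  finally show ?thesis .
qed

text \<open>After the first ring, at site \<open>x\<close> and time \<open>u\<close>, the clocks start afresh: gap \<open>p\<close> of the
  restarted clocks is gap \<open>lift_idx x p\<close> of the old ones, minus \<open>u\<close> for the gaps in progress.\<close>

definition lift_idx :: "'v \<Rightarrow> 'v \<times> nat \<Rightarrow> 'v \<times> nat" where
  "lift_idx x p = (if fst p = x then (x, Suc (snd p)) else p)"

definition restart :: "'v set \<Rightarrow> 'v \<Rightarrow> real \<Rightarrow> ('v \<times> nat \<Rightarrow> real) \<Rightarrow> 'v \<times> nat \<Rightarrow> real" where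
  "restart \<Lambda> x u \<omega> = (\<lambda>p\<in>\<Lambda> \<times> UNIV. \<omega> (lift_idx x p) - (if fst p \<noteq> x \<and> snd p = 0 then u else 0))"

lemma inj_lift_idx: "inj (lift_idx x)"
  by (auto simp: inj_def lift_idx_def split: if_splits)

lemma lift_idx_image: "x \<in> \<Lambda> \<Longrightarrow> lift_idx x ` (\<Lambda> \<times> UNIV) = \<Lambda> \<times> UNIV - {(x, 0)}"
proof (intro equalityI subsetI)
  fix p :: "'a \<times> nat" assume x: "x \<in> \<Lambda>" and p: "p \<in> \<Lambda> \<times> UNIV - {(x, 0)}"
  then obtain y k where yk: "p = (y, k)" "y \<in> \<Lambda>" "y = x \<longrightarrow> k \<noteq> 0" by (cases p) auto
  show "p \<in> lift_idx x ` (\<Lambda> \<times> UNIV)"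
  proof (cases "y = x")
    case True
    then obtain j where "k = Suc j" using yk(3) by (cases k) auto
    then have "p = lift_idx x (x, j)" using True yk by (simp add: lift_idx_def)
    then show ?thesis using x by blast
  next
    case False
    then have "p = lift_idx x p" using yk by (simp add: lift_idx_def)
    then show ?thesis using yk by blast
  qed
qed (auto simp: lift_idx_def split: if_splits)

text \<open>Each of the \<open>card \<Lambda> - 1\<close> gaps still in progress contributes a
  factor \<open>exp (- u)\<close> by lack of memory and leaves a fresh exponential gap; the other
  gaps are merely renumbered. Both sides are finite measures in \<open>B\<close>, so it suffices to
  compare them on cylinders.\<close>

lemma restart_measure:
  fixes \<Lambda> :: "'v::countable set"
  assumes L: "finite \<Lambda>" "x \<in> \<Lambda>" and u: "0 \<le> u" and B: "B \<in> sets (poisson_clocks \<Lambda>)"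
  defines "I' \<equiv> \<Lambda> \<times> UNIV - {(x, 0)}"
  shows "emeasure (\<Pi>\<^sub>M p\<in>I'. unit_exp)
      {\<omega> \<in> space (\<Pi>\<^sub>M p\<in>I'. unit_exp). (\<forall>y\<in>\<Lambda> - {x}. u < \<omega> (y, 0)) \<and> restart \<Lambda> x u \<omega> \<in> B}
    = ennreal (exp (- (real (card \<Lambda> - 1) * u))) * emeasure (poisson_clocks \<Lambda>) B"
proof -
  let ?I = "\<Lambda> \<times> (UNIV :: nat set)"
  let ?M' = "\<Pi>\<^sub>M p\<in>I'. unit_exp" and ?M = "\<Pi>\<^sub>M p\<in>?I. unit_exp"
  interpret E: prob_space unit_exp by (rule prob_unit_exp)
  interpret M': prob_space ?M' by (intro prob_space_PiM prob_unit_exp)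
  interpret M: prob_space ?M by (intro prob_space_PiM prob_unit_exp)
  have liftI: "lift_idx x p \<in> I'" if "p \<in> ?I" for p
    using that lift_idx_image[OF L(2)] unfolding I'_def by blast
  have m1: "(\<lambda>\<omega>. \<omega> p) \<in> borel_measurable ?M'" if "p \<in> I'" for p
  proof -
    have "(\<lambda>\<omega>. \<omega> p) \<in> ?M' \<rightarrow>\<^sub>M unit_exp" using that by (rule measurable_component_singleton)
    then show ?thesis by simp
  qed
  have mr: "restart \<Lambda> x u \<in> ?M' \<rightarrow>\<^sub>M ?M"
    unfolding restart_def
  proof (intro measurable_restrict)
    fix p assume "p \<in> ?I"
    then have "(\<lambda>\<omega>. \<omega> (lift_idx x p) - (if fst p \<noteq> x \<and> snd p = 0 then u else 0)) \<in> borel_measurable ?M'"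
      by (intro borel_measurable_diff m1 liftI) auto
    then show "(\<lambda>\<omega>. \<omega> (lift_idx x p) - (if fst p \<noteq> x \<and> snd p = 0 then u else 0)) \<in> ?M' \<rightarrow>\<^sub>M unit_exp"
      by simp
  qed
  define H where "H = {\<omega> \<in> space ?M'. \<forall>y\<in>\<Lambda> - {x}. u < \<omega> (y, 0)}"
  have H: "H \<in> sets ?M'"
    unfolding H_def
  proof (intro sets.sets_Collect_finite_All)
    fix y assume "y \<in> \<Lambda> - {x}"
    then have "(\<lambda>\<omega>. \<omega> (y, 0)) \<in> borel_measurable ?M'" by (intro m1) (auto simp: I'_def)
    then show "{\<omega> \<in> space ?M'. u < \<omega> (y, 0)} \<in> sets ?M'" by measurable
  qed (use L in auto)
  let ?c = "ennreal (exp (- (real (card \<Lambda> - 1) * u)))"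
  let ?P = "scale_measure ?c ?M" and ?Q = "distr (density ?M' (indicator H)) ?M (restart \<Lambda> x u)"
  have "?P = ?Q"
  proof (rule measure_eqI_PiM_infinite)
    show "finite_measure ?P"
      by (rule finite_measureI) (simp add: M.emeasure_space_1 ennreal_mult_eq_top_iff)
  next
    fix A and J :: "('v \<times> nat) set"
    assume J: "finite J" "J \<subseteq> ?I" and A: "\<And>i. i \<in> J \<Longrightarrow> A i \<in> sets unit_exp"
    \<comment> \<open>The cylinder is enlarged by the first gaps of all other sites, unconstrained,
      so that the event \<open>H\<close> that none of them has ended becomes part of the same
      cylinder.\<close>
    define J2 where "J2 = J \<union> (\<Lambda> - {x}) \<times> {0}"
    define A2 where "A2 j = (if j \<in> J then A j else UNIV)" for j
    define c where "c j = (if fst j \<noteq> x \<and> snd j = 0 then u else 0)" for j :: "'v \<times> nat"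
    define A' where "A' i = (let j = inv (lift_idx x) i in
       if fst j \<noteq> x \<and> snd j = 0 then {v. u < v \<and> v - u \<in> A2 j} else A2 j)" for i
    have J2: "finite J2" "J2 \<subseteq> ?I" using J L by (auto simp: J2_def)
    have A2: "A2 j \<in> sets borel" for j using A by (auto simp: A2_def)
    have inv: "inv (lift_idx x) (lift_idx x j) = j" for j by (rule inv_f_f[OF inj_lift_idx])
    have A'm: "A' i \<in> sets borel" for i
    proof -
      have [measurable]: "A2 (inv (lift_idx x) i) \<in> sets borel" by (rule A2)
      have "{v. u < v \<and> v - u \<in> A2 (inv (lift_idx x) i)} \<in> sets borel" by measurable
      then show ?thesis unfolding A'_def Let_def by (simp add: A2)
    qed
    have E1: "emeasure unit_exp UNIV = 1" using E.emeasure_space_1 by simp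
    have A_eq: "(\<Prod>j\<in>J. emeasure unit_exp (A j)) = (\<Prod>j\<in>J2. emeasure unit_exp (A2 j))"
      using J2 by (intro prod.mono_neutral_cong_left) (auto simp: J2_def A2_def E1)
    have c_eq: "?c = (\<Prod>j\<in>J2. ennreal (exp (- c j)))"
    proof -
      have "(\<Prod>j\<in>J2. ennreal (exp (- c j))) = (\<Prod>j\<in>(\<Lambda> - {x}) \<times> {0::nat}. ennreal (exp (- u)))"
        using J2 by (intro prod.mono_neutral_cong_right) (auto simp: J2_def c_def)
      also have "\<dots> = ennreal (exp (- u) ^ (card \<Lambda> - 1))"
        using L by (simp add: card_cartesian_product ennreal_power)
      also have "exp (- u) ^ (card \<Lambda> - 1) = exp (- (real (card \<Lambda> - 1) * u))"
        by (simp add: exp_of_nat_mult[symmetric])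
      finally show ?thesis by simp
    qed
    have "emeasure ?P (prod_emb ?I (\<lambda>_. unit_exp) J (Pi\<^sub>E J A)) = ?c * (\<Prod>j\<in>J. emeasure unit_exp (A j))"
      using J A by (simp add: emeasure_PiM_emb prob_unit_exp)
    also have "\<dots> = (\<Prod>j\<in>J2. emeasure unit_exp (A' (lift_idx x j)))"
      unfolding A_eq c_eq prod.distrib[symmetric]
      by (intro prod.cong refl) (simp add: A'_def inv c_def unit_exp_memoryless[OF u A2])
    also have "\<dots> = (\<Prod>i\<in>lift_idx x ` J2. emeasure unit_exp (A' i))"
      by (subst prod.reindex) (auto intro: inj_on_subset[OF inj_lift_idx])
    also have "\<dots> = emeasure ?M' (prod_emb I' (\<lambda>_. unit_exp) (lift_idx x ` J2) (Pi\<^sub>E (lift_idx x ` J2) A'))"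
      using J2 liftI A'm by (subst emeasure_PiM_emb) (auto simp: prob_unit_exp)
    also have "prod_emb I' (\<lambda>_. unit_exp) (lift_idx x ` J2) (Pi\<^sub>E (lift_idx x ` J2) A') =
        H \<inter> (restart \<Lambda> x u -` prod_emb ?I (\<lambda>_. unit_exp) J (Pi\<^sub>E J A) \<inter> space ?M')" (is "?L = ?R")
    proof -
      have "\<omega> \<in> ?L \<longleftrightarrow> \<omega> \<in> ?R" if w: "\<omega> \<in> space ?M'" for \<omega>
      proof -
        have rs: "restart \<Lambda> x u \<omega> \<in> space ?M" using mr w by (rule measurable_space)
        have "\<omega> \<in> ?L \<longleftrightarrow> (\<forall>j\<in>J2. \<omega> (lift_idx x j) \<in> A' (lift_idx x j))"
          using w by (auto simp: prod_emb_def space_PiM PiE_iff restrict_def extensional_def)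
        also have "\<dots> \<longleftrightarrow> (\<forall>j\<in>J2. (fst j \<noteq> x \<and> snd j = 0 \<longrightarrow> u < \<omega> j) \<and> restart \<Lambda> x u \<omega> j \<in> A2 j)"
        proof (intro ball_cong refl)
          fix j assume "j \<in> J2"
          then have "fst j \<in> \<Lambda>" using J2 by auto
          moreover have "A' (lift_idx x j) = (if fst j \<noteq> x \<and> snd j = 0 then {v. u < v \<and> v - u \<in> A2 j} else A2 j)"
            by (simp add: A'_def inv)
          ultimately show "\<omega> (lift_idx x j) \<in> A' (lift_idx x j) \<longleftrightarrow>
              (fst j \<noteq> x \<and> snd j = 0 \<longrightarrow> u < \<omega> j) \<and> restart \<Lambda> x u \<omega> j \<in> A2 j"
            by (cases j) (auto simp: restart_def lift_idx_def)
        qed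
        also have "\<dots> \<longleftrightarrow> (\<forall>y\<in>\<Lambda> - {x}. u < \<omega> (y, 0)) \<and> (\<forall>j\<in>J. restart \<Lambda> x u \<omega> j \<in> A j)"
        proof (intro iffI conjI ballI)
          fix y assume "\<forall>j\<in>J2. (fst j \<noteq> x \<and> snd j = 0 \<longrightarrow> u < \<omega> j) \<and> restart \<Lambda> x u \<omega> j \<in> A2 j"
            and "y \<in> \<Lambda> - {x}"
          then show "u < \<omega> (y, 0)" by (auto simp: J2_def dest: bspec[where x="(y, 0)"])
        next
          fix j assume "\<forall>j\<in>J2. (fst j \<noteq> x \<and> snd j = 0 \<longrightarrow> u < \<omega> j) \<and> restart \<Lambda> x u \<omega> j \<in> A2 j"
            and "j \<in> J"
          then show "restart \<Lambda> x u \<omega> j \<in> A j" by (auto simp: J2_def A2_def dest: bspec[where x=j])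
        qed (use J in \<open>auto simp: J2_def A2_def\<close>)
        also have "\<dots> \<longleftrightarrow> \<omega> \<in> ?R"
          using w rs J by (auto simp: H_def prod_emb_def space_PiM PiE_iff restrict_def extensional_def)
        finally show ?thesis .
      qed
      moreover have "?L \<subseteq> space ?M'" by (auto simp: prod_emb_def space_PiM)
      ultimately show ?thesis by blast
    qed
    also have "emeasure ?M' \<dots> = emeasure ?Q (prod_emb ?I (\<lambda>_. unit_exp) J (Pi\<^sub>E J A))"
    proof -
      have s: "prod_emb ?I (\<lambda>_. unit_exp) J (Pi\<^sub>E J A) \<in> sets ?M"
        using J A by (intro sets_PiM_I) auto
      have s': "restart \<Lambda> x u -` prod_emb ?I (\<lambda>_. unit_exp) J (Pi\<^sub>E J A) \<inter> space ?M' \<in> sets ?M'"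
        by (rule measurable_sets[OF mr s])
      show ?thesis using s s' H mr
        by (subst emeasure_distr) (simp_all add: emeasure_restricted)
    qed
    finally show "emeasure ?P (prod_emb ?I (\<lambda>_. unit_exp) J (Pi\<^sub>E J A)) =
      emeasure ?Q (prod_emb ?I (\<lambda>_. unit_exp) J (Pi\<^sub>E J A))" .
  qed auto
  then have "?c * emeasure ?M B = emeasure ?Q B"
    by (metis emeasure_scale_measure)
  moreover have "emeasure ?Q B = emeasure ?M' (H \<inter> (restart \<Lambda> x u -` B \<inter> space ?M'))"
  proof -
    have s: "B \<in> sets ?M" using B by (simp add: poisson_clocks_def)
    have s': "restart \<Lambda> x u -` B \<inter> space ?M' \<in> sets ?M'" by (rule measurable_sets[OF mr s])
    show ?thesis using s s' H mr
      by (subst emeasure_distr) (simp_all add: emeasure_restricted)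
  qed
  moreover have "H \<inter> (restart \<Lambda> x u -` B \<inter> space ?M') =
      {\<omega> \<in> space ?M'. (\<forall>y\<in>\<Lambda> - {x}. u < \<omega> (y, 0)) \<and> restart \<Lambda> x u \<omega> \<in> B}"
    by (auto simp: H_def)
  ultimately show ?thesis by (simp add: poisson_clocks_def)
qed

text \<open>A part of the event that the ring sequence is \<open>xs\<close> on which the list in the
  definite description provably exists. Positivity of the gaps is part of the event because it puts
  every later ring strictly after the first one.\<close>

definition good_clocks :: "'v set \<Rightarrow> 'v list \<Rightarrow> real \<Rightarrow> ('v \<times> nat \<Rightarrow> real) set" where
  "good_clocks \<Lambda> xs t = {\<omega> \<in> space (poisson_clocks \<Lambda>). (\<forall>p\<in>\<Lambda> \<times> UNIV. 0 < \<omega> p) \<and>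
     (\<exists>ps. map fst ps = xs \<and> set ps = rings \<Lambda> t \<omega> \<and> sorted_wrt (<) (map (ring_time \<omega>) ps))}"

lemma ring_sequence_good:
  assumes "\<omega> \<in> good_clocks \<Lambda> xs t"
  shows "ring_sequence \<Lambda> t \<omega> = xs"
proof -
  let ?P = "\<lambda>ps. set ps = rings \<Lambda> t \<omega> \<and> sorted_wrt (<) (map (ring_time \<omega>) ps)"
  obtain ps where ps: "map fst ps = xs" "?P ps" using assms by (auto simp: good_clocks_def)
  have "qs = ps" if "?P qs" for qs
  proof -
    have "map (ring_time \<omega>) ps = map (ring_time \<omega>) qs"
      using that ps strict_sorted_equal[of "map (ring_time \<omega>) ps" "map (ring_time \<omega>) qs"]
      by (metis list.set_map)
    moreover have "inj_on (ring_time \<omega>) (set ps \<union> set qs)"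
      using that ps by (metis Un_absorb distinct_map strict_sorted_iff)
    ultimately show ?thesis by (metis map_inj_on)
  qed
  then have "(THE ps. ?P ps) = ps" using ps(2) by (rule the_equality[rotated])
  then show ?thesis using ps(1) unfolding ring_sequence_def by simp
qed

lemma clock_coordinate_measurable:
  "p \<in> \<Lambda> \<times> UNIV \<Longrightarrow> (\<lambda>\<omega>. \<omega> p) \<in> borel_measurable (poisson_clocks \<Lambda>)"
  using measurable_component_singleton[of p "\<Lambda> \<times> UNIV" "\<lambda>_. unit_exp"]
  by (simp add: poisson_clocks_def)

lemma good_clocks_sets:
  fixes \<Lambda> :: "'v::countable set"
  shows "good_clocks \<Lambda> xs t \<in> sets (poisson_clocks \<Lambda>)"
proof -
  have c: "(\<lambda>\<omega>. \<omega> p) \<in> borel_measurable (poisson_clocks \<Lambda>)" for p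
  proof (cases "p \<in> \<Lambda> \<times> UNIV")
    case False
    then have "\<And>\<omega>. \<omega> \<in> space (poisson_clocks \<Lambda>) \<Longrightarrow> \<omega> p = undefined"
      by (cases p) (auto simp: poisson_clocks_def space_PiM PiE_def extensional_def)
    then show ?thesis by (subst measurable_cong[where g="\<lambda>_. undefined"]) auto
  qed (rule clock_coordinate_measurable)
  note [measurable] = c
  have rt [measurable]: "(\<lambda>\<omega>. ring_time \<omega> p) \<in> borel_measurable (poisson_clocks \<Lambda>)" for p
    unfolding ring_time_def by (intro borel_measurable_sum c)
  have eq: "good_clocks \<Lambda> xs t = {\<omega> \<in> space (poisson_clocks \<Lambda>). (\<forall>p. p \<in> \<Lambda> \<times> UNIV \<longrightarrow> 0 < \<omega> p) \<and>
     (\<exists>ps. map fst ps = xs \<and> (\<forall>p. (p \<in> set ps) = (p \<in> \<Lambda> \<times> UNIV \<and> ring_time \<omega> p \<le> t)) \<and>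
     (\<forall>i<length ps. \<forall>j<i. ring_time \<omega> (ps!j) < ring_time \<omega> (ps!i)))}"
    unfolding good_clocks_def by (auto simp: rings_def sorted_wrt_iff_nth_less set_eq_iff)
  show ?thesis unfolding eq by measurable
qed

lemma ring_time_restart:
  assumes "x \<in> \<Lambda>" "p \<in> \<Lambda> \<times> UNIV" "\<omega> (x, 0) = u"
  shows "ring_time \<omega> (lift_idx x p) = u + ring_time (restart \<Lambda> x u \<omega>) p"
proof (cases "fst p = x")
  case True
  then have "ring_time \<omega> (lift_idx x p) = (\<Sum>j\<le>Suc (snd p). \<omega> (x, j))"
    by (simp add: ring_time_def lift_idx_def)
  also have "\<dots> = \<omega> (x, 0) + (\<Sum>j\<le>snd p. \<omega> (x, Suc j))" by (rule sum.atMost_Suc_shift)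
  also have "(\<Sum>j\<le>snd p. \<omega> (x, Suc j)) = ring_time (restart \<Lambda> x u \<omega>) p"
    using True assms by (simp add: ring_time_def restart_def lift_idx_def)
  finally show ?thesis using assms by simp
next
  case False
  have "ring_time (restart \<Lambda> x u \<omega>) p = (\<Sum>j\<le>snd p. \<omega> (fst p, j) - (if j = 0 then u else 0))"
    using False assms by (auto simp: ring_time_def restart_def lift_idx_def intro!: sum.cong)
  also have "\<dots> = (\<Sum>j\<le>snd p. \<omega> (fst p, j)) - u" by (simp add: sum_subtractf)
  finally show ?thesis using False by (simp add: ring_time_def lift_idx_def)
qed

text \<open>All ring times of the restarted clocks are positive and are shifted by the same
  \<open>u\<close>, so their order survives and the ring of \<open>x\<close> at time
  \<open>u\<close> precedes them.\<close>

lemma good_clocks_Cons: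
  assumes x: "x \<in> \<Lambda>" and w: "\<omega> \<in> space (poisson_clocks \<Lambda>)"
    and u: "\<omega> (x, 0) = u" "0 < u" "u \<le> t" and y: "\<forall>y\<in>\<Lambda> - {x}. u < \<omega> (y, 0)"
    and g: "restart \<Lambda> x u \<omega> \<in> good_clocks \<Lambda> xs (t - u)"
  shows "\<omega> \<in> good_clocks \<Lambda> (x # xs) t"
proof -
  let ?\<eta> = "restart \<Lambda> x u \<omega>"
  obtain ps where ps: "map fst ps = xs" "set ps = rings \<Lambda> (t - u) ?\<eta>"
      "sorted_wrt (<) (map (ring_time ?\<eta>) ps)"
    and pos: "\<And>p. p \<in> \<Lambda> \<times> UNIV \<Longrightarrow> 0 < ?\<eta> p"
    using g by (auto simp: good_clocks_def)
  have psI: "set ps \<subseteq> \<Lambda> \<times> UNIV" using ps(2) by (auto simp: rings_def)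
  define qs where "qs = (x, 0) # map (lift_idx x) ps"
  have rt0: "ring_time \<omega> (x, 0) = u" using u by (simp add: ring_time_def)
  have rt: "ring_time \<omega> (lift_idx x p) = u + ring_time ?\<eta> p" if "p \<in> \<Lambda> \<times> UNIV" for p
    using x that u(1) by (rule ring_time_restart)
  have rpos: "0 < ring_time ?\<eta> p" if "p \<in> \<Lambda> \<times> UNIV" for p
    unfolding ring_time_def using that by (intro sum_pos pos) auto
  have I: "\<Lambda> \<times> UNIV = insert (x, 0) (lift_idx x ` (\<Lambda> \<times> UNIV))"
    unfolding lift_idx_image[OF x] using x by blast
  have wpos: "0 < \<omega> p" if "p \<in> \<Lambda> \<times> UNIV" for p
  proof -
    have "p \<in> insert (x, 0) (lift_idx x ` (\<Lambda> \<times> UNIV))" by (rule subsetD[OF equalityD1[OF I] that])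
    then consider "p = (x, 0)" | r where "r \<in> \<Lambda> \<times> UNIV" "p = lift_idx x r" by blast
    then show ?thesis
    proof cases
      case 2
      have "0 < ?\<eta> r" by (rule pos[OF 2(1)])
      also have "\<dots> \<le> \<omega> p" using 2 u by (auto simp: restart_def)
      finally show ?thesis .
    qed (use u in auto)
  qed
  have "map fst qs = x # xs"
    unfolding qs_def ps(1)[symmetric] by (auto simp: lift_idx_def)
  moreover have "set qs = rings \<Lambda> t \<omega>"
  proof -
    have "rings \<Lambda> t \<omega> = {p \<in> insert (x, 0) (lift_idx x ` (\<Lambda> \<times> UNIV)). ring_time \<omega> p \<le> t}"
      unfolding rings_def I[symmetric] ..
    also have "\<dots> = insert (x, 0) (lift_idx x ` rings \<Lambda> (t - u) ?\<eta>)"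
      using rt0 u(3) unfolding rings_def by (auto simp: rt)
    finally show ?thesis by (simp add: qs_def ps(2))
  qed
  moreover have "sorted_wrt (<) (map (ring_time \<omega>) qs)"
  proof -
    have "map (ring_time \<omega>) (map (lift_idx x) ps) = map (\<lambda>r. u + r) (map (ring_time ?\<eta>) ps)"
      using psI rt by auto
    moreover have "sorted_wrt (<) (map (\<lambda>r. u + r) (map (ring_time ?\<eta>) ps))"
      using ps(3) by (simp add: sorted_wrt_map)
    ultimately have "sorted_wrt (<) (map (ring_time \<omega>) (map (lift_idx x) ps))" by (simp only:)
    moreover have "ring_time \<omega> (x, 0) < ring_time \<omega> (lift_idx x p)" if "p \<in> set ps" for p
      using psI rpos[of p] rt[of p] that unfolding rt0 by auto
    ultimately show ?thesis by (simp add: qs_def)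
  qed
  ultimately show ?thesis unfolding good_clocks_def mem_Collect_eq
    by (intro conjI ballI exI[of _ qs] w wpos)
qed

text \<open>A lower bound suffices, because the left-hand sides add up to 1.\<close>

lemma good_clocks_lower:
  fixes \<Lambda> :: "'v::countable set" and t :: real
  assumes L: "finite \<Lambda>" "\<Lambda> \<noteq> {}" and xs: "set xs \<subseteq> \<Lambda>" and t: "0 \<le> t"
  shows "ennreal (exp (- (card \<Lambda> * t)) * t ^ length xs / fact (length xs))
    \<le> emeasure (poisson_clocks \<Lambda>) (good_clocks \<Lambda> xs t)"
  using xs t
proof (induction xs arbitrary: t)
  case Nil
  let ?I = "\<Lambda> \<times> (UNIV :: nat set)"
  let ?J = "\<Lambda> \<times> {0::nat}"
  interpret P: prob_space "poisson_clocks \<Lambda>" unfolding poisson_clocks_def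
    by (intro prob_space_PiM prob_unit_exp)
  interpret E: prob_space unit_exp by (rule prob_unit_exp)
  have E1: "emeasure unit_exp UNIV = 1" using E.emeasure_space_1 by simp
  have tail: "emeasure unit_exp {t<..} = ennreal (exp (- t))"
    using unit_exp_memoryless[OF Nil.prems(2), of UNIV] E1 by (simp add: greaterThan_def)
  have tail0: "emeasure unit_exp {0<..} = 1"
    using unit_exp_memoryless[of 0 UNIV] E1 by (simp add: greaterThan_def)
  \<comment> \<open>Exponential gaps are almost surely positive, so a ring time is at least the
    first gap of its site; first gaps beyond \<open>t\<close> then rule out any ring up to
    \<open>t\<close>.\<close>
  have pos: "AE \<omega> in poisson_clocks \<Lambda>. \<forall>p\<in>?I. 0 < \<omega> p"
  proof (subst AE_ball_countable, simp, intro ballI)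
    fix p assume p: "p \<in> ?I"
    have "emeasure (poisson_clocks \<Lambda>) (prod_emb ?I (\<lambda>_. unit_exp) {p} (Pi\<^sub>E {p} (\<lambda>_. {0<..}))) = (\<Prod>i\<in>{p}. emeasure unit_exp {0<..})"
      unfolding poisson_clocks_def
      by (rule emeasure_PiM_emb) (use p in \<open>simp_all add: prob_unit_exp\<close>)
    then have "AE \<omega> in poisson_clocks \<Lambda>. \<omega> \<in> prod_emb ?I (\<lambda>_. unit_exp) {p} (Pi\<^sub>E {p} (\<lambda>_. {0<..}))"
      using p by (subst P.AE_in_set_eq_1)
        (simp_all add: tail0 P.emeasure_eq_measure, simp add: poisson_clocks_def sets_PiM_I)
    then show "AE \<omega> in poisson_clocks \<Lambda>. 0 < \<omega> p"
      by eventually_elim (auto simp: prod_emb_def PiE_iff)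
  qed
  let ?X = "prod_emb ?I (\<lambda>_. unit_exp) ?J (Pi\<^sub>E ?J (\<lambda>_. {t<..}))"
  have "emeasure (poisson_clocks \<Lambda>) ?X = (\<Prod>i\<in>?J. emeasure unit_exp {t<..})"
    unfolding poisson_clocks_def using L by (subst emeasure_PiM_emb) (auto simp: prob_unit_exp)
  also have "\<dots> = ennreal (exp (- t) ^ card \<Lambda>)"
    unfolding tail by (simp add: card_cartesian_product ennreal_power)
  also have "exp (- t) ^ card \<Lambda> = exp (- (card \<Lambda> * t))"
    by (simp add: exp_of_nat_mult[symmetric])
  finally have "ennreal (exp (- (card \<Lambda> * t))) = emeasure (poisson_clocks \<Lambda>) ?X" by simp
  also have "\<dots> \<le> emeasure (poisson_clocks \<Lambda>) (good_clocks \<Lambda> [] t)"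
  proof (rule emeasure_mono_AE)
    show "AE \<omega> in poisson_clocks \<Lambda>. \<omega> \<in> ?X \<longrightarrow> \<omega> \<in> good_clocks \<Lambda> [] t"
      using pos AE_space
    proof eventually_elim
      case (elim \<omega>)
      show ?case
      proof
        assume X: "\<omega> \<in> ?X"
        have "t < ring_time \<omega> p" if p: "p \<in> ?I" for p
        proof -
          have "t < \<omega> (fst p, 0)" using X p by (auto simp: prod_emb_def PiE_iff)
          also have "\<dots> \<le> ring_time \<omega> p"
            unfolding ring_time_def using elim(1) p by (intro member_le_sum) (auto intro: less_imp_le)
          finally show ?thesis .
        qed
        then have "rings \<Lambda> t \<omega> = {}" by (auto simp: rings_def not_le)
        then show "\<omega> \<in> good_clocks \<Lambda> [] t" using elim by (auto simp: good_clocks_def)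
      qed
    qed
  qed (rule good_clocks_sets)
  finally show ?case by simp
next
  case (Cons x xs)
  let ?I' = "\<Lambda> \<times> UNIV - {(x, 0::nat)}"
  let ?M' = "\<Pi>\<^sub>M p\<in>?I'. unit_exp" and ?N = "real (card \<Lambda>)" and ?k = "length xs"
  let ?G = "good_clocks \<Lambda> (x # xs) t"
  have x: "x \<in> \<Lambda>" and xs: "set xs \<subseteq> \<Lambda>" using Cons.prems by auto
  have I: "insert (x, 0) ?I' = \<Lambda> \<times> UNIV" using x by auto
  interpret E: prob_space unit_exp by (rule prob_unit_exp)
  interpret M': prob_space ?M' by (intro prob_space_PiM prob_unit_exp)
  have N1: "real (card \<Lambda> - 1) = ?N - 1" using L by (simp add: Suc_leI card_gt_0_iff of_nat_diff)
  \<comment> \<open>The gap that ends first is split off as an independent factor, to be integrated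
    over its value \<open>u\<close>.\<close>
  have PC: "poisson_clocks \<Lambda> = distr (unit_exp \<Otimes>\<^sub>M ?M') (poisson_clocks \<Lambda>) (\<lambda>(v, \<omega>). fun_upd \<omega> (x, 0) v)"
    unfolding poisson_clocks_def
    using distr_pair_PiM_eq_PiM[of ?I' "\<lambda>_. unit_exp" "(x, 0)"] prob_unit_exp unfolding I by simp
  have mp: "(\<lambda>(v, \<omega>). fun_upd \<omega> (x, 0) v) \<in> unit_exp \<Otimes>\<^sub>M ?M' \<rightarrow>\<^sub>M poisson_clocks \<Lambda>"
  proof -
    have "(\<lambda>(v, \<omega>). fun_upd \<omega> (x, 0) v) \<in> unit_exp \<Otimes>\<^sub>M ?M' \<rightarrow>\<^sub>M (\<Pi>\<^sub>M p\<in>insert (x, 0) ?I'. unit_exp)"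
      by measurable
    then show ?thesis unfolding I poisson_clocks_def .
  qed
  let ?V = "(\<lambda>(v, \<omega>). fun_upd \<omega> (x, 0) v) -` ?G \<inter> space (unit_exp \<Otimes>\<^sub>M ?M')"
  have V: "?V \<in> sets (unit_exp \<Otimes>\<^sub>M ?M')"
    by (rule measurable_sets[OF mp good_clocks_sets])
  let ?h = "\<lambda>u. exp (- (?N * t)) * (t - u) ^ ?k / fact ?k"
  \<comment> \<open>Given the value \<open>u\<close>, the other sites stay silent until
    \<open>u\<close> with weight exp (- (N - 1) u), and the restarted clocks are good for
    \<open>xs\<close> with the weight from the induction hypothesis.\<close>
  have inner: "ennreal (exp (- ((?N - 1) * u)) * (exp (- (?N * (t - u))) * (t - u) ^ ?k / fact ?k))
      \<le> emeasure ?M' (Pair u -` ?V)" if u: "0 < u" "u \<le> t" for u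
  proof -
    let ?B = "good_clocks \<Lambda> xs (t - u)"
    let ?S = "{\<omega> \<in> space ?M'. (\<forall>y\<in>\<Lambda> - {x}. u < \<omega> (y, 0)) \<and> restart \<Lambda> x u \<omega> \<in> ?B}"
    have "ennreal (exp (- ((?N - 1) * u)) * (exp (- (?N * (t - u))) * (t - u) ^ ?k / fact ?k)) =
        ennreal (exp (- ((?N - 1) * u))) * ennreal (exp (- (?N * (t - u))) * (t - u) ^ ?k / fact ?k)"
      by (rule ennreal_mult') simp
    also have "\<dots> \<le> ennreal (exp (- ((?N - 1) * u))) * emeasure (poisson_clocks \<Lambda>) ?B"
      using Cons.IH[OF xs, of "t - u"] u by (intro mult_left_mono) auto
    also have "\<dots> = emeasure ?M' ?S"
      using restart_measure[OF L(1) x less_imp_le[OF u(1)] good_clocks_sets, of xs "t - u"]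
      unfolding N1 by simp
    also have "\<dots> \<le> emeasure ?M' (Pair u -` ?V)"
    proof (rule emeasure_mono)
      show "Pair u -` ?V \<in> sets ?M'" by (rule sets_Pair1[OF V])
      show "?S \<subseteq> Pair u -` ?V"
      proof
        fix \<omega> assume w: "\<omega> \<in> ?S"
        let ?w = "fun_upd \<omega> (x, 0) u"
        have sp: "(u, \<omega>) \<in> space (unit_exp \<Otimes>\<^sub>M ?M')" using w by (simp add: space_pair_measure)
        have wsp: "?w \<in> space (poisson_clocks \<Lambda>)" using measurable_space[OF mp sp] by simp
        have "restart \<Lambda> x u ?w = restart \<Lambda> x u \<omega>"
          unfolding restart_def by (intro restrict_ext) (auto simp: lift_idx_def)
        then have "?w \<in> ?G"
          using w u by (intro good_clocks_Cons[OF x wsp]) auto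
        then show "\<omega> \<in> Pair u -` ?V" using sp by simp
      qed
    qed
    finally show ?thesis .
  qed
  have "ennreal (exp (- (card \<Lambda> * t)) * t ^ length (x # xs) / fact (length (x # xs))) =
      ennreal ((- exp (- (?N * t)) / fact (Suc ?k)) * (t - t) ^ Suc ?k -
        (- exp (- (?N * t)) / fact (Suc ?k)) * (t - 0) ^ Suc ?k)"
    by simp
  \<comment> \<open>All weights multiply to exp (- N t) (t - u)^k / k!, and integrating over
    \<open>u\<close> from 0 to \<open>t\<close> raises \<open>k\<close> by one.\<close>
  also have "\<dots> = (\<integral>\<^sup>+u. ennreal (?h u) * indicator {0..t} u \<partial>lborel)"
  proof (rule nn_integral_FTC_Icc[where F="\<lambda>u. (- exp (- (?N * t)) / fact (Suc ?k)) * (t - u) ^ Suc ?k", symmetric])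
    fix u assume "u \<in> {0..t}"
    have "((\<lambda>u. t - u) has_field_derivative - 1) (at u)"
      by (auto intro!: derivative_eq_intros)
    from DERIV_power_Suc[OF this, of ?k]
    have "((\<lambda>u. (t - u) ^ Suc ?k) has_field_derivative (of_nat (Suc ?k) * (- 1) * (t - u) ^ ?k)) (at u)"
      by (simp add: algebra_simps)
    then have "((\<lambda>u. (- exp (- (?N * t)) / fact (Suc ?k)) * (t - u) ^ Suc ?k) has_field_derivative
        ((- exp (- (?N * t)) / fact (Suc ?k)) * (of_nat (Suc ?k) * (- 1) * (t - u) ^ ?k))) (at u)"
      by (rule DERIV_cmult)
    moreover have "(- exp (- (?N * t)) / fact (Suc ?k)) * (of_nat (Suc ?k) * (- 1) * (t - u) ^ ?k) = ?h u"
      by (simp add: field_simps del: of_nat_Suc)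
    ultimately show "((\<lambda>u. (- exp (- (?N * t)) / fact (Suc ?k)) * (t - u) ^ Suc ?k) has_real_derivative ?h u) (at u)"
      by (simp only:)
    show "0 \<le> ?h u" using \<open>u \<in> {0..t}\<close> by simp
  qed (use Cons.prems in auto)
  also have "\<dots> \<le> (\<integral>\<^sup>+u. ennreal (exponential_density 1 u) * emeasure ?M' (Pair u -` ?V) \<partial>lborel)"
  proof (rule nn_integral_mono_AE)
    show "AE u in lborel. ennreal (?h u) * indicator {0..t} u \<le>
        ennreal (exponential_density 1 u) * emeasure ?M' (Pair u -` ?V)"
      using AE_lborel_singleton[of 0]
    proof eventually_elim
      case (elim u)
      show ?case
      proof (cases "0 < u \<and> u \<le> t")
        case True
        have "exp (- u) * (exp (- ((?N - 1) * u)) * exp (- (?N * (t - u)))) = exp (- (?N * t))"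
          by (simp add: algebra_simps flip: exp_add)
        then have h_eq: "?h u = exp (- u) * (exp (- ((?N - 1) * u)) * (exp (- (?N * (t - u))) * (t - u) ^ ?k / fact ?k))"
          by (simp add: algebra_simps)
        then have "ennreal (?h u) = ennreal (exp (- u)) *
            ennreal (exp (- ((?N - 1) * u)) * (exp (- (?N * (t - u))) * (t - u) ^ ?k / fact ?k))"
          unfolding h_eq by (intro ennreal_mult') simp
        also have "\<dots> \<le> ennreal (exp (- u)) * emeasure ?M' (Pair u -` ?V)"
          using True by (intro mult_left_mono inner) auto
        finally show ?thesis using True by (simp add: exponential_density_def)
      next
        case False
        then have "u \<notin> {0..t}" using elim by auto
        then show ?thesis by simp
      qed
    qed
  qed
  also have "\<dots> = (\<integral>\<^sup>+u. emeasure ?M' (Pair u -` ?V) \<partial>unit_exp)"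
    using M'.measurable_emeasure_Pair[OF V] by (subst nn_integral_density) auto
  also have "\<dots> = emeasure (unit_exp \<Otimes>\<^sub>M ?M') ?V"
    by (rule M'.emeasure_pair_measure_alt[OF V, symmetric])
  also have "\<dots> = emeasure (poisson_clocks \<Lambda>) ?G"
    using emeasure_distr[OF mp good_clocks_sets, of "x # xs" t] arg_cong[OF PC, of "\<lambda>M. emeasure M ?G"]
    by simp
  finally show ?case .
qed

text \<open>Time \<open>0\<close> is a separate case so that, for nonempty \<open>\<Lambda>\<close>
  and positive times, \<open>poisson_pmf\<close> occurs with a positive rate.\<close>

definition site_list_pmf :: "'v set \<Rightarrow> real \<Rightarrow> 'v list pmf" where
  "site_list_pmf \<Lambda> t = (if t = 0 then return_pmf []
     else bind_pmf (poisson_pmf (real (card \<Lambda>) * t)) (\<lambda>k. replicate_pmf k (pmf_of_set \<Lambda>)))"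

lemma pmf_replicate_pmf:
  "pmf (replicate_pmf n p) xs = (if length xs = n then prod_list (map (pmf p) xs) else 0)"
proof (induction n arbitrary: xs)
  case (Suc n)
  have eq: "replicate_pmf (Suc n) p = map_pmf (\<lambda>(x, xs). x # xs) (pair_pmf p (replicate_pmf n p))"
    by (simp add: pair_pmf_def map_bind_pmf)
  show ?case
  proof (cases xs)
    case Nil
    then have "xs \<notin> set_pmf (replicate_pmf (Suc n) p)" by (simp add: set_replicate_pmf)
    then show ?thesis using Nil by (simp add: pmf_eq_0_set_pmf del: replicate_pmf.simps)
  next
    case (Cons y ys)
    have "inj (\<lambda>(x :: 'a, xs). x # xs)" by (auto simp: inj_def)
    from pmf_map_inj'[OF this, of "pair_pmf p (replicate_pmf n p)" "(y, ys)"]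
    show ?thesis unfolding eq Cons by (simp add: pmf_pair Suc.IH)
  qed
qed simp

text \<open>The factor \<open>card \<Lambda> ^ k\<close> in the Poisson weight cancels against the
  uniform choice of \<open>k\<close> sites; what is left is the lower bound found for the
  clocks.\<close>

lemma pmf_site_list_le:
  fixes t :: real
  assumes L: "finite \<Lambda>" "\<Lambda> \<noteq> {}" and t: "0 \<le> t" and xs: "set xs \<subseteq> \<Lambda>"
  shows "pmf (site_list_pmf \<Lambda> t) xs \<le> exp (- (card \<Lambda> * t)) * t ^ length xs / fact (length xs)"
proof (cases "t = 0")
  case True
  then show ?thesis by (cases xs) (auto simp: site_list_pmf_def)
next
  case False
  let ?N = "real (card \<Lambda>)"
  have N: "0 < ?N" using L by (simp add: card_gt_0_iff)
  then have r: "0 < ?N * t" using False t by simp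
  have "prod_list (map (pmf (pmf_of_set \<Lambda>)) xs) = (1 / ?N) ^ length xs"
    using xs L by (induction xs) auto
  moreover have e: "site_list_pmf \<Lambda> t = bind_pmf (poisson_pmf (?N * t)) (\<lambda>k. replicate_pmf k (pmf_of_set \<Lambda>))"
    using False by (simp add: site_list_pmf_def)
  ultimately have "pmf (site_list_pmf \<Lambda> t) xs =
      measure_pmf.expectation (poisson_pmf (?N * t)) (\<lambda>k. (1 / ?N) ^ length xs * indicator {length xs} k)"
    unfolding e pmf_bind
    by (intro Bochner_Integration.integral_cong refl) (auto simp: pmf_replicate_pmf)
  also have "\<dots> = (1 / ?N) ^ length xs * pmf (poisson_pmf (?N * t)) (length xs)"
    by (simp add: pmf.rep_eq)
  also have "\<dots> = exp (- (?N * t)) * t ^ length xs / fact (length xs)"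
    using N r by (simp add: power_mult_distrib field_simps)
  finally show ?thesis by simp
qed

text \<open>Domination on points passes to all sets. Applied to a set and to its complement, with
  total mass one on both sides, it becomes equality.\<close>

lemma prob_space_eq_pmfI:
  fixes M :: "'b::countable measure"
  assumes M: "prob_space M" "sets M = UNIV" and le: "\<And>x. ennreal (pmf p x) \<le> emeasure M {x}"
  shows "M = measure_pmf p"
proof -
  interpret M: prob_space M by fact
  have le': "emeasure (measure_pmf p) A \<le> emeasure M A" for A
  proof -
    have "emeasure (measure_pmf p) A = (\<integral>\<^sup>+x. emeasure (measure_pmf p) {x} \<partial>count_space A)"
      by (rule emeasure_countable_singleton) auto
    also have "\<dots> \<le> (\<integral>\<^sup>+x. emeasure M {x} \<partial>count_space A)"
      by (intro nn_integral_mono) (simp add: emeasure_pmf_single le)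
    also have "\<dots> = emeasure M A"
      using M by (intro emeasure_countable_singleton[symmetric]) auto
    finally show ?thesis .
  qed
  have sp: "space M = UNIV" using M(2) sets.top[of M] by (metis UNIV_I sets.sets_into_space top.extremum_uniqueI)
  have le_r: "measure_pmf.prob p A \<le> M.prob A" for A
    using le'[of A] by (simp add: M.emeasure_eq_measure measure_pmf.emeasure_eq_measure)
  have "measure_pmf.prob p A = M.prob A" for A
    using le_r[of A] le_r[of "- A"] M.prob_compl[of A] measure_pmf.prob_compl[of A p] M sp
    by (simp add: Compl_eq_Diff_UNIV)
  then show ?thesis
    using M by (intro measure_eqI) (auto simp: M.emeasure_eq_measure measure_pmf.emeasure_eq_measure)
qed

lemma distr_ring_sequence:
  fixes \<Lambda> :: "'v::countable set" and t :: real
  assumes L: "finite \<Lambda>" "\<Lambda> \<noteq> {}" and t: "0 \<le> t"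
  shows "distr (poisson_clocks \<Lambda>) (count_space UNIV) (ring_sequence \<Lambda> t) = measure_pmf (site_list_pmf \<Lambda> t)"
proof (rule prob_space_eq_pmfI)
  interpret P: prob_space "poisson_clocks \<Lambda>" unfolding poisson_clocks_def
    by (intro prob_space_PiM prob_unit_exp)
  show "prob_space (distr (poisson_clocks \<Lambda>) (count_space UNIV) (ring_sequence \<Lambda> t))"
    by (intro P.prob_space_distr ring_sequence_measurable)
  fix xs
  show "ennreal (pmf (site_list_pmf \<Lambda> t) xs) \<le>
      emeasure (distr (poisson_clocks \<Lambda>) (count_space UNIV) (ring_sequence \<Lambda> t)) {xs}"
  proof (cases "set xs \<subseteq> \<Lambda>")
    case True
    have "ennreal (pmf (site_list_pmf \<Lambda> t) xs) \<le> emeasure (poisson_clocks \<Lambda>) (good_clocks \<Lambda> xs t)"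
      using good_clocks_lower[OF L True t] pmf_site_list_le[OF L t True]
      by (meson ennreal_leI order_trans)
    also have "\<dots> \<le> emeasure (poisson_clocks \<Lambda>) (ring_sequence \<Lambda> t -` {xs} \<inter> space (poisson_clocks \<Lambda>))"
    proof (rule emeasure_mono)
      show "ring_sequence \<Lambda> t -` {xs} \<inter> space (poisson_clocks \<Lambda>) \<in> sets (poisson_clocks \<Lambda>)"
        by (rule measurable_sets[OF ring_sequence_measurable]) simp
      show "good_clocks \<Lambda> xs t \<subseteq> ring_sequence \<Lambda> t -` {xs} \<inter> space (poisson_clocks \<Lambda>)"
        using ring_sequence_good by (fastforce simp: good_clocks_def)
    qed
    also have "\<dots> = emeasure (distr (poisson_clocks \<Lambda>) (count_space UNIV) (ring_sequence \<Lambda> t)) {xs}"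
      by (rule emeasure_distr[OF ring_sequence_measurable, symmetric]) simp
    finally show ?thesis .
  next
    case False
    have "set ys \<subseteq> \<Lambda>" if "ys \<in> set_pmf (site_list_pmf \<Lambda> t)" for ys
      using that L by (auto simp: site_list_pmf_def set_replicate_pmf split: if_splits)
    then have "pmf (site_list_pmf \<Lambda> t) xs = 0" using False by (auto simp: pmf_eq_0_set_pmf)
    then show ?thesis by simp
  qed
qed simp

text \<open>From here on the clocks disappear: only a Poisson number of updates at independent
  uniform sites remains.\<close>

lemma heat_bath_law_eq:
  fixes \<Lambda> :: "'v::countable set" and t :: real
  assumes "finite \<Lambda>" "\<Lambda> \<noteq> {}" "0 \<le> t"
  shows "heat_bath_law \<mu> \<Lambda> t \<sigma> =
    measure_pmf (bind_pmf (site_list_pmf \<Lambda> t) (\<lambda>xs. resample_seq \<mu> \<Lambda> xs \<sigma>))"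
proof -
  interpret P: prob_space "poisson_clocks \<Lambda>" unfolding poisson_clocks_def
    by (intro prob_space_PiM prob_unit_exp)
  have "(\<lambda>xs. measure_pmf (resample_seq \<mu> \<Lambda> xs \<sigma>)) \<in> count_space UNIV \<rightarrow>\<^sub>M subprob_algebra (count_space UNIV)"
    by (auto simp: space_subprob_algebra measure_pmf.subprob_space_axioms)
  then show ?thesis
    unfolding heat_bath_law_def measure_pmf_bind distr_ring_sequence[OF assms, symmetric]
    by (intro bind_distr[symmetric] ring_sequence_measurable P.not_empty)
qed

section \<open>Variances on product spaces\<close>

abbreviation pmf_exp :: "'a pmf \<Rightarrow> ('a \<Rightarrow> real) \<Rightarrow> real" where
  "pmf_exp \<equiv> measure_pmf.expectation"

definition pmf_var :: "'a pmf \<Rightarrow> ('a \<Rightarrow> real) \<Rightarrow> real" where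
  "pmf_var p f = pmf_exp p (\<lambda>x. (f x - pmf_exp p f)\<^sup>2)"

lemma pmf_exp_finite:
  "finite (set_pmf p) \<Longrightarrow> pmf_exp p f = (\<Sum>x\<in>set_pmf p. pmf p x * f x)"
  by (subst integral_measure_pmf_real[where A="set_pmf p"]) (auto simp: mult.commute)

lemma pmf_exp_add:
  "finite (set_pmf p) \<Longrightarrow> pmf_exp p (\<lambda>x. f x + g x) = pmf_exp p f + pmf_exp p g"
  by (simp add: pmf_exp_finite distrib_left sum.distrib)

lemma pmf_exp_diff:
  "finite (set_pmf p) \<Longrightarrow> pmf_exp p (\<lambda>x. f x - g x) = pmf_exp p f - pmf_exp p g"
  by (simp add: pmf_exp_finite right_diff_distrib sum_subtractf)

lemma pmf_exp_sum:
  "finite (set_pmf p) \<Longrightarrow> pmf_exp p (\<lambda>x. \<Sum>i\<in>I. f i x) = (\<Sum>i\<in>I. pmf_exp p (f i))"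
  unfolding pmf_exp_finite sum_distrib_left by (rule sum.swap)

lemma pmf_exp_mono:
  "finite (set_pmf p) \<Longrightarrow> (\<And>x. x \<in> set_pmf p \<Longrightarrow> f x \<le> g x) \<Longrightarrow> pmf_exp p f \<le> pmf_exp p g"
  unfolding pmf_exp_finite by (intro sum_mono mult_left_mono) auto

lemma pmf_exp_cong:
  "(\<And>x. x \<in> set_pmf p \<Longrightarrow> f x = g x) \<Longrightarrow> pmf_exp p f = pmf_exp p g"
  by (intro Bochner_Integration.integral_cong_AE) (auto simp: AE_measure_pmf_iff)

lemma pmf_exp_swap:
  "finite (set_pmf p) \<Longrightarrow> finite (set_pmf r) \<Longrightarrow>
   pmf_exp p (\<lambda>x. pmf_exp r (f x)) = pmf_exp r (\<lambda>y. pmf_exp p (\<lambda>x. f x y))"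
  unfolding pmf_exp_finite sum_distrib_left
  by (subst sum.swap) (simp add: mult.left_commute)

lemma pmf_exp_bind:
  assumes "finite (set_pmf p)" "\<And>x. x \<in> set_pmf p \<Longrightarrow> finite (set_pmf (f x))"
  shows "pmf_exp (bind_pmf p f) h = pmf_exp p (\<lambda>x. pmf_exp (f x) h)"
proof -
  have "pmf_exp (bind_pmf p f) h = (\<Sum>a\<in>set_pmf p. pmf p a *\<^sub>R pmf_exp (f a) h)"
    using assms by (intro pmf_expectation_bind) auto
  then show ?thesis using assms by (simp add: pmf_exp_finite)
qed

lemma pmf_exp_nonneg: "(\<And>x. 0 \<le> f x) \<Longrightarrow> 0 \<le> pmf_exp p f"
  by (intro integral_nonneg_AE) auto

lemma pmf_exp_indicator: "pmf_exp p (\<lambda>x. of_bool (P x)) = measure_pmf.prob p {x. P x}"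
proof -
  have "pmf_exp p (\<lambda>x. of_bool (P x)) = pmf_exp p (indicator {x. P x})"
    by (intro pmf_exp_cong) auto
  then show ?thesis by simp
qed

lemma finite_set_replicate_pmf: "finite (set_pmf p) \<Longrightarrow> finite (set_pmf (replicate_pmf n p))"
  by (induction n) auto

lemma length_replicate_pmf: "us \<in> set_pmf (replicate_pmf n p) \<Longrightarrow> length us = n"
  by (simp add: set_replicate_pmf)

lemma pmf_exp_replicate_Suc:
  assumes "finite (set_pmf p)"
  shows "pmf_exp (replicate_pmf (Suc n) p) h =
    pmf_exp p (\<lambda>u. pmf_exp (replicate_pmf n p) (\<lambda>us. h (u # us)))"
  using assms finite_set_replicate_pmf[OF assms]
  by (simp add: pmf_exp_bind flip: map_pmf_def)

lemma pmf_exp_replicate_add: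
  assumes "finite (set_pmf p)"
  shows "pmf_exp (replicate_pmf (m + n) p) h =
    pmf_exp (replicate_pmf m p) (\<lambda>us. pmf_exp (replicate_pmf n p) (\<lambda>ws. h (us @ ws)))"
  using finite_set_replicate_pmf[OF assms]
  by (simp add: replicate_pmf_distrib pmf_exp_bind flip: map_pmf_def)

lemma pmf_exp_replicate_snoc:
  assumes "finite (set_pmf p)"
  shows "pmf_exp (replicate_pmf (Suc n) p) h =
    pmf_exp (replicate_pmf n p) (\<lambda>us. pmf_exp p (\<lambda>u. h (us @ [u])))"
  using pmf_exp_replicate_add[OF assms, of n 1 h] unfolding replicate_pmf_1 by simp

text \<open>Linearised form of a Cauchy-Schwarz bound: the hypothesis is linear in
  \<open>\<bar>x\<bar>\<close>, \<open>a\<close> and \<open>b\<close>, so it survives sums and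
  expectations, and optimising over \<open>l\<close> recovers the product.\<close>

lemma sq_le_prodI:
  fixes x a b :: real
  assumes "0 \<le> a" "0 \<le> b" "\<And>l. 0 < l \<Longrightarrow> 2 * \<bar>x\<bar> \<le> l * a + b / l"
  shows "x\<^sup>2 \<le> a * b"
proof (cases "a = 0 \<or> b = 0")
  case True
  have "\<bar>x\<bar> \<le> 0"
  proof (rule field_le_epsilon)
    fix e :: real assume e: "0 < e"
    show "\<bar>x\<bar> \<le> 0 + e"
    proof (cases "a = 0")
      case True
      \<comment> \<open>With \<open>a = 0\<close>, a large \<open>l\<close> makes the remaining term
        smaller than \<open>e\<close>; the \<open>+ 1\<close> keeps \<open>l\<close> positive when
        \<open>b = 0\<close>.\<close>
      then have "2 * \<bar>x\<bar> \<le> b / ((b + 1) / e)" using assms(3)[of "(b+1)/e"] e assms(2) by simp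
      also have "\<dots> = e * (b / (b + 1))" using e assms(2) by (simp add: field_simps)
      also have "\<dots> \<le> e * 1" using e assms(2) by (intro mult_left_mono) auto
      finally show ?thesis using e by linarith
    next
      case False
      then have "b = 0" using True by simp
      then have "2 * \<bar>x\<bar> \<le> (e / (a + 1)) * a" using assms(3)[of "e/(a+1)"] e assms(1) by simp
      also have "\<dots> = e * (a / (a + 1))" by simp
      also have "\<dots> \<le> e * 1" using e assms(1) by (intro mult_left_mono) auto
      finally show ?thesis using e by linarith
    qed
  qed
  then show ?thesis using assms by simp
next
  case False
  then have p: "a > 0" "b > 0" using assms by auto
  \<comment> \<open>The minimiser of \<open>l * a + b / l\<close>.\<close>
  have "2 * \<bar>x\<bar> \<le> sqrt (b / a) * a + b / sqrt (b / a)" using p by (intro assms) auto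
  also have "\<dots> = 2 * sqrt (a * b)"
    using p by (simp add: real_sqrt_divide real_sqrt_mult field_simps)
  finally have "\<bar>x\<bar> \<le> sqrt (a * b)" by simp
  then have "\<bar>x\<bar>\<^sup>2 \<le> (sqrt (a * b))\<^sup>2" by (intro power_mono) auto
  then show ?thesis using p by simp
qed

lemma sq_le_prodD:
  fixes x a b :: real
  assumes "0 \<le> a" "0 \<le> b" "x\<^sup>2 \<le> a * b" "0 < l"
  shows "2 * \<bar>x\<bar> \<le> l * a + b / l"
proof -
  have "(2 * \<bar>x\<bar>)\<^sup>2 \<le> 4 * ((l * a) * (b / l))" using assms by simp
  also have "\<dots> \<le> (l * a + b / l)\<^sup>2"
    using zero_le_power2[of "l * a - b / l"] by (simp add: power2_eq_square algebra_simps)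
  finally show ?thesis by (rule power2_le_imp_le) (use assms in auto)
qed

lemma pmf_cauchy_schwarz:
  assumes f: "finite (set_pmf p)"
    and "\<And>x. x \<in> set_pmf p \<Longrightarrow> (X x)\<^sup>2 \<le> a x * b x" "\<And>x. 0 \<le> a x" "\<And>x. 0 \<le> b x"
  shows "(pmf_exp p X)\<^sup>2 \<le> pmf_exp p a * pmf_exp p b"
proof (rule sq_le_prodI)
  fix l :: real assume l: "0 < l"
  have "2 * \<bar>pmf_exp p X\<bar> \<le> 2 * pmf_exp p (\<lambda>x. \<bar>X x\<bar>)" by simp
  also have "\<dots> = pmf_exp p (\<lambda>x. 2 * \<bar>X x\<bar>)" by simp
  also have "\<dots> \<le> pmf_exp p (\<lambda>x. l * a x + b x / l)"
    using assms l by (intro pmf_exp_mono sq_le_prodD) auto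
  also have "\<dots> = l * pmf_exp p a + pmf_exp p b / l" using f by (simp add: pmf_exp_add)
  finally show "2 * \<bar>pmf_exp p X\<bar> \<le> l * pmf_exp p a + pmf_exp p b / l" .
qed (auto intro!: pmf_exp_nonneg assms)

text \<open>The same \<open>l\<close> serves both summands, so the linearised bounds add up.\<close>

lemma sq_le_prod_add:
  fixes x y :: real
  assumes "x\<^sup>2 \<le> a * b" "y\<^sup>2 \<le> c * d" "0 \<le> a" "0 \<le> b" "0 \<le> c" "0 \<le> d"
  shows "(x + y)\<^sup>2 \<le> (a + c) * (b + d)"
proof (rule sq_le_prodI)
  fix l :: real assume l: "0 < l"
  have "2 * \<bar>x + y\<bar> \<le> 2 * \<bar>x\<bar> + 2 * \<bar>y\<bar>"
    using mult_left_mono[OF abs_triangle_ineq[of x y], of 2] by (simp add: distrib_left)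
  also have "\<dots> \<le> (l * a + b / l) + (l * c + d / l)"
    using assms l by (intro add_mono sq_le_prodD) auto
  finally show "2 * \<bar>x + y\<bar> \<le> l * (a + c) + (b + d) / l" by (simp add: algebra_simps add_divide_distrib)
qed (use assms in auto)

section \<open>Total variance and Shearer's inequality\<close>

lemma pmf_var_nonneg: "0 \<le> pmf_var p f"
  unfolding pmf_var_def by (rule pmf_exp_nonneg) simp

lemma pmf_var_eq:
  assumes "finite (set_pmf p)"
  shows "pmf_var p f = pmf_exp p (\<lambda>x. (f x)\<^sup>2) - (pmf_exp p f)\<^sup>2"
  unfolding pmf_var_def power2_diff
  by (simp add: pmf_exp_diff pmf_exp_add assms power2_eq_square)

lemma pmf_var_shift:
  assumes "finite (set_pmf p)"
  shows "pmf_exp p (\<lambda>x. (f x - c)\<^sup>2) = pmf_var p f + (pmf_exp p f - c)\<^sup>2"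
  unfolding pmf_var_eq[OF assms] power2_diff
  by (simp add: pmf_exp_diff pmf_exp_add assms power2_eq_square)

lemma pmf_var_le:
  assumes "finite (set_pmf p)"
  shows "pmf_var p f \<le> pmf_exp p (\<lambda>x. (f x - c)\<^sup>2)"
  using pmf_var_shift[OF assms, of f c] by simp

text \<open>Law of total variance, conditioning on the first coordinate.\<close>

lemma pmf_var_replicate_Suc:
  assumes f: "finite (set_pmf p)"
  shows "pmf_var (replicate_pmf (Suc n) p) h =
    pmf_exp p (\<lambda>u. pmf_var (replicate_pmf n p) (\<lambda>us. h (u # us))) +
    pmf_var p (\<lambda>u. pmf_exp (replicate_pmf n p) (\<lambda>us. h (u # us)))"
  using f finite_set_replicate_pmf[OF f]
  by (simp add: pmf_var_eq pmf_exp_replicate_Suc pmf_exp_diff del: replicate_pmf.simps)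

text \<open>A hidden letter becomes \<open>None\<close>, the symbol of an empty slot, so that a
  masked list of updates can still be run.\<close>

fun mask :: "'a set \<Rightarrow> 'a option \<Rightarrow> 'a option" where
  "mask A None = None"
| "mask A (Some a) = (if a \<in> A then Some a else None)"

lemma mask_idem [simp]: "mask A (mask A u) = mask A u"
  by (cases u) auto

text \<open>Moving the centre from the mean to \<open>f x0\<close> adds the square of
  \<open>pmf_exp p f - f x0\<close>. This is the mean of a function that vanishes at
  \<open>x0\<close>, so by Cauchy-Schwarz its square is at most \<open>1 - pmf p x0\<close> times
  the left-hand side, that is, at most half of it.\<close>

lemma pmf_atom_var:
  assumes f: "finite (set_pmf p)" and "1 / 2 \<le> pmf p x0"
  shows "pmf_exp p (\<lambda>x. (f x - f x0)\<^sup>2) \<le> 2 * pmf_var p f"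
proof -
  let ?Y = "\<lambda>x. f x - f x0"
  have "(pmf_exp p ?Y)\<^sup>2 \<le> pmf_exp p (\<lambda>x. of_bool (x \<noteq> x0)) * pmf_exp p (\<lambda>x. (?Y x)\<^sup>2)"
    by (rule pmf_cauchy_schwarz[OF f]) auto
  also have "pmf_exp p (\<lambda>x. of_bool (x \<noteq> x0)) = 1 - pmf p x0"
    unfolding pmf_exp_indicator pmf.rep_eq
    using measure_pmf.prob_compl[of "{x0}" p] by (simp add: Compl_eq_Diff_UNIV[symmetric] Collect_neg_eq)
  also have "(1 - pmf p x0) * pmf_exp p (\<lambda>x. (?Y x)\<^sup>2) \<le> (1 / 2) * pmf_exp p (\<lambda>x. (?Y x)\<^sup>2)"
    using assms by (intro mult_right_mono pmf_exp_nonneg) auto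
  finally have "(pmf_exp p f - f x0)\<^sup>2 \<le> (1 / 2) * pmf_exp p (\<lambda>x. (?Y x)\<^sup>2)"
    using f by (simp add: pmf_exp_diff)
  then show ?thesis using pmf_var_shift[OF f, of f "f x0"] by simp
qed

text \<open>Dual form of Shearer's inequality for variances: on average over \<open>w\<close>, the projection of \<open>g\<close> on what is
  visible through the mask \<open>A w\<close> retains at most a fraction \<open>2 * \<delta>\<close> of the variance.\<close>

lemma shearer_cov:
  fixes A :: "'w \<Rightarrow> 'a set"
  assumes Q: "finite (set_pmf Q)" "1 / 2 \<le> pmf Q None" and R: "finite (set_pmf R)"
    and d: "0 \<le> \<delta>" "\<And>a. measure_pmf.prob R {w. a \<in> A w} \<le> \<delta>"
    and h: "\<And>w us. length us = n \<Longrightarrow> h w (map (mask (A w)) us) = h w us"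
  shows "(pmf_exp R (\<lambda>w. pmf_exp (replicate_pmf n Q)
            (\<lambda>us. (g us - pmf_exp (replicate_pmf n Q) g) * h w us)))\<^sup>2
    \<le> (2 * \<delta> * pmf_var (replicate_pmf n Q) g) *
       pmf_exp R (\<lambda>w. pmf_var (replicate_pmf n Q) (h w))"
  using h
proof (induction n arbitrary: g h)
  case 0
  show ?case by (simp add: pmf_var_def)
next
  case (Suc n)
  define L where "L = replicate_pmf n Q"
  have L: "finite (set_pmf L)" unfolding L_def by (rule finite_set_replicate_pmf[OF Q(1)])
  note fin = Q(1) R L
  define gm where "gm u = pmf_exp L (\<lambda>us. g (u # us))" for u
  define hm where "hm w u = pmf_exp L (\<lambda>us. h w (u # us))" for w u
  define m where "m = pmf_exp (replicate_pmf (Suc n) Q) g"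
  have m: "m = pmf_exp Q gm" unfolding m_def gm_def L_def by (rule pmf_exp_replicate_Suc[OF Q(1)])
  have hmask: "h w (u # map (mask (A w)) us) = h w (u # us)" if "length us = n" for w u us
    using Suc.prems[of "u # map (mask (A w)) us" w] Suc.prems[of "u # us" w] that
    by (simp add: o_def)
  \<comment> \<open>If the first letter is hidden, \<open>h\<close> cannot tell it from an empty
    slot.\<close>
  have hm_out: "hm w u = hm w None" if "mask (A w) u = None" for w u
    unfolding hm_def
  proof (rule pmf_exp_cong)
    fix us assume "us \<in> set_pmf L"
    then have "length us = n" unfolding L_def by (rule length_replicate_pmf)
    then show "h w (u # us) = h w (None # us)"
      using Suc.prems[of "u # us" w] Suc.prems[of "None # us" w] that by simp
  qed
  \<comment> \<open>Martingale splitting of \<open>g - m\<close>: \<open>X u\<close> tests the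
    fluctuation of \<open>g\<close> for a fixed first letter, where the induction hypothesis
    applies, and \<open>Y\<close> the fluctuation caused by the first letter.\<close>
  define X where "X u = pmf_exp R (\<lambda>w. pmf_exp L (\<lambda>us. (g (u # us) - gm u) * h w (u # us)))" for u
  define Y where "Y = pmf_exp R (\<lambda>w. pmf_exp Q (\<lambda>u. (gm u - m) * hm w u))"
  have split: "pmf_exp R (\<lambda>w. pmf_exp (replicate_pmf (Suc n) Q) (\<lambda>us. (g us - m) * h w us))
     = pmf_exp Q X + Y"
  proof -
    have "pmf_exp (replicate_pmf (Suc n) Q) (\<lambda>us. (g us - m) * h w us) =
      pmf_exp Q (\<lambda>u. pmf_exp L (\<lambda>us. (g (u # us) - gm u) * h w (u # us))) +
      pmf_exp Q (\<lambda>u. (gm u - m) * hm w u)" for w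
      unfolding pmf_exp_replicate_Suc[OF Q(1)] L_def[symmetric] hm_def
      by (simp add: fin pmf_exp_add[symmetric] pmf_exp_diff left_diff_distrib)
    then show ?thesis unfolding X_def Y_def
      by (simp add: fin pmf_exp_add pmf_exp_swap[OF fin(1) fin(2)])
  qed
  define a1 where "a1 u = 2 * \<delta> * pmf_var L (\<lambda>us. g (u # us))" for u
  define b1 where "b1 u = pmf_exp R (\<lambda>w. pmf_var L (\<lambda>us. h w (u # us)))" for u
  have X: "(X u)\<^sup>2 \<le> a1 u * b1 u" for u
    using Suc.IH[of "\<lambda>w us. h w (u # us)" "\<lambda>us. g (u # us)"] hmask
    unfolding X_def gm_def a1_def b1_def L_def by simp
  have XX: "(pmf_exp Q X)\<^sup>2 \<le> pmf_exp Q a1 * pmf_exp Q b1"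
    by (intro pmf_cauchy_schwarz fin X)
       (auto simp: a1_def b1_def d intro!: mult_nonneg_nonneg pmf_exp_nonneg pmf_var_nonneg)
  \<comment> \<open>Since \<open>gm - m\<close> has mean zero, subtracting a constant in
    \<open>u\<close> from \<open>hm w\<close> is free. With the value at \<open>None\<close> as the
    constant, the integrand vanishes unless the first letter is visible.\<close>
  define h0 where "h0 w u = hm w u - hm w None" for w u
  have Y_eq: "Y = pmf_exp R (\<lambda>w. pmf_exp Q (\<lambda>u. (gm u - m) * h0 w u))"
    unfolding Y_def
  proof (rule pmf_exp_cong)
    fix w
    have "pmf_exp Q (\<lambda>u. (gm u - m) * h0 w u) =
      pmf_exp Q (\<lambda>u. (gm u - m) * hm w u) - pmf_exp Q (\<lambda>u. gm u - m) * hm w None"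
      unfolding h0_def by (simp add: fin pmf_exp_diff right_diff_distrib)
    also have "pmf_exp Q (\<lambda>u. gm u - m) = 0" by (simp add: fin pmf_exp_diff m)
    finally show "pmf_exp Q (\<lambda>u. (gm u - m) * hm w u) = pmf_exp Q (\<lambda>u. (gm u - m) * h0 w u)" by simp
  qed
  define a2 where "a2 w u = (gm u - m)\<^sup>2 * of_bool (mask (A w) u \<noteq> None)" for w u
  have YY: "Y\<^sup>2 \<le> pmf_exp R (\<lambda>w. pmf_exp Q (a2 w)) * pmf_exp R (\<lambda>w. pmf_exp Q (\<lambda>u. (h0 w u)\<^sup>2))"
    unfolding Y_eq
  proof (intro pmf_cauchy_schwarz fin pmf_exp_nonneg)
    fix w u
    show "((gm u - m) * h0 w u)\<^sup>2 \<le> a2 w u * (h0 w u)\<^sup>2"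
      using hm_out[of w u] by (auto simp: a2_def h0_def power_mult_distrib)
  qed (auto simp: a2_def)
  \<comment> \<open>Averaging over \<open>w\<close> first, for a fixed letter, turns the visibility
    indicator into the factor \<open>\<delta>\<close>.\<close>
  have "pmf_exp R (\<lambda>w. pmf_exp Q (a2 w)) = pmf_exp Q (\<lambda>u. pmf_exp R (\<lambda>w. a2 w u))"
    by (intro pmf_exp_swap fin)
  also have "\<dots> = pmf_exp Q (\<lambda>u. (gm u - m)\<^sup>2 * measure_pmf.prob R {w. mask (A w) u \<noteq> None})"
    unfolding a2_def by (simp add: pmf_exp_indicator)
  also have "\<dots> \<le> pmf_exp Q (\<lambda>u. (gm u - m)\<^sup>2 * \<delta>)"
  proof (intro pmf_exp_mono fin mult_left_mono)
    fix u
    show "measure_pmf.prob R {w. mask (A w) u \<noteq> None} \<le> \<delta>"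
      using d by (cases u) auto
  qed auto
  also have "\<dots> = \<delta> * pmf_var Q gm" unfolding pmf_var_def m by simp
  finally have a2_le: "pmf_exp R (\<lambda>w. pmf_exp Q (a2 w)) \<le> \<delta> * pmf_var Q gm" .
  \<comment> \<open>Centring at \<open>None\<close> in place of the mean costs a factor 2, by the
    atom of mass one half.\<close>
  have b2_le: "pmf_exp R (\<lambda>w. pmf_exp Q (\<lambda>u. (h0 w u)\<^sup>2)) \<le> 2 * pmf_exp R (\<lambda>w. pmf_var Q (hm w))"
  proof -
    have "pmf_exp R (\<lambda>w. pmf_exp Q (\<lambda>u. (h0 w u)\<^sup>2)) \<le> pmf_exp R (\<lambda>w. 2 * pmf_var Q (hm w))"
      unfolding h0_def by (intro pmf_exp_mono fin pmf_atom_var Q)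
    then show ?thesis by simp
  qed
  have YY': "Y\<^sup>2 \<le> (2 * \<delta> * pmf_var Q gm) * pmf_exp R (\<lambda>w. pmf_var Q (hm w))"
  proof -
    have "Y\<^sup>2 \<le> (\<delta> * pmf_var Q gm) * (2 * pmf_exp R (\<lambda>w. pmf_var Q (hm w)))"
      by (rule order_trans[OF YY], rule mult_mono[OF a2_le b2_le])
         (auto intro!: pmf_exp_nonneg mult_nonneg_nonneg pmf_var_nonneg d)
    then show ?thesis by (simp add: algebra_simps)
  qed
  \<comment> \<open>Both estimates bound a square by \<open>2 * \<delta>\<close> times a part of the
    variance of \<open>g\<close> times a part of that of \<open>h\<close>; the law of total variance
    assembles the parts.\<close>
  have "(pmf_exp Q X + Y)\<^sup>2 \<le> (pmf_exp Q a1 + 2 * \<delta> * pmf_var Q gm) *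
      (pmf_exp Q b1 + pmf_exp R (\<lambda>w. pmf_var Q (hm w)))"
    by (intro sq_le_prod_add XX YY')
       (auto simp: a1_def b1_def d intro!: mult_nonneg_nonneg pmf_exp_nonneg pmf_var_nonneg)
  moreover have "pmf_exp Q a1 + 2 * \<delta> * pmf_var Q gm = 2 * \<delta> * pmf_var (replicate_pmf (Suc n) Q) g"
    unfolding pmf_var_replicate_Suc[OF Q(1)] a1_def gm_def L_def[symmetric] by (simp add: distrib_left)
  moreover have "pmf_exp Q b1 + pmf_exp R (\<lambda>w. pmf_var Q (hm w)) =
      pmf_exp R (\<lambda>w. pmf_var (replicate_pmf (Suc n) Q) (h w))"
    unfolding pmf_var_replicate_Suc[OF Q(1)] b1_def hm_def L_def[symmetric]
    by (simp add: fin pmf_exp_add pmf_exp_swap[OF fin(1) fin(2)])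
  ultimately show ?case unfolding split[symmetric] m_def[symmetric] by simp
qed

text \<open>Tensorisation in the manner of Efron and Stein: a coordinate differs from
  \<open>None\<close> with probability \<open>1 - pmf Q None\<close>, and only then does it move the
  conditional mean away from its value at \<open>None\<close>, by at most \<open>B\<close>.\<close>

lemma pmf_var_replicate_le:
  assumes Q: "finite (set_pmf Q)" and B: "\<And>us a ws. \<bar>g (us @ Some a # ws) - g (us @ None # ws)\<bar> \<le> B"
  shows "pmf_var (replicate_pmf n Q) g \<le> n * (1 - pmf Q None) * B\<^sup>2"
  using B
proof (induction n arbitrary: g)
  case 0
  show ?case by (simp add: pmf_var_def)
next
  case (Suc n)
  define L where "L = replicate_pmf n Q"
  have L: "finite (set_pmf L)" unfolding L_def by (rule finite_set_replicate_pmf[OF Q])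
  have B0: "0 \<le> B" using Suc.prems[of "[]" undefined "[]"] by linarith
  have IH: "pmf_var L (\<lambda>us. g (u # us)) \<le> n * (1 - pmf Q None) * B\<^sup>2" for u
    unfolding L_def using Suc.prems[of "u # _"] by (intro Suc.IH) simp
  have 1: "pmf_exp Q (\<lambda>u. pmf_var L (\<lambda>us. g (u # us))) \<le> n * (1 - pmf Q None) * B\<^sup>2"
    using pmf_exp_mono[OF Q IH, of "\<lambda>u. u"] by simp
  let ?m = "\<lambda>u. pmf_exp L (\<lambda>us. g (u # us))"
  have m: "(?m u - ?m None)\<^sup>2 \<le> of_bool (u \<noteq> None) * B\<^sup>2" for u
  proof (cases u)
    case (Some a)
    have "\<bar>?m u - ?m None\<bar> = \<bar>pmf_exp L (\<lambda>us. g (u # us) - g (None # us))\<bar>"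
      by (simp add: pmf_exp_diff L)
    also have "\<dots> \<le> pmf_exp L (\<lambda>us. \<bar>g (u # us) - g (None # us)\<bar>)" by simp
    also have "\<dots> \<le> pmf_exp L (\<lambda>us. B)"
      using Suc.prems[of "[]"] Some by (intro pmf_exp_mono L) simp
    finally have "\<bar>?m u - ?m None\<bar> \<le> B" by simp
    then have "\<bar>?m u - ?m None\<bar>\<^sup>2 \<le> B\<^sup>2" by (intro power_mono) auto
    then show ?thesis using Some by simp
  qed simp
  have "pmf_var Q ?m \<le> pmf_exp Q (\<lambda>u. (?m u - ?m None)\<^sup>2)" by (rule pmf_var_le[OF Q])
  also have "\<dots> \<le> pmf_exp Q (\<lambda>u. of_bool (u \<noteq> None) * B\<^sup>2)" by (intro pmf_exp_mono Q m)
  also have "\<dots> = (1 - pmf Q None) * B\<^sup>2"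
    unfolding pmf.rep_eq using measure_pmf.prob_compl[of "{None}" Q]
    by (simp add: pmf_exp_indicator Compl_eq_Diff_UNIV[symmetric] Collect_neg_eq del: not_None_eq)
  finally show ?case unfolding pmf_var_replicate_Suc[OF Q] L_def[symmetric]
    using 1 by (simp add: algebra_simps)
qed

section \<open>Poisson limit of lazy chains\<close>

lemma one_minus_power_tendsto:
  fixes p :: "nat \<Rightarrow> real" and K :: "nat \<Rightarrow> nat"
  assumes lim: "(\<lambda>m. real (K m) * p m) \<longlonglongrightarrow> l" and p0: "p \<longlonglongrightarrow> 0" and p: "\<And>m. 0 \<le> p m"
  shows "(\<lambda>m. (1 - p m) ^ K m) \<longlonglongrightarrow> exp (- l)"
proof -
  have ev: "\<forall>\<^sub>F m in sequentially. p m \<le> 1 / 2"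
    using order_tendstoD(2)[OF p0, of "1/2"] by (auto elim: eventually_mono)
  have lo: "\<forall>\<^sub>F m in sequentially. exp (- (real (K m) * p m) - 2 * (real (K m) * p m) * p m) \<le> (1 - p m) ^ K m"
    using ev
  proof eventually_elim
    case (elim m)
    have "exp (- p m - 2 * (p m)\<^sup>2) \<le> exp (ln (1 - p m))"
      using ln_one_minus_pos_lower_bound[OF p elim] by simp
    then have "exp (- p m - 2 * (p m)\<^sup>2) \<le> 1 - p m" using elim by simp
    then have "exp (- p m - 2 * (p m)\<^sup>2) ^ K m \<le> (1 - p m) ^ K m" by (intro power_mono) auto
    also have "exp (- p m - 2 * (p m)\<^sup>2) ^ K m = exp (- (real (K m) * p m) - 2 * (real (K m) * p m) * p m)"
      by (simp add: exp_of_nat_mult[symmetric] algebra_simps power2_eq_square)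
    finally show ?case .
  qed
  have hi: "\<forall>\<^sub>F m in sequentially. (1 - p m) ^ K m \<le> exp (- (real (K m) * p m))"
    using ev
  proof eventually_elim
    case (elim m)
    have "(1 - p m) ^ K m \<le> exp (- p m) ^ K m"
      using elim exp_ge_add_one_self[of "- p m"] by (intro power_mono) auto
    then show ?case by (simp add: exp_of_nat_mult[symmetric])
  qed
  have "(\<lambda>m. exp (- (real (K m) * p m) - 2 * (real (K m) * p m) * p m)) \<longlonglongrightarrow> exp (- l - 2 * l * 0)"
    by (intro tendsto_intros lim p0)
  moreover have "(\<lambda>m. exp (- (real (K m) * p m))) \<longlonglongrightarrow> exp (- l)"
    by (intro tendsto_intros lim)
  ultimately show ?thesis using tendsto_sandwich[OF lo hi, of "exp (- l)"] by simp
qed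

lemma binomial_pmf_tendsto_poisson:
  fixes p :: "nat \<Rightarrow> real" and K :: "nat \<Rightarrow> nat"
  assumes lim: "(\<lambda>m. real (K m) * p m) \<longlonglongrightarrow> l" and p0: "p \<longlonglongrightarrow> 0" and p: "\<And>m. 0 \<le> p m" "\<And>m. p m \<le> 1"
  shows "(\<lambda>m. pmf (binomial_pmf (K m) (p m)) k) \<longlonglongrightarrow> l ^ k / fact k * exp (- l)"
proof -
  have "(\<lambda>m. real (K m - k) * p m) \<longlonglongrightarrow> l"
  proof (rule tendsto_sandwich[OF _ _ _ lim])
    show "\<forall>\<^sub>F m in sequentially. real (K m) * p m - real k * p m \<le> real (K m - k) * p m"
      using p by (intro always_eventually allI) (simp add: left_diff_distrib[symmetric] mult_right_mono)
    show "\<forall>\<^sub>F m in sequentially. real (K m - k) * p m \<le> real (K m) * p m"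
      using p by (intro always_eventually allI mult_right_mono) auto
    have "(\<lambda>m. real (K m) * p m - real k * p m) \<longlonglongrightarrow> l - real k * 0"
      by (intro tendsto_intros lim p0)
    then show "(\<lambda>m. real (K m) * p m - real k * p m) \<longlonglongrightarrow> l" by simp
  qed
  then have 1: "(\<lambda>m. (1 - p m) ^ (K m - k)) \<longlonglongrightarrow> exp (- l)"
    by (rule one_minus_power_tendsto[OF _ p0 p(1)])
  have "real (K m choose k) * p m ^ k = (\<Prod>i<k. real (K m) * p m - real i * p m) / fact k" for m
  proof -
    have "real (K m choose k) = (\<Prod>i<k. real (K m) - real i) / fact k"
      by (simp add: binomial_gbinomial gbinomial_prod_rev atLeast0LessThan)
    then show ?thesis by (simp add: left_diff_distrib[symmetric] prod.distrib)
  qed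
  moreover have "(\<lambda>m. (\<Prod>i<k. real (K m) * p m - real i * p m) / fact k) \<longlonglongrightarrow> (\<Prod>i<k. l - real i * 0) / fact k"
    by (intro tendsto_intros lim p0) auto
  ultimately have 2: "(\<lambda>m. real (K m choose k) * p m ^ k) \<longlonglongrightarrow> l ^ k / fact k" by simp
  show ?thesis using tendsto_mult[OF 2 1] p by (simp add: pmf_binomial)
qed

text \<open>Scheffe's argument: the limit is again a probability law, so no mass escapes to
  infinity, and convergence of the single masses controls the expectation of a bounded
  function.\<close>

lemma nat_pmf_tendsto_expectation:
  fixes P :: "nat \<Rightarrow> nat pmf"
  assumes lim: "\<And>k. (\<lambda>m. pmf (P m) k) \<longlonglongrightarrow> pmf R k" and a: "\<And>k. \<bar>a k\<bar> \<le> 1"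
  shows "(\<lambda>m. pmf_exp (P m) a) \<longlonglongrightarrow> pmf_exp R a"
proof (rule LIMSEQ_I)
  fix r :: real assume r: "0 < r"
  \<comment> \<open>The tail of \<open>R\<close> will be below \<open>e\<close>, that of
    \<open>P m\<close> below \<open>2 * e\<close>, and the heads differ by less than
    \<open>e\<close>.\<close>
  define e where "e = r / 4"
  have e: "0 < e" using r by (simp add: e_def)
  have split: "\<bar>pmf_exp S a - (\<Sum>k\<le>n. pmf S k * a k)\<bar> \<le> 1 - (\<Sum>k\<le>n. pmf S k)" for S and n :: nat
  proof -
    have i: "integrable (measure_pmf S) f" if "\<And>k. \<bar>f k\<bar> \<le> 1" for f :: "nat \<Rightarrow> real"
      by (rule measure_pmf.integrable_const_bound[where B=1]) (use that in auto)
    have "pmf_exp S (\<lambda>k. a k * indicator {..n} k) = (\<Sum>k\<le>n. pmf S k * a k)"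
      by (subst integral_measure_pmf_real[where A="{..n}"]) (auto simp: indicator_def mult.commute)
    moreover have "pmf_exp S a = pmf_exp S (\<lambda>k. a k * indicator {..n} k) + pmf_exp S (\<lambda>k. a k * indicator {n<..} k)"
      by (subst Bochner_Integration.integral_add[symmetric])
        (auto intro!: i Bochner_Integration.integral_cong simp: a indicator_def)
    moreover have "\<bar>pmf_exp S (\<lambda>k. a k * indicator {n<..} k)\<bar> \<le> pmf_exp S (indicator {n<..})"
    proof (rule order_trans[OF integral_abs_bound], intro integral_mono i)
      fix k show "\<bar>a k * indicator {n<..} k\<bar> \<le> indicat_real {n<..} k" using a[of k] by (auto simp: indicator_def)
    qed (use a in \<open>auto simp: indicator_def\<close>)
    moreover have "pmf_exp S (indicator {n<..}) = 1 - (\<Sum>k\<le>n. pmf S k)"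
      using measure_pmf.prob_compl[of "{..n}" S]
      by (simp add: measure_measure_pmf_finite Compl_eq_Diff_UNIV[symmetric] Compl_atMost)
    ultimately show ?thesis by simp
  qed
  have "(\<lambda>n. measure_pmf.prob R {..n}) \<longlonglongrightarrow> measure_pmf.prob R (\<Union>n. {..n})"
    by (intro measure_pmf.finite_Lim_measure_incseq) (auto simp: incseq_def)
  moreover have "(\<Union>n::nat. {..n}) = UNIV" by auto
  ultimately have "(\<lambda>n. \<Sum>k\<le>n. pmf R k) \<longlonglongrightarrow> 1" by (simp add: measure_measure_pmf_finite)
  then obtain n where n: "1 - e < (\<Sum>k\<le>n. pmf R k)"
    using order_tendstoD(1)[of _ 1 sequentially "1 - e"] e by (auto simp: eventually_sequentially)
  have "(\<lambda>m. \<Sum>k\<le>n. \<bar>pmf (P m) k - pmf R k\<bar>) \<longlonglongrightarrow> (\<Sum>k\<le>n. \<bar>pmf R k - pmf R k\<bar>)"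
    by (intro tendsto_intros lim)
  then have "\<forall>\<^sub>F m in sequentially. (\<Sum>k\<le>n. \<bar>pmf (P m) k - pmf R k\<bar>) < e"
    using order_tendstoD(2)[of _ "0::real" sequentially e] e by simp
  then obtain M where M: "\<And>m. m \<ge> M \<Longrightarrow> (\<Sum>k\<le>n. \<bar>pmf (P m) k - pmf R k\<bar>) < e"
    by (auto simp: eventually_sequentially)
  show "\<exists>no. \<forall>m\<ge>no. norm (pmf_exp (P m) a - pmf_exp R a) < r"
  proof (intro exI allI impI)
    fix m assume "M \<le> m"
    note D = M[OF this]
    have "\<bar>(\<Sum>k\<le>n. pmf (P m) k) - (\<Sum>k\<le>n. pmf R k)\<bar> \<le> (\<Sum>k\<le>n. \<bar>pmf (P m) k - pmf R k\<bar>)"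
      unfolding sum_subtractf[symmetric] by (rule sum_abs)
    moreover have "\<bar>(\<Sum>k\<le>n. pmf (P m) k * a k) - (\<Sum>k\<le>n. pmf R k * a k)\<bar> \<le> (\<Sum>k\<le>n. \<bar>pmf (P m) k - pmf R k\<bar>)"
      unfolding sum_subtractf[symmetric] left_diff_distrib[symmetric]
    proof (rule order_trans[OF sum_abs], rule sum_mono)
      fix k show "\<bar>(pmf (P m) k - pmf R k) * a k\<bar> \<le> \<bar>pmf (P m) k - pmf R k\<bar>"
        unfolding abs_mult using a[of k] by (simp add: mult_left_le)
    qed
    ultimately show "norm (pmf_exp (P m) a - pmf_exp R a) < r"
      using split[of "P m" n] split[of R n] n D unfolding e_def real_norm_def by linarith
  qed
qed

primrec iterate_kernel :: "('s \<Rightarrow> 's pmf) \<Rightarrow> nat \<Rightarrow> 's \<Rightarrow> 's pmf" where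
  "iterate_kernel M 0 \<sigma> = return_pmf \<sigma>"
| "iterate_kernel M (Suc k) \<sigma> = bind_pmf (M \<sigma>) (iterate_kernel M k)"

text \<open>Empty slots do nothing, so only the number of nonempty ones counts; it is binomial, and
  the kernel is iterated that many times.\<close>

lemma map_replicate_lazy_pmf:
  fixes f :: "'a option \<Rightarrow> 's \<Rightarrow> 's"
  assumes "\<And>\<sigma>. f None \<sigma> = \<sigma>" and p: "0 \<le> p" "p \<le> 1"
    and S: "S = bind_pmf (bernoulli_pmf p) (\<lambda>b. if b then map_pmf Some G else return_pmf None)"
  shows "map_pmf (\<lambda>us. fold f us \<sigma>) (replicate_pmf K S) =
    bind_pmf (binomial_pmf K p) (\<lambda>k. iterate_kernel (\<lambda>\<sigma>. map_pmf (\<lambda>a. f (Some a) \<sigma>) G) k \<sigma>)"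
proof (induction K arbitrary: \<sigma>)
  case 0
  then show ?case using p by (simp add: binomial_pmf_0 bind_return_pmf)
next
  case (Suc K)
  let ?M = "\<lambda>\<sigma>. map_pmf (\<lambda>a. f (Some a) \<sigma>) G"
  let ?B = "binomial_pmf K p"
  have "map_pmf (\<lambda>us. fold f us \<sigma>) (replicate_pmf (Suc K) S) =
      bind_pmf S (\<lambda>u. map_pmf (\<lambda>us. fold f us (f u \<sigma>)) (replicate_pmf K S))"
    by (simp add: map_bind_pmf map_pmf_def bind_assoc_pmf bind_return_pmf)
  also have "\<dots> = bind_pmf (bernoulli_pmf p) (\<lambda>b. if b
      then bind_pmf (?M \<sigma>) (\<lambda>\<eta>. bind_pmf ?B (\<lambda>k. iterate_kernel ?M k \<eta>))
      else bind_pmf ?B (\<lambda>k. iterate_kernel ?M k \<sigma>))"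
    unfolding Suc.IH unfolding S bind_assoc_pmf
    by (intro bind_pmf_cong refl) (simp add: bind_map_pmf bind_return_pmf assms(1))
  also have "\<dots> = bind_pmf (bernoulli_pmf p) (\<lambda>b. bind_pmf ?B (\<lambda>k. iterate_kernel ?M ((if b then 1 else 0) + k) \<sigma>))"
    by (intro bind_pmf_cong refl) (auto simp: bind_commute_pmf[of ?B])
  also have "\<dots> = bind_pmf (binomial_pmf (Suc K) p) (\<lambda>k. iterate_kernel ?M k \<sigma>)"
    using p by (simp add: binomial_pmf_Suc bind_assoc_pmf bind_return_pmf)
  finally show ?case .
qed

section \<open>Proper colorings and their updates\<close>

text \<open>For a uniformly random permutation \<open>cs\<close> this is a uniform colour outside
  \<open>F\<close>, and the same \<open>cs\<close> serves every \<open>F\<close>: this is the grand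
  coupling of the updates in all states.\<close>

definition pick :: "'c list \<Rightarrow> 'c set \<Rightarrow> 'c" where
  "pick cs F = hd (filter (\<lambda>c. c \<notin> F) cs)"

lemma pick_in:
  assumes "\<exists>c\<in>set cs. c \<notin> F"
  shows "pick cs F \<in> set cs" "pick cs F \<notin> F"
proof -
  have "filter (\<lambda>c. c \<notin> F) cs \<noteq> []" using assms by (auto simp: filter_empty_conv)
  then have "pick cs F \<in> set (filter (\<lambda>c. c \<notin> F) cs)" unfolding pick_def by (rule hd_in_set)
  then show "pick cs F \<in> set cs" "pick cs F \<notin> F" by auto
qed

text \<open>Entries skipped for \<open>F\<close> are also skipped for \<open>G\<close>. This is how
  a choice made with partial knowledge of the blocked colours is seen to be the true one.\<close>

lemma pick_superset:
  assumes "\<exists>c\<in>set cs. c \<notin> F" "F \<subseteq> G" "pick cs F \<notin> G"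
  shows "pick cs G = pick cs F"
  using assms unfolding pick_def
proof (induction cs)
  case (Cons c cs)
  show ?case
  proof (cases "c \<in> F")
    case True
    then have "\<exists>c\<in>set cs. c \<notin> F" using Cons.prems by auto
    then show ?thesis using True Cons by auto
  qed (use Cons in auto)
qed simp

text \<open>By pigeonhole, \<open>Suc n\<close> distinct entries cannot all lie in
  \<open>F\<close>.\<close>

lemma pick_in_take:
  assumes "distinct cs" "finite F" "card F \<le> n" "n < length cs"
  shows "pick cs F \<in> set (take (Suc n) cs)"
proof -
  have "card (set (take (Suc n) cs)) = Suc n"
    using assms by (subst distinct_card) (auto simp: min_def)
  then have ex: "\<exists>c\<in>set (take (Suc n) cs). c \<notin> F"
    using assms card_mono[of F "set (take (Suc n) cs)"] by force
  have "filter (\<lambda>c. c \<notin> F) cs = filter (\<lambda>c. c \<notin> F) (take (Suc n) cs) @ filter (\<lambda>c. c \<notin> F) (drop (Suc n) cs)"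
    by (metis append_take_drop_id filter_append)
  moreover have "filter (\<lambda>c. c \<notin> F) (take (Suc n) cs) \<noteq> []" using ex by (auto simp: filter_empty_conv)
  ultimately have "pick cs F = pick (take (Suc n) cs) F" unfolding pick_def by simp
  then show ?thesis using pick_in(1)[OF ex] by simp
qed

lemma pick_map_inj:
  assumes "inj f" "\<And>c. f c \<in> F \<longleftrightarrow> c \<in> F" "\<exists>c\<in>set cs. c \<notin> F"
  shows "pick (map f cs) F = f (pick cs F)"
proof -
  have "filter (\<lambda>c. c \<notin> F) (map f cs) = map f (filter (\<lambda>c. c \<notin> F) cs)"
    by (simp add: filter_map o_def assms(2))
  moreover have "filter (\<lambda>c. c \<notin> F) cs \<noteq> []" using assms(3) by (auto simp: filter_empty_conv)
  ultimately show ?thesis unfolding pick_def by (simp add: hd_map)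
qed

lemma pmf_of_setI:
  assumes A: "finite A" and sub: "set_pmf p \<subseteq> A" and eq: "\<And>x y. x \<in> A \<Longrightarrow> y \<in> A \<Longrightarrow> pmf p x = pmf p y"
  shows "p = pmf_of_set A"
proof -
  have ne: "A \<noteq> {}" using sub set_pmf_not_empty[of p] by auto
  then obtain a where a: "a \<in> A" by auto
  have "1 = (\<Sum>x\<in>A. pmf p x)" using A sub by (simp add: sum_pmf_eq_1)
  also have "\<dots> = card A * pmf p a" using eq[OF _ a] by simp
  finally have pa: "pmf p a = 1 / card A" using A ne by (simp add: field_simps)
  show ?thesis
  proof (rule pmf_eqI)
    fix x
    show "pmf p x = pmf (pmf_of_set A) x"
      using eq[OF _ a, of x] pa A ne sub by (cases "x \<in> A") (auto simp: pmf_eq_0_set_pmf)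
  qed
qed

text \<open>Transposing two colours of \<open>C - F\<close> preserves \<open>F\<close> and the
  uniform law of \<open>cs\<close>, and exchanges the probabilities of the two colours.\<close>

lemma pick_uniform:
  assumes C: "finite C" "C - F \<noteq> {}"
  shows "map_pmf (\<lambda>cs. pick cs F) (pmf_of_set (permutations_of_set C)) = pmf_of_set (C - F)"
proof (rule pmf_of_setI)
  let ?P = "pmf_of_set (permutations_of_set C)"
  have ne: "permutations_of_set C \<noteq> {}" using C by simp
  have sP: "set_pmf ?P = permutations_of_set C" using ne by (simp add: set_pmf_of_set)
  have ex: "\<exists>c\<in>set cs. c \<notin> F" if "cs \<in> permutations_of_set C" for cs
    using that C by (auto simp: permutations_of_set_def)
  show "set_pmf (map_pmf (\<lambda>cs. pick cs F) ?P) \<subseteq> C - F"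
    using pick_in[OF ex] by (auto simp: sP dest: permutations_of_setD(1))
  fix x y assume xy: "x \<in> C - F" "y \<in> C - F"
  let ?f = "Transposition.transpose x y"
  have fF: "?f c \<in> F \<longleftrightarrow> c \<in> F" for c using xy by (cases "c = x"; cases "c = y") auto
  have perm: "?f permutes C" using xy by (intro permutes_swap_id) auto
  have map_eq: "map_pmf (map ?f) ?P = ?P"
  proof -
    have inj: "inj_on (map ?f) (permutations_of_set C)" by (auto simp: inj_on_def inj_map_eq_map[OF inj_transpose])
    have "map_pmf (map ?f) ?P = pmf_of_set (map ?f ` permutations_of_set C)"
      by (rule map_pmf_of_set_inj[OF inj ne]) simp
    then show ?thesis using permutations_of_set_image_permutes[OF perm] by simp
  qed
  have "map_pmf (\<lambda>cs. pick cs F) ?P = map_pmf (\<lambda>cs. pick cs F) (map_pmf (map ?f) ?P)"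
    unfolding map_eq ..
  also have "\<dots> = map_pmf (\<lambda>cs. ?f (pick cs F)) ?P"
    unfolding pmf.map_comp
    by (intro map_pmf_cong refl) (simp add: sP ex pick_map_inj fF)
  also have "\<dots> = map_pmf ?f (map_pmf (\<lambda>cs. pick cs F) ?P)" by (simp add: pmf.map_comp o_def)
  finally have "pmf (map_pmf (\<lambda>cs. pick cs F) ?P) y = pmf (map_pmf ?f (map_pmf (\<lambda>cs. pick cs F) ?P)) (?f x)" by simp
  also have "\<dots> = pmf (map_pmf (\<lambda>cs. pick cs F) ?P) x" by (rule pmf_map_inj') simp
  finally show "pmf (map_pmf (\<lambda>cs. pick cs F) ?P) x = pmf (map_pmf (\<lambda>cs. pick cs F) ?P) y" ..
qed (use C in auto)

text \<open>The boundary condition enters only through the sets \<open>forb x\<close> of colours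
  forbidden by it, which count towards the degree.\<close>

locale coloring_system =
  fixes V :: "'v set" and nbr :: "'v \<Rightarrow> 'v set" and forb :: "'v \<Rightarrow> nat set" and q \<Delta> :: nat
  assumes finite_V: "finite V" and V_nonempty: "V \<noteq> {}"
    and nbr_V: "\<And>x. x \<in> V \<Longrightarrow> nbr x \<subseteq> V"
    and nbr_sym: "\<And>x y. x \<in> V \<Longrightarrow> y \<in> nbr x \<Longrightarrow> x \<in> nbr y"
    and nbr_irrefl: "\<And>x. x \<in> V \<Longrightarrow> x \<notin> nbr x"
    and finite_forb: "\<And>x. x \<in> V \<Longrightarrow> finite (forb x)"
    and degree: "\<And>x. x \<in> V \<Longrightarrow> card (nbr x) + card (forb x) \<le> \<Delta>"
    and many_colors: "\<Delta> * (\<Delta> + 2) \<le> q" and \<Delta>_pos: "0 < \<Delta>"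
begin

definition \<Omega> :: "('v \<Rightarrow> nat) set" where
  "\<Omega> = {\<sigma> \<in> V \<rightarrow>\<^sub>E {1..q}. \<forall>x\<in>V. \<sigma> x \<notin> forb x \<and> (\<forall>y\<in>nbr x. \<sigma> y \<noteq> \<sigma> x)}"

definition blocked :: "('v \<Rightarrow> nat) \<Rightarrow> 'v \<Rightarrow> nat set" where
  "blocked \<sigma> x = forb x \<union> \<sigma> ` nbr x"

definition perms :: "nat list set" where "perms = permutations_of_set {1..q}"

fun step :: "('v \<times> nat list) option \<Rightarrow> ('v \<Rightarrow> nat) \<Rightarrow> 'v \<Rightarrow> nat" where
  "step None \<sigma> = \<sigma>"
| "step (Some (x, cs)) \<sigma> = \<sigma>(x := pick cs (blocked \<sigma> x))"

definition run :: "('v \<times> nat list) option list \<Rightarrow> ('v \<Rightarrow> nat) \<Rightarrow> 'v \<Rightarrow> nat" where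
  "run us \<sigma> = fold step us \<sigma>"

definition letters :: "('v \<times> nat list) pmf" where
  "letters = pair_pmf (pmf_of_set V) (pmf_of_set perms)"

text \<open>\<open>a\<close> is the probability that a given site rings during the slot; for slots
  of length 1/m it is 1/m.\<close>

definition slot :: "real \<Rightarrow> ('v \<times> nat list) option pmf" where
  "slot a = bind_pmf (bernoulli_pmf (real (card V) * a)) (\<lambda>b. if b then map_pmf Some letters else return_pmf None)"

definition \<mu> :: "('v \<Rightarrow> nat) pmf" where "\<mu> = pmf_of_set \<Omega>"

lemma run_Nil [simp]: "run [] \<sigma> = \<sigma>" and run_Cons [simp]: "run (u # us) \<sigma> = run us (step u \<sigma>)"
  and run_append [simp]: "run (us @ ws) \<sigma> = run ws (run us \<sigma>)"
  by (simp_all add: run_def)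

lemma card_V_pos: "0 < card V"
  using finite_V V_nonempty by (simp add: card_gt_0_iff)

lemma site_rate_le_1:
  assumes "0 \<le> a" "real (card V) * a \<le> 1"
  shows "a \<le> 1"
proof -
  have "1 * a \<le> real (card V) * a" using card_V_pos assms by (intro mult_right_mono) auto
  then show ?thesis using assms by simp
qed

lemma finite_nbr: "x \<in> V \<Longrightarrow> finite (nbr x)"
  using nbr_V finite_V finite_subset by blast

lemma q_gt: "\<Delta> < q"
proof -
  have "\<Delta> * 1 < \<Delta> * (\<Delta> + 2)" using \<Delta>_pos by (intro mult_strict_left_mono) auto
  then show ?thesis using many_colors by linarith
qed

lemma finite_blocked: "x \<in> V \<Longrightarrow> finite (blocked \<sigma> x)"
  by (simp add: blocked_def finite_nbr finite_forb)

lemma card_blocked: "x \<in> V \<Longrightarrow> card (blocked \<sigma> x) \<le> \<Delta>"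
  unfolding blocked_def using degree[of x] card_Un_le[of "forb x" "\<sigma> ` nbr x"] card_image_le[OF finite_nbr, of x \<sigma>]
  by linarith

lemma available: "x \<in> V \<Longrightarrow> {1..q} - blocked \<sigma> x \<noteq> {}"
proof
  assume x: "x \<in> V" and "{1..q} - blocked \<sigma> x = {}"
  then have "card {1..q} \<le> card (blocked \<sigma> x)" by (intro card_mono finite_blocked) auto
  then show False using card_blocked[OF x, of \<sigma>] q_gt by simp
qed

lemma finite_perms: "finite perms" and perms_nonempty: "perms \<noteq> {}"
  by (simp_all add: perms_def)

lemma permsD: "cs \<in> perms \<Longrightarrow> set cs = {1..q} \<and> distinct cs \<and> length cs = q"
  using distinct_card[of cs] by (auto simp: perms_def permutations_of_set_def)

lemma set_letters: "set_pmf letters = V \<times> perms"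
  using finite_V V_nonempty finite_perms perms_nonempty by (simp add: letters_def)

lemma pick_available:
  "x \<in> V \<Longrightarrow> cs \<in> perms \<Longrightarrow> pick cs (blocked \<sigma> x) \<in> {1..q} - blocked \<sigma> x"
  using pick_in[of cs "blocked \<sigma> x"] available[of x \<sigma>] permsD[of cs] by auto

lemma upd_\<Omega>:
  assumes s: "\<sigma> \<in> \<Omega>" and x: "x \<in> V" and c: "c \<in> {1..q} - blocked \<sigma> x"
  shows "\<sigma>(x := c) \<in> \<Omega>"
  unfolding \<Omega>_def
proof (intro CollectI conjI ballI)
  show "\<sigma>(x := c) \<in> V \<rightarrow>\<^sub>E {1..q}" using s x c by (auto simp: \<Omega>_def PiE_iff extensional_def)
  fix y assume y: "y \<in> V"
  show "(\<sigma>(x := c)) y \<notin> forb y" using s c y by (auto simp: \<Omega>_def blocked_def)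
  fix z assume z: "z \<in> nbr y"
  then have "z \<noteq> y" "y \<in> nbr z" using nbr_irrefl nbr_sym y by auto
  then show "(\<sigma>(x := c)) z \<noteq> (\<sigma>(x := c)) y"
    using s c y z by (auto simp: \<Omega>_def blocked_def)
qed

lemma step_\<Omega>: "\<sigma> \<in> \<Omega> \<Longrightarrow> u \<in> set_pmf (slot a) \<Longrightarrow> step u \<sigma> \<in> \<Omega>"
  by (cases u) (auto simp: slot_def set_letters simp del: atLeastAtMost_iff split: if_splits intro!: upd_\<Omega> pick_available)

lemma run_\<Omega>: "\<sigma> \<in> \<Omega> \<Longrightarrow> us \<in> set_pmf (replicate_pmf n (slot a)) \<Longrightarrow> run us \<sigma> \<in> \<Omega>"
proof (induction n arbitrary: us \<sigma>)
  case (Suc n)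
  then obtain u ws where "us = u # ws" "u \<in> set_pmf (slot a)" "ws \<in> set_pmf (replicate_pmf n (slot a))"
    by auto
  then show ?case using Suc.IH step_\<Omega> Suc.prems by simp
qed simp

lemma finite_\<Omega>: "finite \<Omega>"
proof (rule finite_subset)
  show "\<Omega> \<subseteq> V \<rightarrow>\<^sub>E {1..q}" by (auto simp: \<Omega>_def)
qed (simp add: finite_PiE finite_V)

text \<open>Greedy colouring, one site after the other: an unblocked colour always exists because
  \<open>q > \<Delta>\<close>.\<close>

lemma \<Omega>_nonempty: "\<Omega> \<noteq> {}"
proof -
  have "\<exists>\<sigma>. \<sigma> \<in> W \<rightarrow>\<^sub>E {1..q} \<and> (\<forall>x\<in>W. \<sigma> x \<notin> forb x \<and> (\<forall>y\<in>nbr x \<inter> W. \<sigma> y \<noteq> \<sigma> x))"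
    if "finite W" "W \<subseteq> V" for W
    using that
  proof (induction W rule: finite_induct)
    case (insert x W)
    then obtain \<sigma> where s: "\<sigma> \<in> W \<rightarrow>\<^sub>E {1..q}" "\<And>y. y \<in> W \<Longrightarrow> \<sigma> y \<notin> forb y \<and> (\<forall>z\<in>nbr y \<inter> W. \<sigma> z \<noteq> \<sigma> y)"
      by auto
    obtain c where c: "c \<in> {1..q}" "c \<notin> blocked \<sigma> x" using available[of x \<sigma>] insert.prems by blast
    have "(\<sigma>(x := c)) y \<notin> forb y \<and> (\<forall>z\<in>nbr y \<inter> insert x W. (\<sigma>(x := c)) z \<noteq> (\<sigma>(x := c)) y)"
      if y: "y \<in> insert x W" for y
    proof -
      have yV: "y \<in> V" using y insert.prems by auto
      have "(\<sigma>(x := c)) z \<noteq> (\<sigma>(x := c)) y" if z: "z \<in> nbr y \<inter> insert x W" for z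
      proof -
        have "z \<noteq> y" "y \<in> nbr z" using nbr_irrefl[OF yV] nbr_sym[OF yV] z by auto
        then show ?thesis using s(2)[of y] c z y by (auto simp: blocked_def)
      qed
      then show ?thesis using s(2)[of y] c y by (auto simp: blocked_def)
    qed
    moreover have "\<sigma>(x := c) \<in> insert x W \<rightarrow>\<^sub>E {1..q}" using s c by (auto simp: PiE_iff extensional_def)
    ultimately show ?case by blast
  qed auto
  from this[OF finite_V subset_refl] obtain \<sigma> where s: "\<sigma> \<in> V \<rightarrow>\<^sub>E {1..q}"
    "\<forall>x\<in>V. \<sigma> x \<notin> forb x \<and> (\<forall>y\<in>nbr x \<inter> V. \<sigma> y \<noteq> \<sigma> x)" by auto
  have "\<sigma> \<in> \<Omega>" unfolding \<Omega>_def using s nbr_V by blast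
  then show ?thesis by auto
qed

lemma finite_slot: "finite (set_pmf (slot a))"
proof (rule finite_subset)
  show "set_pmf (slot a) \<subseteq> insert None (Some ` (V \<times> perms))"
    by (auto simp: slot_def set_letters split: if_splits)
qed (simp add: finite_V finite_perms)

lemma resample_eq:
  assumes s: "\<sigma> \<in> \<Omega>" and x: "x \<in> V"
  shows "{\<eta> \<in> \<Omega>. \<forall>y\<in>V - {x}. \<eta> y = \<sigma> y} = (\<lambda>c. \<sigma>(x := c)) ` ({1..q} - blocked \<sigma> x)"
proof (intro equalityI subsetI)
  fix \<eta> assume e: "\<eta> \<in> {\<eta> \<in> \<Omega>. \<forall>y\<in>V - {x}. \<eta> y = \<sigma> y}"
  have "\<eta> = \<sigma>(x := \<eta> x)"
  proof
    fix y show "\<eta> y = (\<sigma>(x := \<eta> x)) y"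
      using e s by (cases "y \<in> V") (auto simp: \<Omega>_def PiE_iff extensional_def)
  qed
  moreover have "\<eta> x \<in> {1..q} - blocked \<sigma> x"
  proof
    show "\<eta> x \<in> {1..q}" using e x by (auto simp: \<Omega>_def)
    have "\<eta> x \<noteq> \<sigma> y" if y: "y \<in> nbr x" for y
    proof -
      have "y \<in> V - {x}" using nbr_V[OF x] nbr_irrefl[OF x] y by auto
      then have "\<sigma> y = \<eta> y" using e by auto
      moreover have "\<eta> y \<noteq> \<eta> x" using e x y by (simp add: \<Omega>_def)
      ultimately show ?thesis by simp
    qed
    then show "\<eta> x \<notin> blocked \<sigma> x" using e x by (auto simp: \<Omega>_def blocked_def)
  qed
  ultimately show "\<eta> \<in> (\<lambda>c. \<sigma>(x := c)) ` ({1..q} - blocked \<sigma> x)" by blast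
next
  fix \<eta> assume "\<eta> \<in> (\<lambda>c. \<sigma>(x := c)) ` ({1..q} - blocked \<sigma> x)"
  then show "\<eta> \<in> {\<eta> \<in> \<Omega>. \<forall>y\<in>V - {x}. \<eta> y = \<sigma> y}"
    using upd_\<Omega>[OF s x] by (auto split: if_splits)
qed

definition site_kernel :: "'v \<Rightarrow> ('v \<Rightarrow> nat) \<Rightarrow> ('v \<Rightarrow> nat) pmf" where
  "site_kernel x \<sigma> = map_pmf (\<lambda>cs. \<sigma>(x := pick cs (blocked \<sigma> x))) (pmf_of_set perms)"

text \<open>The permutation update is the heat-bath update: \<open>pick_uniform\<close> yields a
  uniform unblocked colour, and these colours parametrise the colourings that agree with
  \<open>\<sigma>\<close> off \<open>x\<close>.\<close>

lemma site_kernel_eq: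
  assumes s: "\<sigma> \<in> \<Omega>" and x: "x \<in> V"
  shows "site_kernel x \<sigma> = pmf_of_set {\<eta> \<in> \<Omega>. \<forall>y\<in>V - {x}. \<eta> y = \<sigma> y}"
proof -
  have "site_kernel x \<sigma> = map_pmf (\<lambda>c. \<sigma>(x := c)) (map_pmf (\<lambda>cs. pick cs (blocked \<sigma> x)) (pmf_of_set perms))"
    unfolding site_kernel_def by (simp add: pmf.map_comp o_def)
  also have "\<dots> = map_pmf (\<lambda>c. \<sigma>(x := c)) (pmf_of_set ({1..q} - blocked \<sigma> x))"
    unfolding perms_def using available[OF x] by (subst pick_uniform) auto
  also have "\<dots> = pmf_of_set ((\<lambda>c. \<sigma>(x := c)) ` ({1..q} - blocked \<sigma> x))"
    using available[OF x] by (intro map_pmf_of_set_inj) (auto simp: inj_on_def dest: fun_cong[where x=x])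
  finally show ?thesis unfolding resample_eq[OF s x] .
qed

lemma slot_exp:
  assumes a: "0 \<le> a" "real (card V) * a \<le> 1"
  shows "pmf_exp (slot a) h = (1 - real (card V) * a) * h None +
    a * (\<Sum>x\<in>V. pmf_exp (pmf_of_set perms) (\<lambda>cs. h (Some (x, cs))))"
proof -
  have fl: "finite (set_pmf letters)" by (simp add: set_letters finite_V finite_perms)
  have "pmf_exp letters (\<lambda>l. h (Some l)) = pmf_exp (pmf_of_set V) (\<lambda>x. pmf_exp (pmf_of_set perms) (\<lambda>cs. h (Some (x, cs))))"
    unfolding letters_def pair_pmf_def using finite_V V_nonempty finite_perms perms_nonempty
    by (simp add: pmf_exp_bind)
  also have "\<dots> = (\<Sum>x\<in>V. pmf_exp (pmf_of_set perms) (\<lambda>cs. h (Some (x, cs)))) / card V"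
    using finite_V V_nonempty by (simp add: integral_pmf_of_set)
  finally have l: "pmf_exp letters (\<lambda>l. h (Some l)) = \<dots>" .
  have "pmf_exp (slot a) h = pmf_exp (bernoulli_pmf (real (card V) * a))
     (\<lambda>b. pmf_exp (if b then map_pmf Some letters else return_pmf None) h)"
    unfolding slot_def by (intro pmf_exp_bind) (auto simp: fl)
  also have "\<dots> = real (card V) * a * pmf_exp letters (\<lambda>l. h (Some l)) + (1 - real (card V) * a) * h None"
    using a by simp
  finally show ?thesis unfolding l using card_V_pos by simp
qed

lemma pmf_slot_None:
  assumes "0 \<le> a" "real (card V) * a \<le> 1"
  shows "pmf (slot a) None = 1 - real (card V) * a"
proof -
  have "pmf (slot a) None = pmf_exp (slot a) (\<lambda>u. of_bool (u = None))"
    by (simp add: pmf_exp_indicator pmf.rep_eq)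
  also have "\<dots> = 1 - real (card V) * a" by (subst slot_exp[OF assms]) simp
  finally show ?thesis .
qed

end

section \<open>Histories and the bounding chain\<close>

context coloring_system
begin

text \<open>The sites whose initial values the value at \<open>x\<close> after the updates may depend on.\<close>

fun hist :: "('v \<times> nat list) option list \<Rightarrow> 'v \<Rightarrow> 'v set" where
  "hist [] x = {x}"
| "hist (None # us) x = hist us x"
| "hist (Some (z, cs) # us) x = (if z \<in> hist us x then hist us x \<union> nbr z else hist us x)"

lemma hist_Cons_mono: "hist us x \<subseteq> hist (u # us) x"
  by (cases u) (auto split: prod.splits)

lemma hist_V: "x \<in> V \<Longrightarrow> hist us x \<subseteq> V"
  by (induction us x rule: hist.induct) (use nbr_V in auto)

text \<open>If a site in the history of the later updates is updated first, \<open>hist\<close> also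
  contains its neighbours, and their colours together with the letter determine the new
  value.\<close>

lemma run_hist:
  "(\<And>z. z \<in> hist us x \<Longrightarrow> \<sigma> z = \<eta> z) \<Longrightarrow> run us \<sigma> x = run us \<eta> x"
proof (induction us arbitrary: \<sigma> \<eta>)
  case (Cons u us)
  have "step u \<sigma> w = step u \<eta> w" if w: "w \<in> hist us x" for w
  proof (cases u)
    case (Some l)
    obtain z cs where l: "l = (z, cs)" by (cases l)
    have sub: "hist us x \<subseteq> hist (u # us) x" by (rule hist_Cons_mono)
    show ?thesis
    proof (cases "w = z")
      case True
      then have "nbr z \<subseteq> hist (u # us) x" using w Some l by auto
      then have "\<sigma> ` nbr z = \<eta> ` nbr z" using Cons.prems by (intro image_cong) auto
      then show ?thesis using Some l True by (simp add: blocked_def)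
    qed (use Some l Cons.prems w sub in auto)
  qed (use Cons.prems w in simp)
  then have "run us (step u \<sigma>) x = run us (step u \<eta>) x" by (rule Cons.IH)
  then show ?case by simp
qed simp

text \<open>An erased update happens outside the history of the later updates, so by
  \<open>run_hist\<close> its effect never reaches \<open>x\<close>.\<close>

lemma run_mask:
  "hist us x \<subseteq> B \<Longrightarrow> run (map (mask (B \<times> UNIV)) us) \<sigma> x = run us \<sigma> x"
proof (induction us arbitrary: \<sigma>)
  case (Cons u us)
  have B: "hist us x \<subseteq> B" using Cons.prems hist_Cons_mono by blast
  show ?case
  proof (cases "mask (B \<times> UNIV) u = u")
    case True
    then show ?thesis using Cons.IH[OF B] by simp
  next
    case False
    then obtain z cs where u: "u = Some (z, cs)" "z \<notin> B" by (cases u) (auto split: if_splits)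
    then have "run us (step u \<sigma>) x = run us \<sigma> x" using B by (intro run_hist) auto
    then show ?thesis using u Cons.IH[OF B] by simp
  qed
qed simp

section \<open>Spread of uncertainty about the initial state\<close>

definition law :: "real \<Rightarrow> nat \<Rightarrow> ('v \<Rightarrow> nat) \<Rightarrow> ('v \<Rightarrow> nat) pmf" where
  "law a n \<sigma> = map_pmf (\<lambda>us. run us \<sigma>) (replicate_pmf n (slot a))"

definition valid :: "('v \<times> nat list) option list \<Rightarrow> bool" where
  "valid us \<longleftrightarrow> set us \<subseteq> insert None (Some ` (V \<times> perms))"

lemma valid_replicate: "us \<in> set_pmf (replicate_pmf n (slot a)) \<Longrightarrow> valid us"
proof -
  have "set_pmf (slot a) \<subseteq> insert None (Some ` (V \<times> perms))"
    by (auto simp: slot_def set_letters split: if_splits)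
  then show "us \<in> set_pmf (replicate_pmf n (slot a)) \<Longrightarrow> valid us"
    by (auto simp: set_replicate_pmf valid_def)
qed

lemma run_valid_\<Omega>: "\<sigma> \<in> \<Omega> \<Longrightarrow> valid us \<Longrightarrow> run us \<sigma> \<in> \<Omega>"
proof (induction us arbitrary: \<sigma>)
  case (Cons u us)
  have "step u \<sigma> \<in> \<Omega>"
    using Cons.prems by (cases u) (auto simp: valid_def simp del: atLeastAtMost_iff intro!: upd_\<Omega> pick_available)
  then show ?case using Cons by (auto simp: valid_def)
qed simp

definition values_at :: "('v \<times> nat list) option list \<Rightarrow> 'v \<Rightarrow> nat set" where
  "values_at us x = (\<lambda>\<sigma>. run us \<sigma> x) ` \<Omega>"

definition unc :: "('v \<times> nat list) option list \<Rightarrow> 'v set" where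
  "unc us = {x \<in> V. \<exists>\<sigma>\<in>\<Omega>. \<exists>\<eta>\<in>\<Omega>. run us \<sigma> x \<noteq> run us \<eta> x}"

definition rung :: "('v \<times> nat list) option list \<Rightarrow> 'v \<Rightarrow> bool" where
  "rung us x \<longleftrightarrow> (\<exists>cs. Some (x, cs) \<in> set us)"

lemma finite_values_at: "finite (values_at us x)"
  by (simp add: values_at_def finite_\<Omega>)

text \<open>The last ring at \<open>x\<close> takes its colour from the first
  \<open>\<Delta> + 1\<close> entries of one permutation, whatever the state before it.\<close>

lemma card_values_at:
  "x \<in> V \<Longrightarrow> valid us \<Longrightarrow> rung us x \<Longrightarrow> card (values_at us x) \<le> Suc \<Delta>"
proof (induction us rule: rev_induct)
  case (snoc u us)
  show ?case
  proof (cases "\<exists>cs. u = Some (x, cs)")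
    case True
    then obtain cs where u: "u = Some (x, cs)" by blast
    then have cs: "cs \<in> perms" using snoc.prems by (auto simp: valid_def)
    have "values_at (us @ [u]) x \<subseteq> set (take (Suc \<Delta>) cs)"
      unfolding values_at_def u
      using permsD[OF cs] q_gt finite_blocked[OF snoc.prems(1)] card_blocked[OF snoc.prems(1)]
      by (auto intro!: pick_in_take)
    then have "card (values_at (us @ [u]) x) \<le> card (set (take (Suc \<Delta>) cs))"
      by (intro card_mono) auto
    also have "\<dots> \<le> Suc \<Delta>" using card_length[of "take (Suc \<Delta>) cs"] by simp
    finally show ?thesis .
  next
    case False
    then have r: "run (us @ [u]) \<sigma> x = run us \<sigma> x" for \<sigma>
      by (cases u) auto
    have "rung us x" "valid us" using snoc.prems False by (auto simp: rung_def valid_def)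
    then show ?thesis using snoc unfolding values_at_def r by simp
  qed
qed (simp add: rung_def)

text \<open>At neighbours outside \<open>unc us\<close> all initial states lead to the same colour,
  so an arbitrary reference state reads it off. This is the part of \<open>blocked\<close> that the
  updates alone determine.\<close>

definition certain_blocked :: "('v \<times> nat list) option list \<Rightarrow> 'v \<Rightarrow> nat set" where
  "certain_blocked us x = forb x \<union> run us (SOME \<sigma>. \<sigma> \<in> \<Omega>) ` (nbr x - unc us)"

text \<open>Here a bounding chain of Huber is at work: if the first colour that no certain neighbour excludes
  is none of the possible values of the uncertain neighbours, every copy of the chain picks it.\<close>

lemma unc_snoc:
  assumes x: "x \<in> V" and cs: "cs \<in> perms" and v: "valid us"
    and unc: "x \<in> unc (us @ [Some (x, cs)])"
  shows "pick cs (certain_blocked us x) \<in> (\<Union>w\<in>nbr x \<inter> unc us. values_at us w)"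
proof (rule ccontr)
  let ?K = "certain_blocked us x" and ?s = "SOME \<sigma>. \<sigma> \<in> \<Omega>"
  assume not: "pick cs ?K \<notin> (\<Union>w\<in>nbr x \<inter> unc us. values_at us w)"
  have s: "?s \<in> \<Omega>" using \<Omega>_nonempty by (simp add: some_in_eq)
  have "pick cs (blocked (run us \<sigma>) x) = pick cs ?K" if \<sigma>: "\<sigma> \<in> \<Omega>" for \<sigma>
  proof (rule pick_superset)
    have cert: "run us ?s w = run us \<sigma> w" if "w \<in> nbr x - unc us" for w
      using that s \<sigma> nbr_V[OF x] by (auto simp: unc_def)
    show sub: "?K \<subseteq> blocked (run us \<sigma>) x"
      unfolding certain_blocked_def blocked_def using cert by force
    obtain c where c: "c \<in> {1..q}" "c \<notin> blocked (run us \<sigma>) x" using available[OF x] by blast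
    then show ex: "\<exists>c\<in>set cs. c \<notin> ?K" using permsD[OF cs] sub by blast
    show "pick cs ?K \<notin> blocked (run us \<sigma>) x"
    proof
      assume "pick cs ?K \<in> blocked (run us \<sigma>) x"
      then consider "pick cs ?K \<in> forb x" | w where "w \<in> nbr x" "pick cs ?K = run us \<sigma> w"
        by (auto simp: blocked_def)
      then show False
      proof cases
        case 1
        then show ?thesis using pick_in(2)[OF ex] by (auto simp: certain_blocked_def)
      next
        case 2
        then have "w \<in> unc us"
          using pick_in(2)[OF ex] cert[of w] by (force simp: certain_blocked_def)
        then show ?thesis using not 2 \<sigma> by (auto simp: values_at_def)
      qed
    qed
  qed
  then have "run (us @ [Some (x, cs)]) \<sigma> x = pick cs ?K" if "\<sigma> \<in> \<Omega>" for \<sigma> using that by simp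
  then show False using unc by (simp add: unc_def)
qed

text \<open>Bounds the chance, per uncertain neighbour, that an update leaves a site uncertain. The
  neighbour has at most \<open>\<Delta> + 1\<close> possible values; since it is uncertain, at most
  \<open>\<Delta> - 1\<close> colours are known to be blocked, which leaves at least
  \<open>q - \<Delta> + 1\<close>.\<close>

definition \<theta> :: real where "\<theta> = (real \<Delta> + 1) / (real q - real \<Delta> + 1)"

text \<open>Subcriticality of the spread. For integers,
  \<open>\<Delta> * (\<Delta> + 1) < q - \<Delta> + 1\<close> is exactly the assumption
  \<open>many_colors\<close>.\<close>

lemma \<theta>_nonneg: "0 \<le> \<theta>" and \<Delta>\<theta>_lt1: "real \<Delta> * \<theta> < 1"
proof -
  have q: "real \<Delta> < real q" using q_gt by simp
  then show "0 \<le> \<theta>" by (simp add: \<theta>_def)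
  have "real (\<Delta> * (\<Delta> + 2)) \<le> real q" using many_colors of_nat_le_iff by blast
  then have "real \<Delta> * (real \<Delta> + 1) < real q - real \<Delta> + 1" by (simp add: algebra_simps)
  then show "real \<Delta> * \<theta> < 1" using q by (simp add: \<theta>_def)
qed

text \<open>By \<open>unc_snoc\<close> the pick has to hit a possible value of an uncertain
  neighbour, which is estimated by counting. The count \<open>\<Delta> + 1\<close> per neighbour
  holds only after a ring, so a neighbour that has not rung is charged the trivial bound 1.\<close>

lemma unc_snoc_prob:
  assumes x: "x \<in> V" and v: "valid us"
  shows "pmf_exp (pmf_of_set perms) (\<lambda>cs. of_bool (x \<in> unc (us @ [Some (x, cs)])))
    \<le> (\<Sum>w\<in>nbr x. of_bool (\<not> rung us w) + \<theta> * of_bool (w \<in> unc us))"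
proof -
  let ?U = "nbr x \<inter> unc us" and ?K = "certain_blocked us x"
  let ?I = "\<Union>w\<in>?U. values_at us w"
  let ?P = "measure_pmf.prob (pmf_of_set perms) {cs. pick cs ?K \<in> ?I}"
  let ?R = "\<Sum>w\<in>nbr x. of_bool (\<not> rung us w) + \<theta> * of_bool (w \<in> unc us)"
  have fU: "finite ?U" using finite_nbr[OF x] by simp
  have fP: "finite (set_pmf (pmf_of_set perms))" using finite_perms perms_nonempty by simp
  have "pmf_exp (pmf_of_set perms) (\<lambda>cs. of_bool (x \<in> unc (us @ [Some (x, cs)])))
      \<le> pmf_exp (pmf_of_set perms) (\<lambda>cs. of_bool (pick cs ?K \<in> ?I))"
    using unc_snoc[OF x _ v] finite_perms perms_nonempty by (intro pmf_exp_mono fP) auto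
  also have "\<dots> = ?P" by (rule pmf_exp_indicator)
  also have "\<dots> \<le> ?R"
  proof (cases "?U = {} \<or> (\<exists>w\<in>nbr x. \<not> rung us w)")
    case True
    have R0: "0 \<le> ?R" by (intro sum_nonneg) (auto simp: \<theta>_nonneg)
    show ?thesis
    proof (cases "?U = {}")
      case False
      then obtain w where w: "w \<in> nbr x" "\<not> rung us w" using True by blast
      have "?P \<le> 1" by simp
      also have "1 \<le> of_bool (\<not> rung us w) + \<theta> * of_bool (w \<in> unc us)" using w \<theta>_nonneg by simp
      also have "\<dots> \<le> ?R" using w finite_nbr[OF x] by (intro member_le_sum) (auto simp: \<theta>_nonneg)
      finally show ?thesis .
    qed (use R0 in simp)
  next
    case False
    let ?u = "card ?U"
    have u: "1 \<le> ?u" using False fU by (simp add: Suc_le_eq card_gt_0_iff)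
    have fI: "finite ?I" using fU by (auto simp: finite_values_at)
    have "card ?I \<le> (\<Sum>w\<in>?U. card (values_at us w))" by (rule card_UN_le[OF fU])
    also have "\<dots> \<le> (\<Sum>w\<in>?U. Suc \<Delta>)"
      using False nbr_V[OF x] v by (intro sum_mono card_values_at) auto
    finally have cI: "card ?I \<le> ?u * Suc \<Delta>" by simp
    have fK: "finite ?K" unfolding certain_blocked_def using finite_nbr[OF x] finite_forb[OF x] by simp
    have "card ?K \<le> card (forb x) + card (nbr x - unc us)"
      unfolding certain_blocked_def
      using card_Un_le[of "forb x"] card_image_le[of "nbr x - unc us"] finite_nbr[OF x]
      by (meson add_left_mono finite_Diff order_trans)
    also have "card (nbr x - unc us) = card (nbr x) - ?u"
      using card_Diff_subset_Int[OF fU] by simp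
    \<comment> \<open>At least one neighbour is uncertain, which saves one in the degree
      bound.\<close>
    finally have cK: "card ?K + 1 \<le> \<Delta>"
      using degree[OF x] u card_mono[OF finite_nbr[OF x], of ?U] by simp
    have cA: "real q - real \<Delta> + 1 \<le> real (card ({1..q} - ?K))"
    proof -
      have "card {1..q} - card ?K \<le> card ({1..q} - ?K)" by (rule diff_card_le_card_Diff[OF fK])
      then show ?thesis using cK q_gt by (simp add: of_nat_diff)
    qed
    have q0: "0 < real q - real \<Delta> + 1" using q_gt by simp
    then have ne: "{1..q} - ?K \<noteq> {}"
    proof (intro notI)
      assume e: "{1..q} - ?K = {}"
      show False using cA q0 unfolding e by simp
    qed
    have "?P = measure_pmf.prob (map_pmf (\<lambda>cs. pick cs ?K) (pmf_of_set perms)) ?I"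
      by (simp add: vimage_def)
    also have "\<dots> = measure_pmf.prob (pmf_of_set ({1..q} - ?K)) ?I"
      unfolding perms_def using ne by (subst pick_uniform) auto
    also have "\<dots> = real (card (({1..q} - ?K) \<inter> ?I)) / real (card ({1..q} - ?K))"
      using ne by (subst measure_pmf_of_set) auto
    also have "\<dots> \<le> real (?u * Suc \<Delta>) / (real q - real \<Delta> + 1)"
    proof (rule frac_le)
      have "card (({1..q} - ?K) \<inter> ?I) \<le> card ?I" by (intro card_mono fI) auto
      then show "real (card (({1..q} - ?K) \<inter> ?I)) \<le> real (?u * Suc \<Delta>)" using cI by linarith
    qed (use cA q0 in auto)
    also have "\<dots> = (\<Sum>w\<in>?U. \<theta>)" by (simp add: \<theta>_def algebra_simps)
    also have "\<dots> = (\<Sum>w\<in>nbr x. \<theta> * of_bool (w \<in> unc us))"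
      using finite_nbr[OF x] by (intro sum.mono_neutral_cong_left) auto
    also have "\<dots> \<le> ?R" by (intro sum_mono) simp
    finally show ?thesis .
  qed
  finally show ?thesis .
qed

lemma unc_snoc_None [simp]: "unc (us @ [None]) = unc us"
  by (simp add: unc_def)

lemma unc_snoc_neq: "z \<noteq> x \<Longrightarrow> x \<in> unc (us @ [Some (z, cs)]) \<longleftrightarrow> x \<in> unc us"
  by (simp add: unc_def)

lemma rung_snoc [simp]: "rung (us @ [None]) x = rung us x"
    "rung (us @ [Some (z, cs)]) x \<longleftrightarrow> rung us x \<or> z = x"
  by (auto simp: rung_def)

text \<open>Half of the slack \<open>1 - \<Delta> * \<theta>\<close>; the other half pays for
  neighbours that have not rung yet. Equivalently
  \<open>gap + \<Delta> * \<theta> = 1 - gap\<close>, so uncertainty decays at rate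
  \<open>gap\<close> per unit of time.\<close>

definition gap :: real where "gap = (1 - real \<Delta> * \<theta>) / 2"

lemma gap_pos: "0 < gap" and gap_le: "gap \<le> 1 / 2"
  using \<Delta>\<theta>_lt1 \<theta>_nonneg by (simp_all add: gap_def)

lemma not_rung_prob:
  assumes a: "0 \<le> a" "real (card V) * a \<le> 1" and x: "x \<in> V"
  shows "pmf_exp (replicate_pmf n (slot a)) (\<lambda>us. of_bool (\<not> rung us x)) \<le> (1 - a) ^ n"
proof (induction n)
  case (Suc n)
  note cV = card_V_pos and a1 = site_rate_le_1[OF a]
  have "pmf_exp (slot a) (\<lambda>u. of_bool (\<not> rung (us @ [u]) x)) = (1 - a) * of_bool (\<not> rung us x)" for us
  proof -
    let ?f = "\<lambda>z. pmf_exp (pmf_of_set perms) (\<lambda>cs. of_bool (\<not> rung (us @ [Some (z, cs)]) x))"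
    have "(\<Sum>z\<in>V. ?f z) = ?f x + (\<Sum>z\<in>V - {x}. ?f z)"
      using x finite_V by (intro sum.remove) auto
    also have "?f x = 0" by simp
    also have "(\<Sum>z\<in>V - {x}. ?f z) = (\<Sum>z\<in>V - {x}. of_bool (\<not> rung us x))"
      by (intro sum.cong refl) simp
    also have "0 + \<dots> = (real (card V) - 1) * of_bool (\<not> rung us x)"
      using x finite_V cV by (simp add: of_nat_diff Suc_leI)
    finally have S: "(\<Sum>z\<in>V. ?f z) = (real (card V) - 1) * of_bool (\<not> rung us x)" by simp
    show ?thesis unfolding slot_exp[OF a] rung_snoc(1) S by (simp only: algebra_simps)
  qed
  then have "pmf_exp (replicate_pmf (Suc n) (slot a)) (\<lambda>us. of_bool (\<not> rung us x)) =
      (1 - a) * pmf_exp (replicate_pmf n (slot a)) (\<lambda>us. of_bool (\<not> rung us x))"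
    by (simp add: pmf_exp_replicate_snoc[OF finite_slot] del: replicate_pmf.simps)
  also have "\<dots> \<le> (1 - a) * (1 - a) ^ n" using Suc a1 by (intro mult_left_mono) auto
  finally show ?case by simp
qed (simp add: rung_def)

text \<open>The last slot is peeled off. If \<open>x\<close> rings there, uncertainty is inherited
  from the neighbours with weight \<open>\<theta>\<close> each, plus the chance that one of them
  never rang, which decays at least as fast because \<open>gap\<close> is below 1. The prefactor
  \<open>\<Delta> / gap\<close> is chosen such that this source term is a fraction
  \<open>gap\<close> of the bound.\<close>

lemma unc_prob:
  assumes a: "0 \<le> a" "real (card V) * a \<le> 1" and x: "x \<in> V"
  shows "pmf_exp (replicate_pmf n (slot a)) (\<lambda>us. of_bool (x \<in> unc us)) \<le> real \<Delta> / gap * (1 - a * gap) ^ n"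
  using x
proof (induction n arbitrary: x)
  case 0
  have "1 \<le> real \<Delta> / gap" using gap_pos gap_le \<Delta>_pos by (simp add: field_simps)
  then show ?case by simp
next
  case (Suc n)
  note x = Suc.prems
  let ?L = "replicate_pmf n (slot a)" and ?r = "1 - a * gap" and ?B = "real \<Delta> / gap"
  note cV = card_V_pos and a1 = site_rate_le_1[OF a]
  have fL: "finite (set_pmf ?L)" by (rule finite_set_replicate_pmf[OF finite_slot])
  have "a * gap \<le> a * 1" using a gap_le by (intro mult_left_mono) auto
  then have r: "1 - a \<le> ?r" "0 \<le> ?r" using a1 by auto
  have one: "pmf_exp (slot a) (\<lambda>u. of_bool (x \<in> unc (us @ [u]))) \<le>
      (1 - a) * of_bool (x \<in> unc us) + a * (\<Sum>w\<in>nbr x. of_bool (\<not> rung us w) + \<theta> * of_bool (w \<in> unc us))"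
    if v: "valid us" for us
  proof -
    let ?R = "\<Sum>w\<in>nbr x. of_bool (\<not> rung us w) + \<theta> * of_bool (w \<in> unc us)"
    let ?f = "\<lambda>z. pmf_exp (pmf_of_set perms) (\<lambda>cs. of_bool (x \<in> unc (us @ [Some (z, cs)])))"
    have "(\<Sum>z\<in>V. ?f z) = ?f x + (\<Sum>z\<in>V - {x}. ?f z)"
      using x finite_V by (intro sum.remove) auto
    also have "(\<Sum>z\<in>V - {x}. ?f z) = (\<Sum>z\<in>V - {x}. of_bool (x \<in> unc us))"
      by (intro sum.cong refl) (simp add: unc_snoc_neq)
    also have "\<dots> = (real (card V) - 1) * of_bool (x \<in> unc us)"
      using x finite_V cV by (simp add: of_nat_diff Suc_leI)
    also have "?f x \<le> ?R" by (rule unc_snoc_prob[OF x v])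
    finally have "(\<Sum>z\<in>V. ?f z) \<le> ?R + (real (card V) - 1) * of_bool (x \<in> unc us)" by simp
    then have "a * (\<Sum>z\<in>V. ?f z) \<le> a * (?R + (real (card V) - 1) * of_bool (x \<in> unc us))"
      using a by (intro mult_left_mono)
    moreover have "(1 - N * a) * I + a * S \<le> (1 - a) * I + a * R"
      if "a * S \<le> a * (R + (N - 1) * I)" for N I S R :: real
      using that by (simp add: algebra_simps)
    ultimately show ?thesis unfolding slot_exp[OF a] unc_snoc_None by blast
  qed
  have "pmf_exp (replicate_pmf (Suc n) (slot a)) (\<lambda>us. of_bool (x \<in> unc us)) =
      pmf_exp ?L (\<lambda>us. pmf_exp (slot a) (\<lambda>u. of_bool (x \<in> unc (us @ [u]))))"
    by (rule pmf_exp_replicate_snoc[OF finite_slot])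
  also have "\<dots> \<le> pmf_exp ?L (\<lambda>us. (1 - a) * of_bool (x \<in> unc us) +
      a * (\<Sum>w\<in>nbr x. of_bool (\<not> rung us w) + \<theta> * of_bool (w \<in> unc us)))"
    by (intro pmf_exp_mono fL one valid_replicate)
  also have "\<dots> = (1 - a) * pmf_exp ?L (\<lambda>us. of_bool (x \<in> unc us)) +
      a * (\<Sum>w\<in>nbr x. pmf_exp ?L (\<lambda>us. of_bool (\<not> rung us w)) + \<theta> * pmf_exp ?L (\<lambda>us. of_bool (w \<in> unc us)))"
    by (simp add: pmf_exp_add[OF fL] pmf_exp_sum[OF fL])
  also have "\<dots> \<le> (1 - a) * (?B * ?r ^ n) + a * (\<Sum>w\<in>nbr x. ?r ^ n + \<theta> * (?B * ?r ^ n))"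
  proof (intro add_mono mult_left_mono sum_mono)
    fix w assume "w \<in> nbr x"
    then have w: "w \<in> V" using nbr_V[OF x] by auto
    show "pmf_exp ?L (\<lambda>us. of_bool (w \<in> unc us)) \<le> ?B * ?r ^ n" by (rule Suc.IH[OF w])
    have "pmf_exp ?L (\<lambda>us. of_bool (\<not> rung us w)) \<le> (1 - a) ^ n" by (rule not_rung_prob[OF a w])
    also have "\<dots> \<le> ?r ^ n" using r a1 by (intro power_mono) auto
    finally show "pmf_exp ?L (\<lambda>us. of_bool (\<not> rung us w)) \<le> ?r ^ n" .
  next
    show "pmf_exp ?L (\<lambda>us. of_bool (x \<in> unc us)) \<le> ?B * ?r ^ n" by (rule Suc.IH[OF x])
  qed (use a a1 \<theta>_nonneg in auto)
  also have "\<dots> = (1 - a) * (?B * ?r ^ n) + a * (real (card (nbr x)) * ((1 + \<theta> * ?B) * ?r ^ n))"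
    by (simp add: algebra_simps)
  also have "\<dots> \<le> (1 - a) * (?B * ?r ^ n) + a * (real \<Delta> * ((1 + \<theta> * ?B) * ?r ^ n))"
  proof -
    have T: "0 \<le> (1 + \<theta> * ?B) * ?r ^ n" using r gap_pos \<theta>_nonneg by simp
    have "real (card (nbr x)) \<le> real \<Delta>" using degree[OF x] by simp
    then show ?thesis by (rule add_left_mono[OF mult_left_mono[OF mult_right_mono[OF _ T] a(1)]])
  qed
  also have "\<dots> = ?B * ?r ^ n * (1 - a + a * (gap + real \<Delta> * \<theta>))"
    using gap_pos by (simp add: field_simps)
  also have "1 - a + a * (gap + real \<Delta> * \<theta>) = ?r"
    unfolding gap_def by (simp add: field_simps)
  finally show ?case by (simp add: mult_ac)
qed

end

section \<open>Contraction from sparse dependence\<close>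

text \<open>\<open>ball_card\<close> counts centres rather than points of a ball: it bounds the
  number of balls of radius \<open>L\<close> that contain a given site.\<close>

locale coloring_geometry = coloring_system V nbr forb q \<Delta>
  for V :: "'v set" and nbr forb q \<Delta> +
  fixes dst :: "'v \<Rightarrow> 'v \<Rightarrow> nat" and \<beta> :: "nat \<Rightarrow> real"
  assumes dst_self: "x \<in> V \<Longrightarrow> dst x x = 0"
    and dst_step: "x \<in> V \<Longrightarrow> z \<in> V \<Longrightarrow> y \<in> nbr z \<Longrightarrow> dst x y \<le> Suc (dst x z)"
    and ball_card: "z \<in> V \<Longrightarrow> real (card {x \<in> V. dst x z \<le> L}) \<le> \<beta> L"

text \<open>The bound 1/2 on \<open>card V * a\<close> gives \<open>None\<close> the mass that
  \<open>shearer_cov\<close> demands.\<close>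

locale coloring_metric = coloring_geometry V nbr forb q \<Delta> dst \<beta>
  for V :: "'v set" and nbr forb q \<Delta> dst \<beta> +
  fixes a :: real
  assumes a_nonneg: "0 \<le> a" and a_small: "real (card V) * a \<le> 1 / 2"
begin

abbreviation slots :: "nat \<Rightarrow> ('v \<times> nat list) option list pmf" where
  "slots n \<equiv> replicate_pmf n (slot a)"

lemma a_le: "real (card V) * a \<le> 1"
  using a_small by simp

lemma finite_slots: "finite (set_pmf (slots n))"
  by (rule finite_set_replicate_pmf[OF finite_slot])

section \<open>Speed of information\<close>

definition ball :: "'v \<Rightarrow> nat \<Rightarrow> 'v set" where "ball x L = {z \<in> V. dst x z \<le> L}"

text \<open>Exponential moment of the history: a ring at one of its sites \<open>z\<close> adds at
  most \<open>\<Delta>\<close> neighbours, each of weight at most \<open>exp 1\<close> times that of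
  \<open>z\<close>, and \<open>z\<close> rings with probability \<open>a\<close> per slot.\<close>

lemma hist_weight_bound:
  assumes x: "x \<in> V"
  shows "pmf_exp (slots n) (\<lambda>us. \<Sum>z\<in>hist us x. exp (real (dst x z))) \<le> (1 + a * (\<Delta> * exp 1)) ^ n"
proof (induction n)
  case 0
  show ?case using dst_self[OF x] by simp
next
  case (Suc n)
  let ?e = "\<lambda>z. exp (real (dst x z))"
  let ?w = "\<lambda>us. \<Sum>z\<in>hist us x. ?e z"
  let ?D = "real \<Delta> * exp 1"
  have one: "pmf_exp (slot a) (\<lambda>u. ?w (u # us)) \<le> (1 + a * ?D) * ?w us" for us
  proof -
    let ?H = "hist us x"
    have HV: "?H \<subseteq> V" by (rule hist_V[OF x])
    have fH: "finite ?H" using HV finite_V finite_subset by blast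
    have w_le: "?w (Some (z, cs) # us) \<le> ?w us + (if z \<in> ?H then ?D * ?e z else 0)" for z cs
    proof (cases "z \<in> ?H")
      case True
      then have z: "z \<in> V" using HV by auto
      have "?w (Some (z, cs) # us) \<le> ?w us + (\<Sum>y\<in>nbr z. ?e y)"
        using True fH finite_nbr[OF z] by (simp add: sum_Un sum_nonneg)
      also have "(\<Sum>y\<in>nbr z. ?e y) \<le> (\<Sum>y\<in>nbr z. exp 1 * ?e z)"
      proof (rule sum_mono)
        fix y assume "y \<in> nbr z"
        then have "?e y \<le> exp (real (Suc (dst x z)))" using dst_step[OF x z] by (simp del: of_nat_Suc)
        then show "?e y \<le> exp 1 * ?e z" by (simp add: exp_add)
      qed
      also have "\<dots> = real (card (nbr z)) * (exp 1 * ?e z)" by simp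
      also have "\<dots> \<le> real \<Delta> * (exp 1 * ?e z)" using degree[OF z] by (intro mult_right_mono) auto
      finally show ?thesis using True by (simp add: mult.assoc)
    qed simp
    have fp: "finite (set_pmf (pmf_of_set perms))" using finite_perms perms_nonempty by simp
    have "(\<Sum>z\<in>V. pmf_exp (pmf_of_set perms) (\<lambda>cs. ?w (Some (z, cs) # us)))
       \<le> (\<Sum>z\<in>V. ?w us + (if z \<in> ?H then ?D * ?e z else 0))"
    proof (rule sum_mono)
      fix z
      have "pmf_exp (pmf_of_set perms) (\<lambda>cs. ?w (Some (z, cs) # us))
          \<le> pmf_exp (pmf_of_set perms) (\<lambda>cs. ?w us + (if z \<in> ?H then ?D * ?e z else 0))"
        by (intro pmf_exp_mono fp w_le)
      then show "pmf_exp (pmf_of_set perms) (\<lambda>cs. ?w (Some (z, cs) # us)) \<le> ?w us + (if z \<in> ?H then ?D * ?e z else 0)"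
        by simp
    qed
    also have "\<dots> = real (card V) * ?w us + ?D * ?w us"
      using finite_V HV by (simp add: sum.distrib sum.If_cases Int_absorb1 sum_distrib_left)
    finally have "a * (\<Sum>z\<in>V. pmf_exp (pmf_of_set perms) (\<lambda>cs. ?w (Some (z, cs) # us)))
       \<le> a * (real (card V) * ?w us + ?D * ?w us)"
      using a_nonneg by (rule mult_left_mono)
    moreover have "(1 - N * a) * W + a * S \<le> (1 + a * D) * W" if "a * S \<le> a * (N * W + D * W)" for N W S D
      using that by (simp add: algebra_simps)
    moreover have "?w (None # us) = ?w us" by simp
    ultimately show ?thesis unfolding slot_exp[OF a_nonneg a_le] by metis
  qed
  have "pmf_exp (slots (Suc n)) ?w = pmf_exp (slot a) (\<lambda>u. pmf_exp (slots n) (\<lambda>us. ?w (u # us)))"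
    by (rule pmf_exp_replicate_Suc[OF finite_slot])
  \<comment> \<open>The head of the list is the earliest update and the one that extends the
    history, so it is averaged for fixed later updates.\<close>
  also have "\<dots> = pmf_exp (slots n) (\<lambda>us. pmf_exp (slot a) (\<lambda>u. ?w (u # us)))"
    by (rule pmf_exp_swap[OF finite_slot finite_slots])
  also have "\<dots> \<le> pmf_exp (slots n) (\<lambda>us. (1 + a * ?D) * ?w us)"
    by (intro pmf_exp_mono finite_slots one)
  also have "\<dots> = (1 + a * ?D) * pmf_exp (slots n) ?w" by simp
  also have "\<dots> \<le> (1 + a * ?D) * (1 + a * ?D) ^ n" using Suc a_nonneg by (intro mult_left_mono) auto
  finally show ?case by simp
qed

definition escapes :: "nat \<Rightarrow> ('v \<times> nat list) option list \<Rightarrow> bool" where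
  "escapes L us \<longleftrightarrow> (\<exists>x\<in>V. \<not> hist us x \<subseteq> ball x L)"

text \<open>Markov's inequality for the exponential weight, with a union over the centres;
  \<open>a * n\<close> is the elapsed time.\<close>

definition esc :: "nat \<Rightarrow> nat \<Rightarrow> real" where
  "esc n L = real (card V) * exp (a * n * (\<Delta> * exp 1) - L)"

lemma escapes_prob: "pmf_exp (slots n) (\<lambda>us. of_bool (escapes L us)) \<le> esc n L"
proof -
  let ?w = "\<lambda>x us. \<Sum>z\<in>hist us x. exp (real (dst x z))"
  have pt: "of_bool (\<not> hist us x \<subseteq> ball x L) \<le> exp (- real L) * ?w x us" if x: "x \<in> V" for us x
  proof (cases "hist us x \<subseteq> ball x L")
    case False
    then obtain z where z: "z \<in> hist us x" "z \<notin> ball x L" by blast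
    moreover have "z \<in> V" using hist_V[OF x] z by blast
    ultimately have z: "z \<in> hist us x" "L < dst x z" by (auto simp: ball_def)
    have f: "finite (hist us x)" using hist_V[OF x] finite_V finite_subset by blast
    have "exp (real L) \<le> exp (real (dst x z))" using z by simp
    also have "\<dots> \<le> ?w x us" using z f by (intro member_le_sum) auto
    finally show ?thesis using False by (simp add: exp_minus field_simps)
  qed (simp add: sum_nonneg)
  have "pmf_exp (slots n) (\<lambda>us. of_bool (escapes L us)) \<le> pmf_exp (slots n) (\<lambda>us. \<Sum>x\<in>V. exp (- real L) * ?w x us)"
  proof (intro pmf_exp_mono finite_slots)
    fix us
    have "of_bool (escapes L us) \<le> (\<Sum>x\<in>V. of_bool (\<not> hist us x \<subseteq> ball x L) :: real)"
    proof (cases "escapes L us")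
      case True
      then obtain x where x: "x \<in> V" "\<not> hist us x \<subseteq> ball x L" by (auto simp: escapes_def)
      then have "of_bool (\<not> hist us x \<subseteq> ball x L) \<le> (\<Sum>x\<in>V. of_bool (\<not> hist us x \<subseteq> ball x L) :: real)"
        using finite_V by (intro member_le_sum) auto
      then show ?thesis using x True by simp
    qed (simp add: sum_nonneg)
    also have "\<dots> \<le> (\<Sum>x\<in>V. exp (- real L) * ?w x us)" by (intro sum_mono pt)
    finally show "of_bool (escapes L us) \<le> (\<Sum>x\<in>V. exp (- real L) * ?w x us)" .
  qed
  also have "\<dots> = (\<Sum>x\<in>V. exp (- real L) * pmf_exp (slots n) (?w x))"
    by (simp add: pmf_exp_sum[OF finite_slots])
  also have "\<dots> \<le> (\<Sum>x\<in>V. exp (- real L) * (1 + a * (\<Delta> * exp 1)) ^ n)"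
    by (intro sum_mono mult_left_mono hist_weight_bound) auto
  also have "\<dots> \<le> (\<Sum>x\<in>V. exp (- real L) * exp (a * (\<Delta> * exp 1)) ^ n)"
    using exp_ge_add_one_self[of "a * (\<Delta> * exp 1)"] a_nonneg by (intro sum_mono mult_left_mono power_mono) auto
  also have "\<dots> = esc n L"
    by (simp add: esc_def exp_of_nat_mult[symmetric] exp_diff exp_minus field_simps)
  finally show ?thesis .
qed

section \<open>Sparse dependence on the earlier updates\<close>

definition influenced :: "nat \<Rightarrow> ('v \<times> nat list) option list \<Rightarrow> 'v set" where
  "influenced L ws = (\<Union>x\<in>unc ws. ball x L)"

definition \<delta> :: "nat \<Rightarrow> nat \<Rightarrow> real" where
  "\<delta> k L = \<beta> L * (\<Delta> / gap * (1 - a * gap) ^ k)"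

lemma a_gap: "0 \<le> 1 - a * gap"
proof -
  have "a * gap \<le> 1 * 1"
    using site_rate_le_1[OF a_nonneg a_le] gap_le gap_pos a_nonneg by (intro mult_mono) auto
  then show ?thesis by simp
qed

lemma \<beta>_nonneg: "0 \<le> \<beta> L"
  using V_nonempty ball_card[of _ L] by (meson all_not_in_conv of_nat_0_le_iff order_trans)

lemma \<delta>_nonneg: "0 \<le> \<delta> k L"
  using a_gap gap_pos \<beta>_nonneg by (simp add: \<delta>_def)

text \<open>Union bound over the centres whose ball contains \<open>z\<close>, which are what
  \<open>ball_card\<close> counts.\<close>

lemma influenced_prob: "pmf_exp (slots k) (\<lambda>ws. of_bool (z \<in> influenced L ws)) \<le> \<delta> k L"
proof (cases "z \<in> V")
  case True
  let ?X = "{x \<in> V. dst x z \<le> L}" and ?B = "\<Delta> / gap * (1 - a * gap) ^ k"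
  have "pmf_exp (slots k) (\<lambda>ws. of_bool (z \<in> influenced L ws)) \<le> pmf_exp (slots k) (\<lambda>ws. \<Sum>x\<in>?X. of_bool (x \<in> unc ws))"
  proof (intro pmf_exp_mono finite_slots)
    fix ws
    show "of_bool (z \<in> influenced L ws) \<le> (\<Sum>x\<in>?X. of_bool (x \<in> unc ws) :: real)"
    proof (cases "z \<in> influenced L ws")
      case True
      then obtain x where x: "x \<in> unc ws" "x \<in> ?X" by (auto simp: influenced_def ball_def unc_def)
      then have "of_bool (x \<in> unc ws) \<le> (\<Sum>x\<in>?X. of_bool (x \<in> unc ws) :: real)"
        using finite_V by (intro member_le_sum) auto
      then show ?thesis using x True by simp
    qed (simp add: sum_nonneg)
  qed
  also have "\<dots> = (\<Sum>x\<in>?X. pmf_exp (slots k) (\<lambda>ws. of_bool (x \<in> unc ws)))"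
    by (rule pmf_exp_sum[OF finite_slots])
  also have "\<dots> \<le> (\<Sum>x\<in>?X. ?B)" by (intro sum_mono unc_prob a_nonneg a_le) auto
  also have "\<dots> \<le> \<beta> L * ?B"
    using ball_card[OF True, of L] a_gap gap_pos by (simp only: sum_constant) (intro mult_right_mono, auto)
  finally show ?thesis by (simp add: \<delta>_def)
next
  case False
  then have "z \<notin> influenced L ws" for ws by (auto simp: influenced_def ball_def)
  then show ?thesis using \<delta>_nonneg by simp
qed

text \<open>A substitute for \<open>run (us @ ws) \<sigma>\<close> that sees \<open>us\<close> only
  inside \<open>influenced L ws\<close>, without exception. Where \<open>ws\<close> decides the
  colour, the start \<open>\<sigma>\<close> is as good as the true state before \<open>ws\<close>;
  elsewhere only the updates in a ball around the site are used.\<close>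

definition local_run :: "nat \<Rightarrow> ('v \<Rightarrow> nat) \<Rightarrow> ('v \<times> nat list) option list \<Rightarrow> ('v \<times> nat list) option list \<Rightarrow> 'v \<Rightarrow> nat" where
  "local_run L \<sigma> us ws = (\<lambda>x. if x \<in> unc ws then run (map (mask (ball x L \<times> UNIV)) (us @ ws)) \<sigma> x else run ws \<sigma> x)"

lemma local_run_eq:
  assumes "\<sigma> \<in> \<Omega>" "valid us" "valid ws" "\<not> escapes L (us @ ws)"
  shows "local_run L \<sigma> us ws = run (us @ ws) \<sigma>"
proof
  fix x
  have r: "run us \<sigma> \<in> \<Omega>" using assms by (intro run_valid_\<Omega>)
  consider "x \<in> unc ws" | "x \<notin> unc ws" "x \<in> V" | "x \<notin> V" by blast
  then show "local_run L \<sigma> us ws x = run (us @ ws) \<sigma> x"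
  proof cases
    case 1
    then have "hist (us @ ws) x \<subseteq> ball x L" using assms(4) by (auto simp: escapes_def unc_def)
    from run_mask[OF this, of \<sigma>] show ?thesis using 1 by (simp add: local_run_def)
  next
    case 2
    then have "run ws \<sigma> x = run ws (run us \<sigma>) x" using assms(1) r unfolding unc_def by blast
    then show ?thesis using 2 by (simp add: local_run_def)
  next
    \<comment> \<open>Off \<open>V\<close> every colouring takes the value \<open>undefined\<close>,
      so the runs agree there too.\<close>
    case 3
    have "run ws \<sigma> \<in> \<Omega>" "run ws (run us \<sigma>) \<in> \<Omega>" using assms r by (auto intro: run_valid_\<Omega>)
    then have "run ws \<sigma> x = undefined" "run ws (run us \<sigma>) x = undefined"
      using 3 by (auto simp: \<Omega>_def PiE_iff extensional_def)
    then show ?thesis using 3 by (auto simp: local_run_def unc_def)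
  qed
qed

text \<open>Every ball that \<open>local_run\<close> looks into lies in
  \<open>influenced L ws\<close>, so the coarser mask hides nothing that is used. This is the
  invariance that \<open>shearer_cov\<close> asks of its test functions.\<close>

lemma local_run_mask:
  "local_run L \<sigma> (map (mask (influenced L ws \<times> UNIV)) us) ws = local_run L \<sigma> us ws"
proof
  fix x
  have "mask (ball x L \<times> UNIV) (mask (influenced L ws \<times> UNIV) u) = mask (ball x L \<times> UNIV) u"
    if "x \<in> unc ws" for u :: "('v \<times> nat list) option"
    using that by (cases u) (auto simp: influenced_def)
  then show "local_run L \<sigma> (map (mask (influenced L ws \<times> UNIV)) us) ws x = local_run L \<sigma> us ws x"
    by (simp add: local_run_def o_def)
qed

text \<open>\<open>g\<close> is a density with respect to the law after \<open>n\<close> slots, and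
  the left-hand side is the difference that tilting by \<open>g\<close> still makes after
  \<open>k\<close> further slots. Shearer's inequality bounds it for \<open>local_run\<close>; the
  two runs differ only when a history escapes, and there \<open>g - 1\<close> is at most
  \<open>1 + B\<close> in modulus.\<close>

lemma tilted_run:
  assumes s: "\<sigma> \<in> \<Omega>" and g: "\<And>\<eta>. 0 \<le> g \<eta>" "\<And>\<eta>. g \<eta> \<le> B" and g1: "pmf_exp (slots n) (\<lambda>us. g (run us \<sigma>)) = 1"
  shows "\<bar>pmf_exp (slots n) (\<lambda>us. (g (run us \<sigma>) - 1) * pmf_exp (slots k) (\<lambda>ws. of_bool (run (us @ ws) \<sigma> \<in> A)))\<bar>
    \<le> sqrt (2 * \<delta> k L * B) + (1 + B) * esc (n + k) L"
proof -
  let ?g = "\<lambda>us. g (run us \<sigma>)"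
  let ?f = "\<lambda>us ws. of_bool (run (us @ ws) \<sigma> \<in> A) :: real"
  let ?h = "\<lambda>ws us. of_bool (local_run L \<sigma> us ws \<in> A) :: real"
  let ?E = "\<lambda>F. pmf_exp (slots n) (\<lambda>us. pmf_exp (slots k) (F us))"
  note fin = finite_slots
  have B0: "0 \<le> B" using g[of undefined] by linarith
  have "(pmf_exp (slots k) (\<lambda>ws. pmf_exp (slots n) (\<lambda>us. (?g us - pmf_exp (slots n) ?g) * ?h ws us)))\<^sup>2
      \<le> (2 * \<delta> k L * pmf_var (slots n) ?g) * pmf_exp (slots k) (\<lambda>ws. pmf_var (slots n) (?h ws))"
  proof (rule shearer_cov[where A="\<lambda>ws. influenced L ws \<times> UNIV"])
    show "1 / 2 \<le> pmf (slot a) None"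
      using a_small by (simp add: pmf_slot_None[OF a_nonneg a_le])
    fix l :: "'v \<times> nat list"
    show "measure_pmf.prob (slots k) {ws. l \<in> influenced L ws \<times> UNIV} \<le> \<delta> k L"
      using influenced_prob[of k "fst l" L] unfolding pmf_exp_indicator by (cases l) simp
  qed (auto simp: finite_slot fin \<delta>_nonneg local_run_mask)
  also have "\<dots> \<le> (2 * \<delta> k L * B) * 1"
  proof (intro mult_mono mult_left_mono)
    \<comment> \<open>A density bounded by \<open>B\<close> has second moment at most
      \<open>B\<close> times its mean, which is one.\<close>
    have "pmf_var (slots n) ?g \<le> pmf_exp (slots n) (\<lambda>us. (?g us - 0)\<^sup>2)" by (rule pmf_var_le[OF fin])
    also have "\<dots> \<le> pmf_exp (slots n) (\<lambda>us. B * ?g us)"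
      using g by (intro pmf_exp_mono fin) (auto simp: power2_eq_square intro: mult_right_mono)
    also have "\<dots> = B" using g1 by simp
    finally show "pmf_var (slots n) ?g \<le> B" .
    have "pmf_var (slots n) (?h ws) \<le> 1" for ws
    proof -
      have "pmf_var (slots n) (?h ws) \<le> pmf_exp (slots n) (\<lambda>us. (?h ws us - 0)\<^sup>2)" by (rule pmf_var_le[OF fin])
      also have "\<dots> \<le> pmf_exp (slots n) (\<lambda>us. 1)" by (intro pmf_exp_mono fin) auto
      finally show ?thesis by simp
    qed
    then have "pmf_exp (slots k) (\<lambda>ws. pmf_var (slots n) (?h ws)) \<le> pmf_exp (slots k) (\<lambda>ws. 1)"
      by (intro pmf_exp_mono fin)
    then show "pmf_exp (slots k) (\<lambda>ws. pmf_var (slots n) (?h ws)) \<le> 1" by simp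
  qed (auto simp: \<delta>_nonneg B0 intro!: pmf_exp_nonneg pmf_var_nonneg)
  finally have "\<bar>pmf_exp (slots k) (\<lambda>ws. pmf_exp (slots n) (\<lambda>us. (?g us - 1) * ?h ws us))\<bar> \<le> sqrt (2 * \<delta> k L * B)"
    unfolding g1 by (intro real_le_rsqrt) simp
  also have "pmf_exp (slots k) (\<lambda>ws. pmf_exp (slots n) (\<lambda>us. (?g us - 1) * ?h ws us)) =
      ?E (\<lambda>us ws. (?g us - 1) * ?h ws us)"
    by (rule pmf_exp_swap[OF fin fin])
  finally have main: "\<bar>?E (\<lambda>us ws. (?g us - 1) * ?h ws us)\<bar> \<le> sqrt (2 * \<delta> k L * B)" .
  have "\<bar>?E (\<lambda>us ws. (?g us - 1) * (?f us ws - ?h ws us))\<bar> \<le> ?E (\<lambda>us ws. (1 + B) * of_bool (escapes L (us @ ws)))"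
  proof -
    have "\<bar>?E (\<lambda>us ws. (?g us - 1) * (?f us ws - ?h ws us))\<bar> \<le> pmf_exp (slots n) (\<lambda>us. \<bar>pmf_exp (slots k) (\<lambda>ws. (?g us - 1) * (?f us ws - ?h ws us))\<bar>)"
      by (rule integral_abs_bound)
    also have "\<dots> \<le> ?E (\<lambda>us ws. \<bar>(?g us - 1) * (?f us ws - ?h ws us)\<bar>)"
      by (intro pmf_exp_mono fin) (rule integral_abs_bound)
    also have "\<dots> \<le> ?E (\<lambda>us ws. (1 + B) * of_bool (escapes L (us @ ws)))"
    proof (intro pmf_exp_mono fin)
      fix us ws assume v: "us \<in> set_pmf (slots n)" "ws \<in> set_pmf (slots k)"
      show "\<bar>(?g us - 1) * (?f us ws - ?h ws us)\<bar> \<le> (1 + B) * of_bool (escapes L (us @ ws))"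
      proof (cases "escapes L (us @ ws)")
        case True
        have "\<bar>?g us - 1\<bar> \<le> 1 + B" using g[of "run us \<sigma>"] B0 by (auto simp: abs_le_iff)
        then have "\<bar>?g us - 1\<bar> * \<bar>?f us ws - ?h ws us\<bar> \<le> (1 + B) * 1" using B0 by (intro mult_mono) auto
        then show ?thesis using True by (simp add: abs_mult)
      next
        case False
        then show ?thesis using local_run_eq[OF s valid_replicate[OF v(1)] valid_replicate[OF v(2)]] by simp
      qed
    qed
    finally show ?thesis .
  qed
  also have "\<dots> = (1 + B) * pmf_exp (slots (n + k)) (\<lambda>us. of_bool (escapes L us))"
    by (simp add: pmf_exp_replicate_add[OF finite_slot])
  also have "\<dots> \<le> (1 + B) * esc (n + k) L" using B0 by (intro mult_left_mono escapes_prob) auto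
  finally have err: "\<bar>?E (\<lambda>us ws. (?g us - 1) * (?f us ws - ?h ws us))\<bar> \<le> (1 + B) * esc (n + k) L" .
  have "?E (\<lambda>us ws. (?g us - 1) * ?f us ws) = ?E (\<lambda>us ws. (?g us - 1) * ?h ws us) + ?E (\<lambda>us ws. (?g us - 1) * (?f us ws - ?h ws us))"
    by (simp add: pmf_exp_add[OF fin, symmetric] algebra_simps)
  then have "pmf_exp (slots n) (\<lambda>us. (?g us - 1) * pmf_exp (slots k) (?f us)) =
      ?E (\<lambda>us ws. (?g us - 1) * ?h ws us) + ?E (\<lambda>us ws. (?g us - 1) * (?f us ws - ?h ws us))"
    by simp
  then show ?thesis using main err by linarith
qed

abbreviation slot_law :: "nat \<Rightarrow> ('v \<Rightarrow> nat) \<Rightarrow> ('v \<Rightarrow> nat) pmf" where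
  "slot_law \<equiv> law a"

lemma set_slot_law: "\<sigma> \<in> \<Omega> \<Longrightarrow> set_pmf (slot_law n \<sigma>) \<subseteq> \<Omega>"
  by (auto simp: law_def intro: run_\<Omega>)

lemma slot_law_exp: "pmf_exp (slot_law n \<sigma>) h = pmf_exp (slots n) (\<lambda>us. h (run us \<sigma>))"
  by (simp add: law_def)

lemma slot_law_prob: "measure_pmf.prob (slot_law n \<sigma>) A = pmf_exp (slots n) (\<lambda>us. of_bool (run us \<sigma> \<in> A))"
  unfolding pmf_exp_indicator by (simp add: law_def vimage_def)

text \<open>The two laws have a common part of mass at least \<open>\<epsilon>\<close>. Normalised, it has density at most
  \<open>1 / \<epsilon>\<close> with respect to both, so \<open>k\<close> further slots bring both laws close to the evolved common part.\<close>

theorem slot_law_contract: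
  assumes s: "\<sigma> \<in> \<Omega>" "\<eta> \<in> \<Omega>" and e: "0 < \<epsilon>"
    and tv: "\<And>A. measure_pmf.prob (slot_law n \<sigma>) A - measure_pmf.prob (slot_law m \<eta>) A \<le> 1 - \<epsilon>"
  shows "\<bar>measure_pmf.prob (slot_law (n + k) \<sigma>) A - measure_pmf.prob (slot_law (m + k) \<eta>) A\<bar>
    \<le> 2 * sqrt (2 * \<delta> k L / \<epsilon>) + (1 + 1 / \<epsilon>) * (esc (n + k) L + esc (m + k) L)"
proof -
  define P where "P = slot_law n \<sigma>"
  define R where "R = slot_law m \<eta>"
  define w where "w = (\<Sum>x\<in>\<Omega>. min (pmf P x) (pmf R x))"
  have sP: "set_pmf P \<subseteq> \<Omega>" using s set_slot_law by (auto simp: P_def)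
  have w: "\<epsilon> \<le> w"
  proof -
    \<comment> \<open>On this set the first law exceeds the second. The excess is their total
      variation distance, and what remains is the common mass.\<close>
    let ?A = "{x \<in> \<Omega>. pmf R x < pmf P x}"
    have "w = (\<Sum>x\<in>\<Omega>. pmf P x - (if pmf R x < pmf P x then pmf P x - pmf R x else 0))"
      unfolding w_def by (intro sum.cong) auto
    also have "\<dots> = 1 - (\<Sum>x\<in>\<Omega>. if pmf R x < pmf P x then pmf P x - pmf R x else 0)"
      using finite_\<Omega> sP by (simp add: sum_subtractf sum_pmf_eq_1)
    also have "(\<Sum>x\<in>\<Omega>. if pmf R x < pmf P x then pmf P x - pmf R x else 0) = (\<Sum>x\<in>?A. pmf P x - pmf R x)"
      by (rule sum.inter_filter[OF finite_\<Omega>, symmetric])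
    also have "(\<Sum>x\<in>?A. pmf P x - pmf R x) = measure_pmf.prob P ?A - measure_pmf.prob R ?A"
      using finite_\<Omega> by (simp add: measure_measure_pmf_finite sum_subtractf)
    finally show ?thesis using tv[of ?A] by (simp add: P_def R_def)
  qed
  have w0: "0 < w" using w e by simp
  define r where "r x = min (pmf P x) (pmf R x) / w" for x
  define K where "K x = pmf_exp (slots k) (\<lambda>ws. of_bool (run ws x \<in> A))" for x
  have K: "measure_pmf.prob (slot_law (j + k) \<xi>) A = pmf_exp (slots j) (\<lambda>us. K (run us \<xi>))" for j \<xi>
    unfolding slot_law_prob K_def pmf_exp_replicate_add[OF finite_slot] by simp
  have one: "\<bar>(\<Sum>x\<in>\<Omega>. r x * K x) - measure_pmf.prob (slot_law (j + k) \<xi>) A\<bar>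
      \<le> sqrt (2 * \<delta> k L / \<epsilon>) + (1 + 1 / \<epsilon>) * esc (j + k) L"
    if x: "\<xi> \<in> \<Omega>" and r: "\<And>x. 0 \<le> r x" "\<And>x. r x \<le> pmf (slot_law j \<xi>) x / w" for j \<xi>
  proof -
    let ?S = "slot_law j \<xi>"
    \<comment> \<open>Where the mass of \<open>?S\<close> vanishes so does \<open>r\<close>, and
      division by zero gives \<open>g x = 0\<close>.\<close>
    define g where "g x = r x / pmf ?S x" for x
    have fS: "finite (set_pmf ?S)" using finite_slots by (simp add: law_def)
    have g: "0 \<le> g x" "g x \<le> 1 / \<epsilon>" for x
    proof -
      show "0 \<le> g x" using r by (simp add: g_def)
      have "g x \<le> 1 / w" using r(2)[of x] w0 by (cases "pmf ?S x = 0") (auto simp: g_def field_simps pmf_nonneg less_le)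
      also have "\<dots> \<le> 1 / \<epsilon>" using w e by (simp add: frac_le)
      finally show "g x \<le> 1 / \<epsilon>" .
    qed
    have pg: "pmf ?S x * g x = r x" for x using r(1)[of x] r(2)[of x] by (auto simp: g_def)
    have E: "pmf_exp (slots j) (\<lambda>us. g (run us \<xi>) * h (run us \<xi>)) = (\<Sum>x\<in>\<Omega>. r x * h x)" for h
    proof -
      have "pmf_exp (slots j) (\<lambda>us. g (run us \<xi>) * h (run us \<xi>)) = pmf_exp ?S (\<lambda>x. g x * h x)"
        by (rule slot_law_exp[symmetric])
      also have "\<dots> = (\<Sum>x\<in>\<Omega>. (g x * h x) * pmf ?S x)"
        using finite_\<Omega> set_slot_law[OF x] by (intro integral_measure_pmf_real) auto
      also have "\<dots> = (\<Sum>x\<in>\<Omega>. r x * h x)" by (intro sum.cong refl) (simp add: pg[symmetric])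
      finally show ?thesis .
    qed
    have "(\<Sum>x\<in>\<Omega>. r x) = 1" using w0 by (simp add: r_def sum_divide_distrib[symmetric] w_def[symmetric])
    then have g1: "pmf_exp (slots j) (\<lambda>us. g (run us \<xi>)) = 1" using E[of "\<lambda>_. 1"] by simp
    have "pmf_exp (slots j) (\<lambda>us. (g (run us \<xi>) - 1) * pmf_exp (slots k) (\<lambda>ws. of_bool (run (us @ ws) \<xi> \<in> A)))
        = (\<Sum>x\<in>\<Omega>. r x * K x) - measure_pmf.prob (slot_law (j + k) \<xi>) A"
      unfolding K E[symmetric] pmf_exp_diff[OF finite_slots, symmetric]
      by (simp add: K_def left_diff_distrib)
    then show ?thesis using tilted_run[OF x g g1, of k A L] by simp
  qed
  have "r x \<le> pmf P x / w" "r x \<le> pmf R x / w" "0 \<le> r x" for x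
    using w0 by (auto simp: r_def divide_right_mono)
  then show ?thesis using one[OF s(1), of n] one[OF s(2), of m] unfolding P_def R_def distrib_left by force
qed

end

section \<open>Reversibility\<close>

context coloring_metric
begin

text \<open>On \<open>\<Omega>\<close> this is the conditional expectation under
  \<open>\<mu>\<close> given the colours off \<open>x\<close>.\<close>

definition site_avg :: "'v \<Rightarrow> (('v \<Rightarrow> nat) \<Rightarrow> real) \<Rightarrow> ('v \<Rightarrow> nat) \<Rightarrow> real" where
  "site_avg x h \<sigma> = pmf_exp (site_kernel x \<sigma>) h"

definition fibre :: "'v \<Rightarrow> ('v \<Rightarrow> nat) \<Rightarrow> ('v \<Rightarrow> nat) set" where
  "fibre x \<sigma> = {\<eta> \<in> \<Omega>. \<forall>y\<in>V - {x}. \<eta> y = \<sigma> y}"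

lemma finite_fibre: "finite (fibre x \<sigma>)"
  by (simp add: fibre_def finite_\<Omega>)

lemma fibre_self: "\<sigma> \<in> \<Omega> \<Longrightarrow> \<sigma> \<in> fibre x \<sigma>"
  by (simp add: fibre_def)

lemma fibre_eq: "\<eta> \<in> fibre x \<sigma> \<Longrightarrow> fibre x \<eta> = fibre x \<sigma>"
  by (auto simp: fibre_def)

lemma fibre_sym: "\<sigma> \<in> \<Omega> \<Longrightarrow> \<eta> \<in> fibre x \<sigma> \<Longrightarrow> \<sigma> \<in> fibre x \<eta>"
  by (auto simp: fibre_def)

lemma site_avg_eq:
  assumes "\<sigma> \<in> \<Omega>" "x \<in> V"
  shows "site_avg x h \<sigma> = (\<Sum>\<eta>\<in>fibre x \<sigma>. h \<eta>) / card (fibre x \<sigma>)"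
proof -
  have "fibre x \<sigma> \<noteq> {}" using fibre_self[OF assms(1)] by auto
  then show ?thesis unfolding site_avg_def site_kernel_eq[OF assms] fibre_def[symmetric]
    by (simp add: integral_pmf_of_set finite_fibre)
qed

text \<open>Lying in the same fibre is an equivalence relation on \<open>\<Omega>\<close>, so the
  averaging kernel, one over the size of the fibre, is symmetric.\<close>

lemma site_avg_self_adjoint:
  assumes x: "x \<in> V"
  shows "(\<Sum>\<sigma>\<in>\<Omega>. g \<sigma> * site_avg x h \<sigma>) = (\<Sum>\<sigma>\<in>\<Omega>. site_avg x g \<sigma> * h \<sigma>)"
proof -
  have eq: "(\<Sum>\<sigma>\<in>\<Omega>. g \<sigma> * site_avg x h \<sigma>) =
      (\<Sum>\<sigma>\<in>\<Omega>. \<Sum>\<eta>\<in>\<Omega>. if \<eta> \<in> fibre x \<sigma> then g \<sigma> * h \<eta> / card (fibre x \<sigma>) else 0)" for g h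
  proof (rule sum.cong[OF refl])
    fix \<sigma> assume s: "\<sigma> \<in> \<Omega>"
    have "\<Omega> \<inter> fibre x \<sigma> = fibre x \<sigma>" by (auto simp: fibre_def)
    then show "g \<sigma> * site_avg x h \<sigma> = (\<Sum>\<eta>\<in>\<Omega>. if \<eta> \<in> fibre x \<sigma> then g \<sigma> * h \<eta> / card (fibre x \<sigma>) else 0)"
      using finite_\<Omega> by (simp add: site_avg_eq[OF s x] sum.inter_restrict[symmetric] sum_divide_distrib sum_distrib_left)
  qed
  have "(\<Sum>\<sigma>\<in>\<Omega>. g \<sigma> * site_avg x h \<sigma>) =
      (\<Sum>\<eta>\<in>\<Omega>. \<Sum>\<sigma>\<in>\<Omega>. if \<eta> \<in> fibre x \<sigma> then g \<sigma> * h \<eta> / card (fibre x \<sigma>) else 0)"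
    unfolding eq by (rule sum.swap)
  also have "\<dots> = (\<Sum>\<eta>\<in>\<Omega>. \<Sum>\<sigma>\<in>\<Omega>. if \<sigma> \<in> fibre x \<eta> then h \<eta> * g \<sigma> / card (fibre x \<eta>) else 0)"
  proof (intro sum.cong refl)
    fix \<eta> \<sigma> assume "\<eta> \<in> \<Omega>" "\<sigma> \<in> \<Omega>"
    then show "(if \<eta> \<in> fibre x \<sigma> then g \<sigma> * h \<eta> / card (fibre x \<sigma>) else 0) =
        (if \<sigma> \<in> fibre x \<eta> then h \<eta> * g \<sigma> / card (fibre x \<eta>) else 0)"
      using fibre_sym fibre_eq by (metis mult.commute)
  qed
  also have "\<dots> = (\<Sum>\<sigma>\<in>\<Omega>. h \<sigma> * site_avg x g \<sigma>)" unfolding eq ..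
  finally show ?thesis by (simp add: mult.commute)
qed

lemma site_avg_idem:
  assumes s: "\<sigma> \<in> \<Omega>" and x: "x \<in> V"
  shows "site_avg x (site_avg x h) \<sigma> = site_avg x h \<sigma>"
proof -
  have "site_avg x h \<eta> = site_avg x h \<sigma>" if "\<eta> \<in> fibre x \<sigma>" for \<eta>
  proof -
    have "\<eta> \<in> \<Omega>" using that by (simp add: fibre_def)
    then show ?thesis using that s x by (simp add: site_avg_eq fibre_eq)
  qed
  then have "site_avg x (site_avg x h) \<sigma> = (\<Sum>\<eta>\<in>fibre x \<sigma>. site_avg x h \<sigma>) / card (fibre x \<sigma>)"
    by (simp add: site_avg_eq[OF s x, of "site_avg x h"])
  also have "\<dots> = site_avg x h \<sigma>" using fibre_self[OF s] finite_fibre by (auto simp: card_gt_0_iff)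
  finally show ?thesis .
qed

section \<open>Powers of the transition operator\<close>

definition evolve :: "nat \<Rightarrow> (('v \<Rightarrow> nat) \<Rightarrow> real) \<Rightarrow> ('v \<Rightarrow> nat) \<Rightarrow> real" where
  "evolve n h \<sigma> = pmf_exp (slots n) (\<lambda>us. h (run us \<sigma>))"

lemma evolve_0 [simp]: "evolve 0 h \<sigma> = h \<sigma>"
  by (simp add: evolve_def)

lemma evolve_Suc: "evolve (Suc n) h \<sigma> = (1 - real (card V) * a) * evolve n h \<sigma> + a * (\<Sum>x\<in>V. site_avg x (evolve n h) \<sigma>)"
  unfolding evolve_def pmf_exp_replicate_Suc[OF finite_slot] slot_exp[OF a_nonneg a_le]
  by (simp add: site_avg_def site_kernel_def evolve_def[abs_def])

lemma evolve_Suc': "evolve (Suc n) h = evolve 1 (evolve n h)"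
  unfolding evolve_def[abs_def] pmf_exp_replicate_Suc[OF finite_slot] One_nat_def by simp

lemma evolve_add: "evolve (m + n) h = evolve m (evolve n h)"
proof (induction m)
  case (Suc m)
  then show ?case using evolve_Suc'[of "m + n" h] evolve_Suc'[of m "evolve n h"] by simp
qed (simp add: evolve_def[abs_def])

lemma evolve_1_self_adjoint: "(\<Sum>\<sigma>\<in>\<Omega>. g \<sigma> * evolve 1 h \<sigma>) = (\<Sum>\<sigma>\<in>\<Omega>. evolve 1 g \<sigma> * h \<sigma>)"
proof -
  have ev: "evolve 1 h \<sigma> = (1 - real (card V) * a) * h \<sigma> + a * (\<Sum>x\<in>V. site_avg x h \<sigma>)" for h \<sigma>
    using evolve_Suc[of 0 h \<sigma>] by (simp add: evolve_def[of 0, abs_def])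
  have "(\<Sum>\<sigma>\<in>\<Omega>. g \<sigma> * evolve 1 h \<sigma>) =
    (1 - real (card V) * a) * (\<Sum>\<sigma>\<in>\<Omega>. g \<sigma> * h \<sigma>) + a * (\<Sum>x\<in>V. \<Sum>\<sigma>\<in>\<Omega>. g \<sigma> * site_avg x h \<sigma>)" for g h
    unfolding ev by (simp add: distrib_left sum.distrib sum_distrib_left mult_ac) (rule sum.swap)
  note e = this
  have "(\<Sum>\<sigma>\<in>\<Omega>. g \<sigma> * evolve 1 h \<sigma>) = (\<Sum>\<sigma>\<in>\<Omega>. h \<sigma> * evolve 1 g \<sigma>)"
  proof -
    have "(\<Sum>\<sigma>\<in>\<Omega>. g \<sigma> * site_avg x h \<sigma>) = (\<Sum>\<sigma>\<in>\<Omega>. h \<sigma> * site_avg x g \<sigma>)" if "x \<in> V" for x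
      unfolding site_avg_self_adjoint[OF that, of g h] by (simp add: mult.commute)
    then show ?thesis unfolding e by (simp add: mult.commute[of "g _"])
  qed
  then show ?thesis by (simp add: mult.commute)
qed

lemma evolve_self_adjoint: "(\<Sum>\<sigma>\<in>\<Omega>. g \<sigma> * evolve n h \<sigma>) = (\<Sum>\<sigma>\<in>\<Omega>. evolve n g \<sigma> * h \<sigma>)"
proof (induction n arbitrary: g)
  case (Suc n)
  have "(\<Sum>\<sigma>\<in>\<Omega>. g \<sigma> * evolve (Suc n) h \<sigma>) = (\<Sum>\<sigma>\<in>\<Omega>. evolve n (evolve 1 g) \<sigma> * h \<sigma>)"
    unfolding evolve_Suc'[of n h] evolve_1_self_adjoint by (rule Suc.IH)
  also have "evolve n (evolve 1 g) = evolve (Suc n) g" using evolve_add[of n 1 g] by simp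
  finally show ?case .
qed simp

lemma evolve_one: "evolve n (\<lambda>_. 1) \<sigma> = 1"
  by (simp add: evolve_def)

lemma evolve_stationary: "(\<Sum>\<sigma>\<in>\<Omega>. evolve n h \<sigma>) = (\<Sum>\<sigma>\<in>\<Omega>. h \<sigma>)"
  using evolve_self_adjoint[of "\<lambda>_. 1" n h] by (simp add: evolve_one)

text \<open>Replaces a spectral argument. The squared norms \<open>c i\<close> of the iterates of
  \<open>g\<close> are log-convex by self-adjointness and Cauchy-Schwarz, so their successive ratios
  do not decrease; the first ratio is at least \<open>(1 - a)\<^sup>2\<close> because only rings at
  \<open>x\<close> affect \<open>g\<close>.\<close>

lemma evolve_energy_lower:
  assumes x: "x \<in> V" and loc: "\<And>\<sigma> \<eta>. \<sigma> x = \<eta> x \<Longrightarrow> g \<sigma> = g \<eta>"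
  shows "(1 - a)\<^sup>2 ^ n * (\<Sum>\<sigma>\<in>\<Omega>. (g \<sigma>)\<^sup>2) \<le> (\<Sum>\<sigma>\<in>\<Omega>. g \<sigma> * evolve (2 * n) g \<sigma>)"
proof -
  define c where "c i = (\<Sum>\<sigma>\<in>\<Omega>. (evolve i g \<sigma>)\<^sup>2)" for i
  have c0: "0 \<le> c i" for i unfolding c_def by (intro sum_nonneg) simp
  note cV = card_V_pos and a1 = site_rate_le_1[OF a_nonneg a_le]
  have b: "(\<Sum>\<sigma>\<in>\<Omega>. evolve i g \<sigma> * evolve j g \<sigma>) = (\<Sum>\<sigma>\<in>\<Omega>. g \<sigma> * evolve (i + j) g \<sigma>)" for i j
    unfolding evolve_add evolve_self_adjoint[of g] ..
  have conv: "(c (Suc i))\<^sup>2 \<le> c i * c (Suc (Suc i))" for i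
  proof -
    have "c (Suc i) = (\<Sum>\<sigma>\<in>\<Omega>. evolve i g \<sigma> * evolve (Suc (Suc i)) g \<sigma>)"
      unfolding c_def power2_eq_square b by simp
    then show ?thesis unfolding c_def by (simp only:) (rule Cauchy_Schwarz_ineq_sum)
  qed
  \<comment> \<open>Rayleigh quotient of one slot: averaging at any other site fixes
    \<open>g\<close>, and the term of \<open>x\<close> is a squared norm because the average is a
    self-adjoint projection.\<close>
  have "(1 - a) * c 0 \<le> (\<Sum>\<sigma>\<in>\<Omega>. g \<sigma> * evolve 1 g \<sigma>)"
  proof -
    have e: "(\<Sum>\<sigma>\<in>\<Omega>. g \<sigma> * evolve 1 g \<sigma>) =
      (1 - real (card V) * a) * c 0 + a * (\<Sum>z\<in>V. \<Sum>\<sigma>\<in>\<Omega>. g \<sigma> * site_avg z g \<sigma>)"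
      using evolve_Suc[of 0 g] unfolding c_def
      by (simp add: evolve_def[of 0, abs_def] distrib_left sum.distrib sum_distrib_left power2_eq_square mult_ac)
        (rule sum.swap)
    have "(\<Sum>z\<in>V. \<Sum>\<sigma>\<in>\<Omega>. g \<sigma> * site_avg z g \<sigma>) =
        (\<Sum>\<sigma>\<in>\<Omega>. g \<sigma> * site_avg x g \<sigma>) + (\<Sum>z\<in>V - {x}. \<Sum>\<sigma>\<in>\<Omega>. g \<sigma> * site_avg z g \<sigma>)"
      using x finite_V by (intro sum.remove) auto
    also have "(\<Sum>z\<in>V - {x}. \<Sum>\<sigma>\<in>\<Omega>. g \<sigma> * site_avg z g \<sigma>) = (\<Sum>z\<in>V - {x}. c 0)"
    proof (intro sum.cong refl)
      fix z assume z: "z \<in> V - {x}"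
      have "site_avg z g \<sigma> = g \<sigma>" for \<sigma>
      proof -
        have "site_avg z g \<sigma> = pmf_exp (pmf_of_set perms) (\<lambda>cs. g (\<sigma>(z := pick cs (blocked \<sigma> z))))"
          by (simp add: site_avg_def site_kernel_def)
        also have "\<dots> = pmf_exp (pmf_of_set perms) (\<lambda>cs. g \<sigma>)"
          using z by (intro pmf_exp_cong loc) auto
        finally show ?thesis by simp
      qed
      then show "(\<Sum>\<sigma>\<in>\<Omega>. g \<sigma> * site_avg z g \<sigma>) = c 0" by (simp add: c_def power2_eq_square)
    qed
    also have "\<dots> = (real (card V) - 1) * c 0" using x finite_V cV by (simp add: of_nat_diff Suc_leI)
    also have "(\<Sum>\<sigma>\<in>\<Omega>. g \<sigma> * site_avg x g \<sigma>) = (\<Sum>\<sigma>\<in>\<Omega>. (site_avg x g \<sigma>)\<^sup>2)"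
    proof -
      have "(\<Sum>\<sigma>\<in>\<Omega>. g \<sigma> * site_avg x g \<sigma>) = (\<Sum>\<sigma>\<in>\<Omega>. g \<sigma> * site_avg x (site_avg x g) \<sigma>)"
        by (intro sum.cong refl) (simp add: site_avg_idem x)
      then show ?thesis unfolding site_avg_self_adjoint[OF x, of g "site_avg x g"] by (simp add: power2_eq_square)
    qed
    finally have S: "(real (card V) - 1) * c 0 \<le> (\<Sum>z\<in>V. \<Sum>\<sigma>\<in>\<Omega>. g \<sigma> * site_avg z g \<sigma>)"
      by (simp add: sum_nonneg)
    have "(1 - a) * c 0 = (1 - real (card V) * a) * c 0 + a * ((real (card V) - 1) * c 0)"
      by (simp add: algebra_simps)
    also have "\<dots> \<le> (\<Sum>\<sigma>\<in>\<Omega>. g \<sigma> * evolve 1 g \<sigma>)"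
      unfolding e by (rule add_left_mono[OF mult_left_mono[OF S a_nonneg]])
    finally show ?thesis .
  qed
  then have "((1 - a) * c 0)\<^sup>2 \<le> (\<Sum>\<sigma>\<in>\<Omega>. g \<sigma> * evolve 1 g \<sigma>)\<^sup>2"
    using a1 c0 by (intro power_mono) auto
  also have "\<dots> \<le> c 0 * c 1" unfolding c_def by simp (rule Cauchy_Schwarz_ineq_sum)
  finally have c1: "(1 - a)\<^sup>2 * c 0 * c 0 \<le> c 1 * c 0" by (simp add: power2_eq_square mult_ac)
  have ratio: "(1 - a)\<^sup>2 * c i \<le> c (Suc i)" for i
  proof (induction i)
    case 0
    show ?case using c1 c0[of 0] c0[of 1] by (cases "c 0 = 0") auto
  next
    case (Suc i)
    show ?case
    proof (cases "c (Suc i) = 0")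
      case False
      then have p: "0 < c (Suc i)" using c0[of "Suc i"] by simp
      have "((1 - a)\<^sup>2 * c i) * c (Suc i) \<le> c (Suc i) * c (Suc i)" using Suc c0 by (intro mult_right_mono)
      also have "\<dots> \<le> c i * c (Suc (Suc i))" using conv[of i] by (simp add: power2_eq_square)
      finally have "c i * ((1 - a)\<^sup>2 * c (Suc i)) \<le> c i * c (Suc (Suc i))" by (simp add: mult_ac)
      moreover have "c i \<noteq> 0" using conv[of i] p by auto
      ultimately show ?thesis using c0[of i] by simp
    qed (use c0 in simp)
  qed
  have "(1 - a)\<^sup>2 ^ n * c 0 \<le> c n"
  proof (induction n)
    case (Suc n)
    have "(1 - a)\<^sup>2 ^ Suc n * c 0 = (1 - a)\<^sup>2 * ((1 - a)\<^sup>2 ^ n * c 0)" by (simp add: mult_ac)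
    also have "\<dots> \<le> (1 - a)\<^sup>2 * c n" using Suc by (intro mult_left_mono) auto
    also have "\<dots> \<le> c (Suc n)" by (rule ratio)
    finally show ?case .
  qed simp
  also have "c n = (\<Sum>\<sigma>\<in>\<Omega>. g \<sigma> * evolve (2 * n) g \<sigma>)"
    unfolding c_def power2_eq_square b by (simp add: mult_2)
  finally show ?thesis by (simp add: c_def)
qed

end

section \<open>Lower bound by agreement with the initial state\<close>

context coloring_metric
begin

lemma card_\<Omega>_pos: "0 < real (card \<Omega>)"
  using finite_\<Omega> \<Omega>_nonempty by (simp add: card_gt_0_iff)

definition marginal :: "'v \<Rightarrow> nat \<Rightarrow> real" where
  "marginal x c = (\<Sum>\<sigma>\<in>\<Omega>. of_bool (\<sigma> x = c)) / card \<Omega>"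

lemma marginal_nonneg: "0 \<le> marginal x c"
  unfolding marginal_def by (intro divide_nonneg_nonneg sum_nonneg) auto

text \<open>Resampling at \<open>x\<close> preserves the uniform law, and it gives no colour more
  than one half since at least two colours are unblocked.\<close>

lemma marginal_le_half:
  assumes x: "x \<in> V"
  shows "marginal x c \<le> 1 / 2"
proof -
  let ?h = "\<lambda>\<sigma>. of_bool (\<sigma> x = c) :: real"
  have one: "site_avg x (\<lambda>_. 1) \<sigma> = 1" for \<sigma> by (simp add: site_avg_def)
  have "(\<Sum>\<sigma>\<in>\<Omega>. ?h \<sigma>) = (\<Sum>\<sigma>\<in>\<Omega>. site_avg x ?h \<sigma>)"
    using site_avg_self_adjoint[OF x, of "\<lambda>_. 1" ?h] by (simp add: one)
  also have "\<dots> \<le> (\<Sum>\<sigma>\<in>\<Omega>. 1 / 2)"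
  proof (rule sum_mono)
    fix \<sigma>
    let ?A = "{1..q} - blocked \<sigma> x"
    have ne: "?A \<noteq> {}" by (rule available[OF x])
    have "q - \<Delta> \<le> card {1..q} - card (blocked \<sigma> x)" using card_blocked[OF x, of \<sigma>] by simp
    also have "\<dots> \<le> card ?A" by (rule diff_card_le_card_Diff[OF finite_blocked[OF x]])
    finally have "q - \<Delta> \<le> card ?A" .
    moreover have "\<Delta> * 3 \<le> \<Delta> * (\<Delta> + 2)" using \<Delta>_pos by (intro mult_le_mono2) simp
    then have "\<Delta> + 2 \<le> q" using many_colors \<Delta>_pos by linarith
    ultimately have cA: "2 \<le> card ?A" by simp
    have "site_avg x ?h \<sigma> = pmf_exp (map_pmf (\<lambda>cs. pick cs (blocked \<sigma> x)) (pmf_of_set perms)) (\<lambda>b. of_bool (b = c))"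
      by (simp add: site_avg_def site_kernel_def)
    also have "\<dots> = pmf (pmf_of_set ?A) c"
      unfolding perms_def using ne by (subst pick_uniform) (auto simp: pmf_exp_indicator pmf.rep_eq)
    also have "\<dots> \<le> 1 / 2" using ne cA by (auto simp: indicator_def field_simps)
    finally show "site_avg x ?h \<sigma> \<le> 1 / 2" .
  qed
  finally show ?thesis using card_\<Omega>_pos by (simp add: marginal_def field_simps)
qed

lemma color_range: "\<sigma> \<in> \<Omega> \<Longrightarrow> x \<in> V \<Longrightarrow> \<sigma> x \<in> {1..q}"
  by (auto simp: \<Omega>_def)

lemma sum_marginal:
  assumes x: "x \<in> V"
  shows "(\<Sum>c\<in>{1..q}. marginal x c) = 1"
proof -
  have "(\<Sum>c\<in>{1..q}. marginal x c) = (\<Sum>\<sigma>\<in>\<Omega>. \<Sum>c\<in>{1..q}. of_bool (\<sigma> x = c)) / card \<Omega>"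
    unfolding marginal_def sum_divide_distrib[symmetric] by (subst sum.swap) simp
  also have "(\<Sum>\<sigma>\<in>\<Omega>. \<Sum>c\<in>{1..q}. of_bool (\<sigma> x = c)) = (\<Sum>\<sigma>\<in>\<Omega>. 1 :: real)"
  proof (intro sum.cong refl)
    fix \<sigma> assume "\<sigma> \<in> \<Omega>"
    from color_range[OF this x] show "(\<Sum>c\<in>{1..q}. of_bool (\<sigma> x = c)) = (1::real)"
      by (simp add: of_bool_def)
  qed
  finally show ?thesis using card_\<Omega>_pos by simp
qed

text \<open>The indicator of the colour \<open>c\<close> is centred. The dynamics preserves the
  constant part, and the centred part, of variance \<open>m - m\<^sup>2\<close>, falls under
  \<open>evolve_energy_lower\<close>.\<close>

lemma color_correlation:
  assumes x: "x \<in> V"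
  defines "f c \<equiv> (\<lambda>\<eta>. of_bool (\<eta> x = c) :: real)"
  shows "card \<Omega> * ((marginal x c)\<^sup>2 + (1 - a)\<^sup>2 ^ n * (marginal x c - (marginal x c)\<^sup>2))
    \<le> (\<Sum>\<sigma>\<in>\<Omega>. f c \<sigma> * evolve (2 * n) (f c) \<sigma>)"
proof -
  define m where "m = marginal x c"
  define g where "g = (\<lambda>\<sigma>. f c \<sigma> - m)"
  have sf: "(\<Sum>\<sigma>\<in>\<Omega>. f c \<sigma>) = card \<Omega> * m" using card_\<Omega>_pos by (simp add: m_def marginal_def f_def)
  have sg: "(\<Sum>\<sigma>\<in>\<Omega>. g \<sigma>) = 0" by (simp add: g_def sum_subtractf sf)
  have ev: "evolve (2 * n) (f c) \<sigma> = evolve (2 * n) g \<sigma> + m" for \<sigma>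
    by (simp add: evolve_def g_def pmf_exp_diff[OF finite_slots])
  have "(\<Sum>\<sigma>\<in>\<Omega>. f c \<sigma> * evolve (2 * n) (f c) \<sigma>) = (\<Sum>\<sigma>\<in>\<Omega>. (g \<sigma> + m) * (evolve (2 * n) g \<sigma> + m))"
    unfolding ev by (simp add: g_def)
  also have "\<dots> = (\<Sum>\<sigma>\<in>\<Omega>. g \<sigma> * evolve (2 * n) g \<sigma> + m * g \<sigma> + m * evolve (2 * n) g \<sigma> + m\<^sup>2)"
    by (intro sum.cong refl) (simp add: algebra_simps power2_eq_square)
  also have "\<dots> = (\<Sum>\<sigma>\<in>\<Omega>. g \<sigma> * evolve (2 * n) g \<sigma>) + card \<Omega> * m\<^sup>2"
    by (simp add: sum.distrib sum_distrib_left[symmetric] evolve_stationary sg)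
  finally have e: "(\<Sum>\<sigma>\<in>\<Omega>. f c \<sigma> * evolve (2 * n) (f c) \<sigma>) = \<dots>" .
  have "(\<Sum>\<sigma>\<in>\<Omega>. (g \<sigma>)\<^sup>2) = (\<Sum>\<sigma>\<in>\<Omega>. f c \<sigma> - 2 * m * f c \<sigma> + m\<^sup>2)"
    by (intro sum.cong refl) (auto simp: g_def f_def power2_eq_square algebra_simps)
  also have "\<dots> = card \<Omega> * (m - m\<^sup>2)"
    by (simp add: sum.distrib sum_subtractf sum_distrib_left[symmetric] sf power2_eq_square algebra_simps)
  finally have "(1 - a)\<^sup>2 ^ n * (card \<Omega> * (m - m\<^sup>2)) \<le> (\<Sum>\<sigma>\<in>\<Omega>. g \<sigma> * evolve (2 * n) g \<sigma>)"
    using evolve_energy_lower[OF x, of g n] by (simp add: g_def f_def)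
  then show ?thesis unfolding e m_def[symmetric] by (simp add: algebra_simps)
qed

text \<open>\<open>color_correlation\<close> is summed over the colours. No marginal exceeds one
  half, so their squares sum to at most 1/2, and under a uniform start each site keeps an excess
  agreement of at least half of \<open>(1 - a)\<^sup>2 ^ n\<close>.\<close>

lemma autocorrelation:
  "(\<Sum>\<sigma>\<in>\<Omega>. \<Sum>x\<in>V. (\<Sum>\<eta>\<in>\<Omega>. of_bool (\<eta> x = \<sigma> x)) / card \<Omega>) + card \<Omega> * (card V * (1 - a)\<^sup>2 ^ n / 2)
    \<le> (\<Sum>\<sigma>\<in>\<Omega>. \<Sum>x\<in>V. evolve (2 * n) (\<lambda>\<eta>. of_bool (\<eta> x = \<sigma> x)) \<sigma>)"
proof -
  let ?r = "(1 - a)\<^sup>2 ^ n"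
  let ?f = "\<lambda>x c \<eta>. of_bool (\<eta> x = c) :: real"
  have r0: "0 \<le> ?r" by simp
  have site: "(\<Sum>\<sigma>\<in>\<Omega>. (\<Sum>\<eta>\<in>\<Omega>. ?f x (\<sigma> x) \<eta>) / card \<Omega>) + card \<Omega> * (?r / 2)
      \<le> (\<Sum>\<sigma>\<in>\<Omega>. evolve (2 * n) (?f x (\<sigma> x)) \<sigma>)" if x: "x \<in> V" for x
  proof -
    \<comment> \<open>Splitting by the colour of \<open>\<sigma>\<close> at \<open>x\<close> turns
      an observable that depends on the start into fixed ones, for which
      \<open>color_correlation\<close> is available.\<close>
    have diag: "(\<Sum>\<sigma>\<in>\<Omega>. F (\<sigma> x) \<sigma>) = (\<Sum>c\<in>{1..q}. \<Sum>\<sigma>\<in>\<Omega>. ?f x c \<sigma> * F c \<sigma>)" for F :: "nat \<Rightarrow> _ \<Rightarrow> real"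
    proof -
      have "(\<Sum>c\<in>{1..q}. \<Sum>\<sigma>\<in>\<Omega>. ?f x c \<sigma> * F c \<sigma>) = (\<Sum>\<sigma>\<in>\<Omega>. \<Sum>c\<in>{1..q}. ?f x c \<sigma> * F c \<sigma>)" by (rule sum.swap)
      also have "\<dots> = (\<Sum>\<sigma>\<in>\<Omega>. F (\<sigma> x) \<sigma>)"
      proof (intro sum.cong refl)
        fix \<sigma> assume "\<sigma> \<in> \<Omega>"
        from color_range[OF this x] show "(\<Sum>c\<in>{1..q}. ?f x c \<sigma> * F c \<sigma>) = F (\<sigma> x) \<sigma>"
          by (subst sum.remove[of _ "\<sigma> x"]) (auto intro: sum.neutral)
      qed
      finally show ?thesis ..
    qed
    have "(\<Sum>\<sigma>\<in>\<Omega>. (\<Sum>\<eta>\<in>\<Omega>. ?f x (\<sigma> x) \<eta>) / card \<Omega>) = (\<Sum>c\<in>{1..q}. \<Sum>\<sigma>\<in>\<Omega>. ?f x c \<sigma> * marginal x c)"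
      unfolding marginal_def by (rule diag[of "\<lambda>c _. (\<Sum>\<eta>\<in>\<Omega>. ?f x c \<eta>) / card \<Omega>"])
    also have "\<dots> = (\<Sum>c\<in>{1..q}. card \<Omega> * (marginal x c)\<^sup>2)"
      unfolding sum_distrib_right[symmetric] using card_\<Omega>_pos
      by (intro sum.cong refl) (simp add: marginal_def power2_eq_square)
    finally have 1: "(\<Sum>\<sigma>\<in>\<Omega>. (\<Sum>\<eta>\<in>\<Omega>. ?f x (\<sigma> x) \<eta>) / card \<Omega>) = card \<Omega> * (\<Sum>c\<in>{1..q}. (marginal x c)\<^sup>2)"
      by (simp add: sum_distrib_left)
    have "(\<Sum>c\<in>{1..q}. (marginal x c)\<^sup>2) \<le> (\<Sum>c\<in>{1..q}. marginal x c * (1 / 2))"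
      unfolding power2_eq_square by (intro sum_mono mult_left_mono marginal_le_half[OF x] marginal_nonneg)
    also have "\<dots> = 1 / 2" unfolding sum_distrib_right[symmetric] sum_marginal[OF x] by simp
    finally have half: "(\<Sum>c\<in>{1..q}. (marginal x c)\<^sup>2) \<le> 1 / 2" .
    have "card \<Omega> * (\<Sum>c\<in>{1..q}. (marginal x c)\<^sup>2) + card \<Omega> * (?r / 2)
        \<le> card \<Omega> * (\<Sum>c\<in>{1..q}. (marginal x c)\<^sup>2) + card \<Omega> * (?r * (1 - (\<Sum>c\<in>{1..q}. (marginal x c)\<^sup>2)))"
      using mult_left_mono[OF half r0] by (intro add_left_mono mult_left_mono) (auto simp: algebra_simps)
    also have "\<dots> = (\<Sum>c\<in>{1..q}. card \<Omega> * ((marginal x c)\<^sup>2 + ?r * (marginal x c - (marginal x c)\<^sup>2)))"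
      unfolding sum_distrib_left[symmetric] sum.distrib sum_subtractf sum_marginal[OF x] by (simp add: distrib_left)
    also have "\<dots> \<le> (\<Sum>c\<in>{1..q}. \<Sum>\<sigma>\<in>\<Omega>. ?f x c \<sigma> * evolve (2 * n) (?f x c) \<sigma>)"
      by (intro sum_mono color_correlation[OF x])
    also have "\<dots> = (\<Sum>\<sigma>\<in>\<Omega>. evolve (2 * n) (?f x (\<sigma> x)) \<sigma>)"
      by (rule diag[of "\<lambda>c. evolve (2 * n) (?f x c)", symmetric])
    finally show ?thesis unfolding 1 .
  qed
  have "(\<Sum>x\<in>V. (\<Sum>\<sigma>\<in>\<Omega>. (\<Sum>\<eta>\<in>\<Omega>. ?f x (\<sigma> x) \<eta>) / card \<Omega>) + card \<Omega> * (?r / 2))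
      \<le> (\<Sum>x\<in>V. \<Sum>\<sigma>\<in>\<Omega>. evolve (2 * n) (?f x (\<sigma> x)) \<sigma>)"
    by (rule sum_mono[OF site])
  moreover have "(\<Sum>\<sigma>\<in>\<Omega>. \<Sum>x\<in>V. (\<Sum>\<eta>\<in>\<Omega>. ?f x (\<sigma> x) \<eta>) / card \<Omega>) =
      (\<Sum>x\<in>V. \<Sum>\<sigma>\<in>\<Omega>. (\<Sum>\<eta>\<in>\<Omega>. ?f x (\<sigma> x) \<eta>) / card \<Omega>)"
    by (rule sum.swap)
  moreover have "(\<Sum>\<sigma>\<in>\<Omega>. \<Sum>x\<in>V. evolve (2 * n) (?f x (\<sigma> x)) \<sigma>) =
      (\<Sum>x\<in>V. \<Sum>\<sigma>\<in>\<Omega>. evolve (2 * n) (?f x (\<sigma> x)) \<sigma>)"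
    by (rule sum.swap)
  moreover have "(\<Sum>x\<in>V. card \<Omega> * (?r / 2)) = card \<Omega> * (card V * ?r / 2)" by simp
  ultimately show ?thesis by (simp only: sum.distrib)
qed

text \<open>Some start does at least as well as the average start of \<open>autocorrelation\<close>.
  The first sum is the agreement with \<open>\<sigma>\<close> expected at equilibrium.\<close>

lemma slow_start:
  "\<exists>\<sigma>\<in>\<Omega>. (\<Sum>x\<in>V. (\<Sum>\<eta>\<in>\<Omega>. of_bool (\<eta> x = \<sigma> x)) / card \<Omega>) + card V * (1 - a)\<^sup>2 ^ n / 2
    \<le> (\<Sum>x\<in>V. evolve (2 * n) (\<lambda>\<eta>. of_bool (\<eta> x = \<sigma> x)) \<sigma>)"
proof (rule ccontr)
  assume "\<not> ?thesis"
  then have "(\<Sum>\<sigma>\<in>\<Omega>. \<Sum>x\<in>V. evolve (2 * n) (\<lambda>\<eta>. of_bool (\<eta> x = \<sigma> x)) \<sigma>) <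
      (\<Sum>\<sigma>\<in>\<Omega>. (\<Sum>x\<in>V. (\<Sum>\<eta>\<in>\<Omega>. of_bool (\<eta> x = \<sigma> x)) / card \<Omega>) + card V * (1 - a)\<^sup>2 ^ n / 2)"
    using finite_\<Omega> \<Omega>_nonempty by (intro sum_strict_mono) (auto simp: not_le)
  then show False using autocorrelation[of n] by (simp add: sum.distrib)
qed

section \<open>Coalescence and distance to equilibrium\<close>

definition coal :: "nat \<Rightarrow> real" where
  "coal n = card V * (\<Delta> / gap * (1 - a * gap) ^ n)"

text \<open>Once no site is uncertain, all starts have merged. Averaging the comparison with a
  second start over \<open>\<Omega>\<close> produces the equilibrium mean, by stationarity.\<close>

lemma evolve_mean:
  assumes x: "\<xi> \<in> \<Omega>" and h: "\<And>\<sigma>. 0 \<le> h \<sigma>" "\<And>\<sigma>. h \<sigma> \<le> 1"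
  shows "\<bar>evolve n h \<xi> - (\<Sum>\<sigma>\<in>\<Omega>. h \<sigma>) / card \<Omega>\<bar> \<le> coal n"
proof -
  have unc: "pmf_exp (slots n) (\<lambda>us. of_bool (unc us \<noteq> {})) \<le> coal n"
  proof -
    have "pmf_exp (slots n) (\<lambda>us. of_bool (unc us \<noteq> {})) \<le> pmf_exp (slots n) (\<lambda>us. \<Sum>x\<in>V. of_bool (x \<in> unc us))"
    proof (intro pmf_exp_mono finite_slots)
      fix us
      show "of_bool (unc us \<noteq> {}) \<le> (\<Sum>x\<in>V. of_bool (x \<in> unc us) :: real)"
      proof (cases "unc us = {}")
        case False
        then obtain x where "x \<in> unc us" "x \<in> V" by (auto simp: unc_def)
        then show ?thesis using False member_le_sum[of x V "\<lambda>x. of_bool (x \<in> unc us) :: real"] finite_V by simp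
      qed (simp add: sum_nonneg)
    qed
    also have "\<dots> = (\<Sum>x\<in>V. pmf_exp (slots n) (\<lambda>us. of_bool (x \<in> unc us)))" by (rule pmf_exp_sum[OF finite_slots])
    also have "\<dots> \<le> (\<Sum>x\<in>V. \<Delta> / gap * (1 - a * gap) ^ n)" by (intro sum_mono unc_prob a_nonneg a_le)
    finally show ?thesis by (simp add: coal_def)
  qed
  have pair: "\<bar>evolve n h \<sigma> - evolve n h \<xi>\<bar> \<le> coal n" if s: "\<sigma> \<in> \<Omega>" for \<sigma>
  proof -
    have "\<bar>evolve n h \<sigma> - evolve n h \<xi>\<bar> = \<bar>pmf_exp (slots n) (\<lambda>us. h (run us \<sigma>) - h (run us \<xi>))\<bar>"
      by (simp add: evolve_def pmf_exp_diff[OF finite_slots])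
    also have "\<dots> \<le> pmf_exp (slots n) (\<lambda>us. \<bar>h (run us \<sigma>) - h (run us \<xi>)\<bar>)" by (rule integral_abs_bound)
    also have "\<dots> \<le> pmf_exp (slots n) (\<lambda>us. of_bool (unc us \<noteq> {}))"
    proof (intro pmf_exp_mono finite_slots)
      fix us assume "us \<in> set_pmf (slots n)"
      then have "run us \<sigma> \<in> \<Omega>" "run us \<xi> \<in> \<Omega>" using s x by (auto intro: run_\<Omega>)
      then have ext: "run us \<sigma> y = run us \<xi> y" if "y \<notin> V" for y
        using that by (auto simp: \<Omega>_def PiE_iff extensional_def)
      show "\<bar>h (run us \<sigma>) - h (run us \<xi>)\<bar> \<le> of_bool (unc us \<noteq> {})"
      proof (cases "unc us = {}")
        case True
        have "run us \<sigma> y = run us \<xi> y" for y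
        proof (cases "y \<in> V")
          case True
          then show ?thesis using \<open>unc us = {}\<close> s x unfolding unc_def by blast
        qed (rule ext)
        then have "run us \<sigma> = run us \<xi>" by blast
        then show ?thesis by simp
      next
        case False
        then show ?thesis using h[of "run us \<sigma>"] h[of "run us \<xi>"] by (auto simp: abs_le_iff)
      qed
    qed
    finally show ?thesis using unc by simp
  qed
  have "evolve n h \<xi> - (\<Sum>\<sigma>\<in>\<Omega>. h \<sigma>) / card \<Omega> = (\<Sum>\<sigma>\<in>\<Omega>. evolve n h \<xi> - evolve n h \<sigma>) / card \<Omega>"
    using card_\<Omega>_pos by (simp add: sum_subtractf evolve_stationary field_simps)
  then have "\<bar>evolve n h \<xi> - (\<Sum>\<sigma>\<in>\<Omega>. h \<sigma>) / card \<Omega>\<bar> = \<bar>\<Sum>\<sigma>\<in>\<Omega>. evolve n h \<xi> - evolve n h \<sigma>\<bar> / card \<Omega>"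
    by (simp add: abs_divide)
  also have "\<dots> \<le> (\<Sum>\<sigma>\<in>\<Omega>. coal n) / card \<Omega>"
    using pair by (intro divide_right_mono order_trans[OF sum_abs] sum_mono) (auto simp: abs_minus_commute)
  also have "\<dots> = coal n" using card_\<Omega>_pos by simp
  finally show ?thesis .
qed

lemma slot_law_near_\<mu>:
  assumes "\<xi> \<in> \<Omega>"
  shows "\<bar>measure_pmf.prob (slot_law n \<xi>) A - measure_pmf.prob \<mu> A\<bar> \<le> coal n"
proof -
  have "measure_pmf.prob \<mu> A = pmf_exp \<mu> (\<lambda>\<sigma>. of_bool (\<sigma> \<in> A))" by (simp add: pmf_exp_indicator)
  also have "\<dots> = (\<Sum>\<sigma>\<in>\<Omega>. of_bool (\<sigma> \<in> A)) / card \<Omega>"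
    unfolding \<mu>_def by (rule integral_pmf_of_set[OF \<Omega>_nonempty finite_\<Omega>])
  finally show ?thesis using evolve_mean[OF assms, of "\<lambda>\<sigma>. of_bool (\<sigma> \<in> A)" n]
    by (simp add: slot_law_prob evolve_def)
qed

text \<open>The agreement is computed from local truncations of the dynamics, so that a single ring can only
  affect a ball of sites.\<close>

definition agree :: "nat \<Rightarrow> ('v \<Rightarrow> nat) \<Rightarrow> ('v \<Rightarrow> nat) \<Rightarrow> ('v \<times> nat list) option list \<Rightarrow> real" where
  "agree L \<sigma> \<xi> us = (\<Sum>x\<in>V. of_bool (run (map (mask (ball x L \<times> UNIV)) us) \<xi> x = \<sigma> x))"

text \<open>A ring at \<open>z\<close> is visible only to the truncated runs whose ball contains
  \<open>z\<close>, and there are at most \<open>\<beta> L\<close> of them.\<close>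

lemma agree_var: "pmf_var (slots n) (agree L \<sigma> \<xi>) \<le> n * (card V * a) * (\<beta> L)\<^sup>2"
proof -
  have p: "1 - pmf (slot a) None = real (card V) * a" by (simp add: pmf_slot_None[OF a_nonneg a_le])
  have "\<bar>agree L \<sigma> \<xi> (us @ Some l # ws) - agree L \<sigma> \<xi> (us @ None # ws)\<bar> \<le> \<beta> L" for us l ws
  proof -
    obtain z cs where l: "l = (z, cs)" by (cases l)
    let ?o = "\<lambda>x u. of_bool (run (map (mask (ball x L \<times> UNIV)) (us @ u # ws)) \<xi> x = \<sigma> x) :: real"
    have "\<bar>agree L \<sigma> \<xi> (us @ Some l # ws) - agree L \<sigma> \<xi> (us @ None # ws)\<bar> = \<bar>\<Sum>x\<in>V. ?o x (Some l) - ?o x None\<bar>"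
      by (simp only: agree_def sum_subtractf)
    also have "\<dots> \<le> (\<Sum>x\<in>V. \<bar>?o x (Some l) - ?o x None\<bar>)" by (rule sum_abs)
    also have "\<dots> \<le> (\<Sum>x\<in>V. of_bool (z \<in> ball x L))"
      by (intro sum_mono) (auto simp: l)
    also have "\<dots> = real (card {x \<in> V. z \<in> ball x L})"
      using finite_V by (simp add: sum.inter_filter[symmetric] of_bool_def)
    also have "\<dots> \<le> \<beta> L"
    proof (cases "z \<in> V")
      case True
      then show ?thesis using ball_card[OF True, of L] by (simp add: ball_def)
    next
      case False
      then have "{x \<in> V. z \<in> ball x L} = {}" by (auto simp: ball_def)
      then show ?thesis using \<beta>_nonneg[of L] by (simp only: card.empty of_nat_0)
    qed
    finally show ?thesis .
  qed
  from pmf_var_replicate_le[OF finite_slot[of a] this, of n] show ?thesis unfolding p .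
qed

lemma agree_mean:
  "\<bar>pmf_exp (slots n) (agree L \<sigma> \<xi>) - (\<Sum>x\<in>V. evolve n (\<lambda>\<eta>. of_bool (\<eta> x = \<sigma> x)) \<xi>)\<bar> \<le> card V * esc n L"
proof -
  let ?f = "\<lambda>us. \<Sum>x\<in>V. of_bool (run us \<xi> x = \<sigma> x) :: real"
  have "\<bar>pmf_exp (slots n) (agree L \<sigma> \<xi>) - (\<Sum>x\<in>V. evolve n (\<lambda>\<eta>. of_bool (\<eta> x = \<sigma> x)) \<xi>)\<bar>
      = \<bar>pmf_exp (slots n) (\<lambda>us. agree L \<sigma> \<xi> us - ?f us)\<bar>"
    by (simp add: evolve_def pmf_exp_sum[OF finite_slots] pmf_exp_diff[OF finite_slots])
  also have "\<dots> \<le> pmf_exp (slots n) (\<lambda>us. \<bar>agree L \<sigma> \<xi> us - ?f us\<bar>)" by (rule integral_abs_bound)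
  also have "\<dots> \<le> pmf_exp (slots n) (\<lambda>us. card V * of_bool (escapes L us))"
  proof (intro pmf_exp_mono finite_slots)
    fix us
    show "\<bar>agree L \<sigma> \<xi> us - ?f us\<bar> \<le> card V * of_bool (escapes L us)"
    proof (cases "escapes L us")
      case True
      have "\<bar>agree L \<sigma> \<xi> us - ?f us\<bar> \<le> (\<Sum>x\<in>V. 1)"
        unfolding agree_def sum_subtractf[symmetric] by (intro order_trans[OF sum_abs] sum_mono) auto
      then show ?thesis using True by simp
    next
      case False
      then have "agree L \<sigma> \<xi> us = ?f us"
        unfolding agree_def by (intro sum.cong refl) (simp add: run_mask escapes_def)
      then show ?thesis by simp
    qed
  qed
  also have "\<dots> = card V * pmf_exp (slots n) (\<lambda>us. of_bool (escapes L us))" by simp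
  also have "\<dots> \<le> card V * esc n L" by (intro mult_left_mono escapes_prob) auto
  finally show ?thesis .
qed

lemma chebyshev:
  assumes "0 < s"
  shows "pmf_exp (slots n) (\<lambda>us. of_bool (s \<le> \<bar>f us - pmf_exp (slots n) f\<bar>)) \<le> pmf_var (slots n) f / s\<^sup>2"
proof -
  let ?m = "pmf_exp (slots n) f"
  have "pmf_exp (slots n) (\<lambda>us. of_bool (s \<le> \<bar>f us - ?m\<bar>)) \<le> pmf_exp (slots n) (\<lambda>us. (f us - ?m)\<^sup>2 / s\<^sup>2)"
  proof (intro pmf_exp_mono finite_slots)
    fix us
    show "of_bool (s \<le> \<bar>f us - ?m\<bar>) \<le> (f us - ?m)\<^sup>2 / s\<^sup>2"
      using power_mono[of s "\<bar>f us - ?m\<bar>" 2] assms by auto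
  qed
  then show ?thesis by (simp add: pmf_var_def)
qed

text \<open>The separating event is that the agreement with a slow start \<open>\<sigma>\<close>
  exceeds a threshold at distance at least \<open>s\<close> from its mean under either law;
  Chebyshev's inequality bounds both errors. The law after \<open>m\<close> slots stands for
  equilibrium because its fluctuations come from independent slots.\<close>

theorem slot_law_apart:
  assumes x: "\<xi> \<in> \<Omega>" and s: "0 < s"
    and gap: "2 * s + card V * (coal m + esc (2 * n) L + esc m L) \<le> card V * (1 - a)\<^sup>2 ^ n / 2"
  shows "\<exists>\<sigma>\<in>\<Omega>. \<exists>A. 1 - ((real (2 * n) + real m) * (card V * a) * (\<beta> L)\<^sup>2 / s\<^sup>2 + esc (2 * n) L + esc m L)
    \<le> measure_pmf.prob (slot_law (2 * n) \<sigma>) A - measure_pmf.prob (slot_law m \<xi>) A"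
proof -
  obtain \<sigma> where s0: "\<sigma> \<in> \<Omega>" and slow: "(\<Sum>x\<in>V. (\<Sum>\<eta>\<in>\<Omega>. of_bool (\<eta> x = \<sigma> x)) / card \<Omega>) + card V * (1 - a)\<^sup>2 ^ n / 2
    \<le> (\<Sum>x\<in>V. evolve (2 * n) (\<lambda>\<eta>. of_bool (\<eta> x = \<sigma> x)) \<sigma>)"
    using slow_start by blast
  define m1 where "m1 = pmf_exp (slots (2 * n)) (agree L \<sigma> \<sigma>)"
  define m2 where "m2 = pmf_exp (slots m) (agree L \<sigma> \<xi>)"
  have "(\<Sum>x\<in>V. evolve m (\<lambda>\<eta>. of_bool (\<eta> x = \<sigma> x)) \<xi>) \<le> (\<Sum>x\<in>V. (\<Sum>\<eta>\<in>\<Omega>. of_bool (\<eta> x = \<sigma> x)) / card \<Omega> + coal m)"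
  proof (rule sum_mono)
    fix y
    show "evolve m (\<lambda>\<eta>. of_bool (\<eta> y = \<sigma> y)) \<xi> \<le> (\<Sum>\<eta>\<in>\<Omega>. of_bool (\<eta> y = \<sigma> y)) / card \<Omega> + coal m"
      using evolve_mean[OF x, of "\<lambda>\<eta>. of_bool (\<eta> y = \<sigma> y)" m] by (simp add: abs_le_iff)
  qed
  \<comment> \<open>The excess from \<open>slow_start\<close>, less the coalescence error at every
    site and the truncation errors of both runs.\<close>
  then have mm: "2 * s \<le> m1 - m2"
    using slow gap agree_mean[of "2 * n" L \<sigma> \<sigma>] agree_mean[of m L \<sigma> \<xi>]
    unfolding m1_def[symmetric] m2_def[symmetric] by (simp add: sum.distrib abs_le_iff algebra_simps)
  let ?A = "{\<eta>. m1 - s < (\<Sum>x\<in>V. of_bool (\<eta> x = \<sigma> x))}"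
  have eq: "agree L \<sigma> \<zeta> us = (\<Sum>x\<in>V. of_bool (run us \<zeta> x = \<sigma> x))" if "\<not> escapes L us" for \<zeta> us
    using that unfolding agree_def by (intro sum.cong refl) (simp add: run_mask escapes_def)
  have "1 - measure_pmf.prob (slot_law (2 * n) \<sigma>) ?A = pmf_exp (slots (2 * n)) (\<lambda>us. 1 - of_bool (run us \<sigma> \<in> ?A))"
    by (simp add: slot_law_prob pmf_exp_diff[OF finite_slots])
  also have "\<dots> \<le> pmf_exp (slots (2 * n)) (\<lambda>us. of_bool (s \<le> \<bar>agree L \<sigma> \<sigma> us - m1\<bar>) + of_bool (escapes L us))"
    using eq[of _ \<sigma>] by (intro pmf_exp_mono finite_slots) (auto simp: of_bool_def)
  also have "\<dots> \<le> (2 * n) * (card V * a) * (\<beta> L)\<^sup>2 / s\<^sup>2 + esc (2 * n) L"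
    unfolding pmf_exp_add[OF finite_slots] m1_def using agree_var[of "2 * n" L \<sigma> \<sigma>]
    by (intro add_mono escapes_prob order_trans[OF chebyshev[OF s]] divide_right_mono) auto
  finally have 1: "1 - measure_pmf.prob (slot_law (2 * n) \<sigma>) ?A \<le> (2 * n) * (card V * a) * (\<beta> L)\<^sup>2 / s\<^sup>2 + esc (2 * n) L" .
  have "measure_pmf.prob (slot_law m \<xi>) ?A \<le> pmf_exp (slots m) (\<lambda>us. of_bool (s \<le> \<bar>agree L \<sigma> \<xi> us - m2\<bar>) + of_bool (escapes L us))"
    unfolding slot_law_prob using eq[of _ \<xi>] mm by (intro pmf_exp_mono finite_slots) (auto simp: of_bool_def)
  also have "\<dots> \<le> m * (card V * a) * (\<beta> L)\<^sup>2 / s\<^sup>2 + esc m L"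
    unfolding pmf_exp_add[OF finite_slots] m2_def using agree_var[of m L \<sigma> \<xi>]
    by (intro add_mono escapes_prob order_trans[OF chebyshev[OF s]] divide_right_mono) auto
  finally have 2: "measure_pmf.prob (slot_law m \<xi>) ?A \<le> m * (card V * a) * (\<beta> L)\<^sup>2 / s\<^sup>2 + esc m L" .
  have split: "(real (2 * n) + real m) * (card V * a) * (\<beta> L)\<^sup>2 / s\<^sup>2 =
      (2 * n) * (card V * a) * (\<beta> L)\<^sup>2 / s\<^sup>2 + m * (card V * a) * (\<beta> L)\<^sup>2 / s\<^sup>2"
    by (simp add: distrib_right add_divide_distrib)
  show ?thesis
  proof (intro bexI[OF _ s0] exI[of _ ?A])
    show "1 - ((real (2 * n) + real m) * (card V * a) * (\<beta> L)\<^sup>2 / s\<^sup>2 + esc (2 * n) L + esc m L)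
        \<le> measure_pmf.prob (slot_law (2 * n) \<sigma>) ?A - measure_pmf.prob (slot_law m \<xi>) ?A"
      unfolding split using 1 2 by linarith
  qed
qed

end

section \<open>Passage to continuous time\<close>

lemma measure_bind_pmf: "measure_pmf.prob (bind_pmf p f) A = pmf_exp p (\<lambda>x. measure_pmf.prob (f x) A)"
proof -
  have "ennreal (measure_pmf.prob (bind_pmf p f) A) = (\<integral>\<^sup>+x. ennreal (measure_pmf.prob (f x) A) \<partial>p)"
    by (simp add: measure_pmf.emeasure_eq_measure[symmetric])
  also have "\<dots> = ennreal (pmf_exp p (\<lambda>x. measure_pmf.prob (f x) A))"
    by (intro nn_integral_eq_integral measure_pmf.integrable_const_bound[where B=1]) auto
  finally show ?thesis by (simp add: pmf_exp_nonneg)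
qed

lemma cond_pmf_pmf_of_set:
  assumes "finite A" "A \<inter> B \<noteq> {}"
  shows "cond_pmf (pmf_of_set A) B = pmf_of_set (A \<inter> B)"
proof (rule pmf_eqI)
  fix x
  have A: "A \<noteq> {}" using assms by auto
  then have ne: "set_pmf (pmf_of_set A) \<inter> B \<noteq> {}" using assms by simp
  have c: "0 < card (A \<inter> B)" "0 < card A" using assms A by (simp_all add: card_gt_0_iff)
  show "pmf (cond_pmf (pmf_of_set A) B) x = pmf (pmf_of_set (A \<inter> B)) x"
    unfolding pmf_cond[OF ne] using assms A c
    by (auto simp: measure_pmf_of_set indicator_def Int_commute)
qed

context coloring_system
begin

definition heat_pmf :: "real \<Rightarrow> ('v \<Rightarrow> nat) \<Rightarrow> ('v \<Rightarrow> nat) pmf" where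
  "heat_pmf t \<sigma> = bind_pmf (site_list_pmf V t) (\<lambda>xs. resample_seq \<mu> V xs \<sigma>)"

definition ring_count_pmf :: "real \<Rightarrow> nat pmf" where
  "ring_count_pmf t = (if t = 0 then return_pmf 0 else poisson_pmf (real (card V) * t))"

definition jump :: "('v \<Rightarrow> nat) \<Rightarrow> ('v \<Rightarrow> nat) pmf" where
  "jump \<sigma> = map_pmf (\<lambda>l. step (Some l) \<sigma>) letters"

lemma resample_site_kernel:
  assumes "\<sigma> \<in> \<Omega>" "x \<in> V"
  shows "resample \<mu> V x \<sigma> = site_kernel x \<sigma>"
proof -
  have "\<sigma> \<in> \<Omega> \<inter> {\<eta>. \<forall>y\<in>V - {x}. \<eta> y = \<sigma> y}" using assms by simp
  then have "resample \<mu> V x \<sigma> = pmf_of_set (\<Omega> \<inter> {\<eta>. \<forall>y\<in>V - {x}. \<eta> y = \<sigma> y})"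
    unfolding resample_def \<mu>_def by (intro cond_pmf_pmf_of_set finite_\<Omega>) blast
  then show ?thesis unfolding site_kernel_eq[OF assms] by (simp add: Collect_conj_eq)
qed

lemma jump_eq: "jump \<sigma> = bind_pmf (pmf_of_set V) (\<lambda>x. site_kernel x \<sigma>)"
  by (simp add: jump_def letters_def pair_pmf_def site_kernel_def map_bind_pmf map_pmf_def bind_assoc_pmf bind_return_pmf)

lemma set_site_kernel: "\<sigma> \<in> \<Omega> \<Longrightarrow> x \<in> V \<Longrightarrow> set_pmf (site_kernel x \<sigma>) \<subseteq> \<Omega>"
  using finite_perms perms_nonempty
  by (auto simp: site_kernel_def simp del: atLeastAtMost_iff intro!: upd_\<Omega> pick_available)

text \<open>Here all sites are drawn in advance, whereas the kernel draws each when needed;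
  independence allows the exchange.\<close>

lemma resample_seq_iterate:
  "\<sigma> \<in> \<Omega> \<Longrightarrow> bind_pmf (replicate_pmf k (pmf_of_set V)) (\<lambda>xs. resample_seq \<mu> V xs \<sigma>) = iterate_kernel jump k \<sigma>"
proof (induction k arbitrary: \<sigma>)
  case (Suc k)
  let ?R = "replicate_pmf k (pmf_of_set V)"
  have "bind_pmf (replicate_pmf (Suc k) (pmf_of_set V)) (\<lambda>xs. resample_seq \<mu> V xs \<sigma>) =
      bind_pmf (pmf_of_set V) (\<lambda>x. bind_pmf ?R (\<lambda>xs. bind_pmf (resample \<mu> V x \<sigma>) (resample_seq \<mu> V xs)))"
    by (simp add: bind_assoc_pmf bind_return_pmf)
  also have "\<dots> = bind_pmf (pmf_of_set V) (\<lambda>x. bind_pmf (site_kernel x \<sigma>) (\<lambda>\<eta>. iterate_kernel jump k \<eta>))"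
  proof (intro bind_pmf_cong refl)
    fix x assume "x \<in> set_pmf (pmf_of_set V)"
    then have x: "x \<in> V" using finite_V V_nonempty by simp
    have "bind_pmf ?R (\<lambda>xs. bind_pmf (resample \<mu> V x \<sigma>) (resample_seq \<mu> V xs)) =
        bind_pmf (site_kernel x \<sigma>) (\<lambda>\<eta>. bind_pmf ?R (\<lambda>xs. resample_seq \<mu> V xs \<eta>))"
      unfolding resample_site_kernel[OF Suc.prems x] by (rule bind_commute_pmf)
    also have "\<dots> = bind_pmf (site_kernel x \<sigma>) (\<lambda>\<eta>. iterate_kernel jump k \<eta>)"
      using set_site_kernel[OF Suc.prems x] by (intro bind_pmf_cong refl Suc.IH) auto
    finally show "bind_pmf ?R (\<lambda>xs. bind_pmf (resample \<mu> V x \<sigma>) (resample_seq \<mu> V xs)) = \<dots>" .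
  qed
  also have "\<dots> = iterate_kernel jump (Suc k) \<sigma>"
    unfolding iterate_kernel.simps jump_eq bind_assoc_pmf ..
  finally show ?case .
qed (simp add: bind_return_pmf)

lemma heat_pmf_eq: "\<sigma> \<in> \<Omega> \<Longrightarrow> heat_pmf t \<sigma> = bind_pmf (ring_count_pmf t) (\<lambda>k. iterate_kernel jump k \<sigma>)"
  unfolding heat_pmf_def site_list_pmf_def ring_count_pmf_def
  by (simp add: bind_return_pmf bind_assoc_pmf resample_seq_iterate)

lemma law_eq:
  assumes "0 \<le> a" "real (card V) * a \<le> 1"
  shows "law a n \<sigma> = bind_pmf (binomial_pmf n (real (card V) * a)) (\<lambda>k. iterate_kernel jump k \<sigma>)"
proof -
  have "law a n \<sigma> = map_pmf (\<lambda>us. fold step us \<sigma>) (replicate_pmf n (slot a))"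
    unfolding law_def run_def ..
  also have "\<dots> = bind_pmf (binomial_pmf n (real (card V) * a))
      (\<lambda>k. iterate_kernel (\<lambda>\<sigma>. map_pmf (\<lambda>l. step (Some l) \<sigma>) letters) k \<sigma>)"
    using assms by (intro map_replicate_lazy_pmf) (auto simp: slot_def)
  finally show ?thesis unfolding jump_def[abs_def] .
qed

text \<open>Both laws mix the same iterated kernel, over a binomial number of steps of mean close to
  \<open>card V * t\<close> and over a Poisson number; the Poisson limit theorem applies.\<close>

lemma law_tendsto:
  assumes s: "\<sigma> \<in> \<Omega>" and t: "0 \<le> t" and K: "(\<lambda>m. real (K m) / real m) \<longlonglongrightarrow> t"
  shows "(\<lambda>m. measure_pmf.prob (law (1 / real m) (K m) \<sigma>) A) \<longlonglongrightarrow> measure_pmf.prob (heat_pmf t \<sigma>) A"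
proof -
  let ?N = "real (card V)"
  \<comment> \<open>The minimum only keeps \<open>p m\<close> a probability for small
    \<open>m\<close>.\<close>
  define p where "p m = min 1 (?N / real m)" for m :: nat
  have N: "0 < ?N" using finite_V V_nonempty by (simp add: card_gt_0_iff)
  have ev: "\<forall>\<^sub>F m in sequentially. card V \<le> m \<and> 0 < m" using eventually_ge_at_top[of "max 1 (card V)"]
    by eventually_elim auto
  have pe: "\<forall>\<^sub>F m in sequentially. p m = ?N / real m"
    using ev by eventually_elim (auto simp: p_def min_def field_simps)
  have p0: "p \<longlonglongrightarrow> 0"
    by (rule tendsto_cong[THEN iffD2, OF pe]) (rule lim_const_over_n)
  have "(\<lambda>m. real (K m) / real m * ?N) \<longlonglongrightarrow> t * ?N" by (intro tendsto_intros K)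
  moreover have "\<forall>\<^sub>F m in sequentially. real (K m) / real m * ?N = real (K m) * p m"
    using pe by eventually_elim simp
  ultimately have "(\<lambda>m. real (K m) * p m) \<longlonglongrightarrow> t * ?N" by (rule Lim_transform_eventually)
  then have lim: "(\<lambda>m. real (K m) * p m) \<longlonglongrightarrow> ?N * t" by (simp add: mult.commute)
  let ?a = "\<lambda>k. measure_pmf.prob (iterate_kernel jump k \<sigma>) A"
  have "(\<lambda>m. pmf_exp (binomial_pmf (K m) (p m)) ?a) \<longlonglongrightarrow> pmf_exp (ring_count_pmf t) ?a"
  proof (rule nat_pmf_tendsto_expectation)
    fix k
    have "pmf (ring_count_pmf t) k = (?N * t) ^ k / fact k * exp (- (?N * t))"
      using N t by (cases k) (auto simp: ring_count_pmf_def indicator_def)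
    moreover have "(\<lambda>m. pmf (binomial_pmf (K m) (p m)) k) \<longlonglongrightarrow> (?N * t) ^ k / fact k * exp (- (?N * t))"
      by (rule binomial_pmf_tendsto_poisson[OF lim p0]) (auto simp: p_def)
    ultimately show "(\<lambda>m. pmf (binomial_pmf (K m) (p m)) k) \<longlonglongrightarrow> pmf (ring_count_pmf t) k" by simp
  qed simp
  moreover have "\<forall>\<^sub>F m in sequentially. pmf_exp (binomial_pmf (K m) (p m)) ?a = measure_pmf.prob (law (1 / real m) (K m) \<sigma>) A"
    using ev pe
  proof eventually_elim
    case (elim m)
    then have "law (1 / real m) (K m) \<sigma> = bind_pmf (binomial_pmf (K m) (p m)) (\<lambda>k. iterate_kernel jump k \<sigma>)"
      by (subst law_eq) auto
    then show ?case by (simp add: measure_bind_pmf)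
  qed
  ultimately show ?thesis
    unfolding heat_pmf_eq[OF s] measure_bind_pmf by (rule Lim_transform_eventually)
qed

lemma set_law: "\<sigma> \<in> \<Omega> \<Longrightarrow> set_pmf (law a n \<sigma>) \<subseteq> \<Omega>"
  by (auto simp: law_def intro: run_\<Omega>)

end

text \<open>Half the number of slots in time \<open>t\<close>: the spectral lower bound on correlations is for even numbers of slots.\<close>

definition slots_for :: "real \<Rightarrow> nat \<Rightarrow> nat" where
  "slots_for t m = nat \<lfloor>real m * t / 2\<rfloor>"

lemma slots_for_tendsto: "0 \<le> t \<Longrightarrow> (\<lambda>m. real (2 * slots_for t m) / real m) \<longlonglongrightarrow> t"
proof -
  assume t: "0 \<le> t"
  have "(\<lambda>m. t - 2 * (1 / real m)) \<longlonglongrightarrow> t - 2 * 0"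
    by (intro tendsto_intros lim_1_over_n)
  then have lo: "(\<lambda>m. t - 2 * (1 / real m)) \<longlonglongrightarrow> t" by simp
  show ?thesis
  proof (rule tendsto_sandwich[OF _ _ lo tendsto_const])
    have e: "real (slots_for t m) = of_int \<lfloor>real m * t / 2\<rfloor>" for m
      using t by (simp add: slots_for_def)
    have f: "of_int \<lfloor>real m * t / 2\<rfloor> \<le> real m * t / 2" "real m * t / 2 - 1 \<le> of_int \<lfloor>real m * t / 2\<rfloor>" for m
      by linarith+
    show "\<forall>\<^sub>F m in sequentially. t - 2 * (1 / real m) \<le> real (2 * slots_for t m) / real m"
      using eventually_gt_at_top[of 0]
    proof eventually_elim
      case (elim m)
      then have "t - 2 * (1 / real m) = (real m * t - 2) / real m" by (simp add: field_simps)
      also have "\<dots> \<le> real (2 * slots_for t m) / real m"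
        using f(2)[of m] e[of m] by (intro divide_right_mono) linarith+
      finally show ?case .
    qed
    show "\<forall>\<^sub>F m in sequentially. real (2 * slots_for t m) / real m \<le> t"
      using eventually_gt_at_top[of 0]
    proof eventually_elim
      case (elim m)
      have "real (2 * slots_for t m) / real m \<le> (real m * t) / real m"
        using f(1)[of m] e[of m] by (intro divide_right_mono) linarith+
      then show ?case using elim by simp
    qed
  qed
qed

context coloring_geometry
begin

section \<open>The slot estimates in the limit of short slots\<close>

definition escape_rate :: "real \<Rightarrow> nat \<Rightarrow> real" where
  "escape_rate t L = card V * exp (t * (\<Delta> * exp 1) - L)"

definition merge_rate :: "real \<Rightarrow> real" where
  "merge_rate t = \<Delta> / gap * exp (- (gap * t))"

lemma metric_eventually: "\<forall>\<^sub>F m in sequentially. coloring_metric V nbr forb q \<Delta> dst \<beta> (1 / real m)"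
  using eventually_ge_at_top[of "2 * card V + 1"]
proof eventually_elim
  case (elim m)
  then have "real (2 * card V + 1) \<le> real m" by (simp only: of_nat_le_iff)
  then show ?case by unfold_locales (auto simp: field_simps)
qed

lemma esc_tendsto:
  assumes "(\<lambda>m. real (K m) / real m) \<longlonglongrightarrow> t"
  shows "(\<lambda>m. real (card V) * exp (1 / real m * K m * (\<Delta> * exp 1) - L)) \<longlonglongrightarrow> escape_rate t L"
proof -
  have "(\<lambda>m. real (card V) * exp (real (K m) / real m * (\<Delta> * exp 1) - L)) \<longlonglongrightarrow> real (card V) * exp (t * (\<Delta> * exp 1) - L)"
    by (intro tendsto_intros assms)
  then show ?thesis by (simp add: escape_rate_def)
qed

lemma merge_tendsto:
  assumes "(\<lambda>m. real (K m) / real m) \<longlonglongrightarrow> t"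
  shows "(\<lambda>m. \<Delta> / gap * (1 - 1 / real m * gap) ^ K m) \<longlonglongrightarrow> merge_rate t"
proof -
  have "(\<lambda>m. real (K m) / real m * gap) \<longlonglongrightarrow> t * gap" by (intro tendsto_intros assms)
  moreover have "(\<lambda>m. 1 / real m * gap) \<longlonglongrightarrow> 0 * gap" by (intro tendsto_intros lim_1_over_n)
  ultimately have "(\<lambda>m. (1 - 1 / real m * gap) ^ K m) \<longlonglongrightarrow> exp (- (t * gap))"
    using gap_pos by (intro one_minus_power_tendsto) simp_all
  then have "(\<lambda>m. \<Delta> / gap * (1 - 1 / real m * gap) ^ K m) \<longlonglongrightarrow> \<Delta> / gap * exp (- (t * gap))"
    by (intro tendsto_intros)
  then show ?thesis by (simp add: merge_rate_def mult.commute)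
qed

lemma prob_eq_Int: "\<sigma> \<in> \<Omega> \<Longrightarrow> measure_pmf.prob (law a n \<sigma>) A = measure_pmf.prob (law a n \<sigma>) (A \<inter> \<Omega>)"
  using set_law[of \<sigma> a n] measure_Int_set_pmf[of "law a n \<sigma>" A] measure_Int_set_pmf[of "law a n \<sigma>" "A \<inter> \<Omega>"]
  by (simp add: Int_absorb1 Int_assoc)

text \<open>The laws live on the finite set \<open>\<Omega>\<close>, so only finitely many events
  matter and all large \<open>m\<close> serve them simultaneously.\<close>

lemma law_diff_eventually:
  assumes s: "\<sigma> \<in> \<Omega>" "\<eta> \<in> \<Omega>" and t: "0 \<le> t" "0 \<le> t'" and e: "0 < \<epsilon>"
    and le: "\<And>A. measure_pmf.prob (heat_pmf t \<sigma>) A - measure_pmf.prob (heat_pmf t' \<eta>) A \<le> c"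
    and K: "(\<lambda>m. real (K m) / real m) \<longlonglongrightarrow> t" "(\<lambda>m. real (K' m) / real m) \<longlonglongrightarrow> t'"
  shows "\<forall>\<^sub>F m in sequentially. \<forall>A. measure_pmf.prob (law (1 / real m) (K m) \<sigma>) A
      - measure_pmf.prob (law (1 / real m) (K' m) \<eta>) A < c + \<epsilon>"
proof -
  have "\<forall>\<^sub>F m in sequentially. \<forall>A\<in>Pow \<Omega>. measure_pmf.prob (law (1 / real m) (K m) \<sigma>) A
      - measure_pmf.prob (law (1 / real m) (K' m) \<eta>) A < c + \<epsilon>"
  proof (rule eventually_ball_finite)
    show "\<forall>A\<in>Pow \<Omega>. \<forall>\<^sub>F m in sequentially. measure_pmf.prob (law (1 / real m) (K m) \<sigma>) A
      - measure_pmf.prob (law (1 / real m) (K' m) \<eta>) A < c + \<epsilon>"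
    proof
      fix A
      have "(\<lambda>m. measure_pmf.prob (law (1 / real m) (K m) \<sigma>) A - measure_pmf.prob (law (1 / real m) (K' m) \<eta>) A)
        \<longlonglongrightarrow> measure_pmf.prob (heat_pmf t \<sigma>) A - measure_pmf.prob (heat_pmf t' \<eta>) A"
        by (intro tendsto_diff law_tendsto s t K)
      then show "\<forall>\<^sub>F m in sequentially. measure_pmf.prob (law (1 / real m) (K m) \<sigma>) A
        - measure_pmf.prob (law (1 / real m) (K' m) \<eta>) A < c + \<epsilon>"
        by (rule order_tendstoD(2)) (use le[of A] e in linarith)
    qed
  qed (simp add: finite_\<Omega>)
  then show ?thesis
  proof eventually_elim
    case (elim m)
    show ?case
    proof
      fix A
      show "measure_pmf.prob (law (1 / real m) (K m) \<sigma>) A - measure_pmf.prob (law (1 / real m) (K' m) \<eta>) A < c + \<epsilon>"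
        unfolding prob_eq_Int[OF s(1), of _ _ A] prob_eq_Int[OF s(2), of _ _ A] using elim by auto
    qed
  qed
qed

text \<open>The hypothesis has \<open>2 * \<epsilon>\<close> so that one \<open>\<epsilon>\<close>
  can be spent on the passage to slots; the \<open>1 - \<epsilon>\<close> of
  \<open>slot_law_contract\<close> is left.\<close>

theorem heat_contract:
  assumes s: "\<sigma> \<in> \<Omega>" "\<eta> \<in> \<Omega>" and t: "0 \<le> t" "0 \<le> t'" "0 \<le> s" and e: "0 < \<epsilon>"
    and tv: "\<And>A. measure_pmf.prob (heat_pmf t \<sigma>) A - measure_pmf.prob (heat_pmf t' \<eta>) A \<le> 1 - 2 * \<epsilon>"
  shows "\<bar>measure_pmf.prob (heat_pmf (t + s) \<sigma>) A - measure_pmf.prob (heat_pmf (t' + s) \<eta>) A\<bar>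
    \<le> 2 * sqrt (2 * (\<beta> L * merge_rate s) / \<epsilon>) + (1 + 1 / \<epsilon>) * (escape_rate (t + s) L + escape_rate (t' + s) L)"
proof -
  define K where "K r m = 2 * slots_for r m" for r m
  have K: "(\<lambda>m. real (K r m) / real m) \<longlonglongrightarrow> r" if "0 \<le> r" for r
    unfolding K_def by (rule slots_for_tendsto[OF that])
  have K2: "(\<lambda>m. real (K r m + K s m) / real m) \<longlonglongrightarrow> r + s" if "0 \<le> r" for r
    using tendsto_add[OF K[OF that] K[OF t(3)]] by (simp add: add_divide_distrib)
  let ?B = "\<lambda>m. 2 * sqrt (2 * (\<beta> L * (\<Delta> / gap * (1 - 1 / real m * gap) ^ K s m)) / \<epsilon>) +
     (1 + 1 / \<epsilon>) * (real (card V) * exp (1 / real m * real (K t m + K s m) * (\<Delta> * exp 1) - L) +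
       real (card V) * exp (1 / real m * real (K t' m + K s m) * (\<Delta> * exp 1) - L))"
  have "\<forall>\<^sub>F m in sequentially. \<bar>measure_pmf.prob (law (1 / real m) (K t m + K s m) \<sigma>) A -
      measure_pmf.prob (law (1 / real m) (K t' m + K s m) \<eta>) A\<bar> \<le> ?B m"
    using metric_eventually law_diff_eventually[OF s t(1,2) e tv K[OF t(1)] K[OF t(2)]]
  proof eventually_elim
    case (elim m)
    interpret M: coloring_metric V nbr forb q \<Delta> dst \<beta> "1 / real m" by (rule elim(1))
    show ?case
      using M.slot_law_contract[OF s e, of "K t m" "K t' m" "K s m" A L] elim(2)
      unfolding M.\<delta>_def M.esc_def by (force simp: less_imp_le)
  qed
  moreover have "(\<lambda>m. \<bar>measure_pmf.prob (law (1 / real m) (K t m + K s m) \<sigma>) A -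
      measure_pmf.prob (law (1 / real m) (K t' m + K s m) \<eta>) A\<bar>) \<longlonglongrightarrow>
      \<bar>measure_pmf.prob (heat_pmf (t + s) \<sigma>) A - measure_pmf.prob (heat_pmf (t' + s) \<eta>) A\<bar>"
    using t by (intro tendsto_rabs tendsto_diff law_tendsto s K2) auto
  moreover have "?B \<longlonglongrightarrow> 2 * sqrt (2 * (\<beta> L * merge_rate s) / \<epsilon>) +
      (1 + 1 / \<epsilon>) * (escape_rate (t + s) L + escape_rate (t' + s) L)"
    using e by (intro tendsto_add tendsto_mult tendsto_const tendsto_real_sqrt tendsto_divide
        merge_tendsto esc_tendsto K K2 t) auto
  ultimately show ?thesis by (intro tendsto_le[OF sequentially_bot])
qed

theorem heat_near_\<mu>:
  assumes x: "\<xi> \<in> \<Omega>" and t: "0 \<le> t"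
  shows "\<bar>measure_pmf.prob (heat_pmf t \<xi>) A - measure_pmf.prob \<mu> A\<bar> \<le> card V * merge_rate t"
proof -
  define K where "K m = 2 * slots_for t m" for m
  have K: "(\<lambda>m. real (K m) / real m) \<longlonglongrightarrow> t" unfolding K_def by (rule slots_for_tendsto[OF t])
  have "\<forall>\<^sub>F m in sequentially. \<bar>measure_pmf.prob (law (1 / real m) (K m) \<xi>) A - measure_pmf.prob \<mu> A\<bar>
      \<le> card V * (\<Delta> / gap * (1 - 1 / real m * gap) ^ K m)"
    using metric_eventually
  proof eventually_elim
    case (elim m)
    interpret M: coloring_metric V nbr forb q \<Delta> dst \<beta> "1 / real m" by (rule elim(1))
    show ?case using M.slot_law_near_\<mu>[OF x, of "K m" A] unfolding M.coal_def .
  qed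
  moreover have "(\<lambda>m. \<bar>measure_pmf.prob (law (1 / real m) (K m) \<xi>) A - measure_pmf.prob \<mu> A\<bar>) \<longlonglongrightarrow>
      \<bar>measure_pmf.prob (heat_pmf t \<xi>) A - measure_pmf.prob \<mu> A\<bar>"
    by (intro tendsto_rabs tendsto_diff law_tendsto x t K tendsto_const)
  moreover have "(\<lambda>m. card V * (\<Delta> / gap * (1 - 1 / real m * gap) ^ K m)) \<longlonglongrightarrow> card V * merge_rate t"
    by (intro tendsto_mult tendsto_const merge_tendsto K)
  ultimately show ?thesis by (intro tendsto_le[OF sequentially_bot])
qed

text \<open>By contradiction, because the slow start and its event may vary with \<open>m\<close>:
  if none worked in continuous time, then for large \<open>m\<close> every start and event would
  stay below \<open>1 - \<epsilon>\<close> in slots.\<close>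

theorem heat_apart:
  fixes t T s \<epsilon> :: real
  assumes x: "\<xi> \<in> \<Omega>" and t: "0 \<le> t" "0 \<le> T" and s: "0 < s" and e: "0 < \<epsilon>"
    and far: "2 * s + card V * (card V * merge_rate T + escape_rate t L + escape_rate T L) < card V * exp (- t) / 2"
    and small: "(t + T) * card V * (\<beta> L)\<^sup>2 / s\<^sup>2 + escape_rate t L + escape_rate T L < \<epsilon>"
  shows "\<exists>\<sigma>\<in>\<Omega>. \<exists>A. 1 - 2 * \<epsilon> < measure_pmf.prob (heat_pmf t \<sigma>) A - measure_pmf.prob (heat_pmf T \<xi>) A"
proof (rule ccontr)
  assume "\<not> ?thesis"
  then have le: "measure_pmf.prob (heat_pmf t \<sigma>) A - measure_pmf.prob (heat_pmf T \<xi>) A \<le> 1 - 2 * \<epsilon>"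
    if "\<sigma> \<in> \<Omega>" for \<sigma> A
    using that by (auto simp: not_less)
  define K where "K r m = slots_for r m" for r m
  have K: "(\<lambda>m. real (2 * K r m) / real m) \<longlonglongrightarrow> r" if "0 \<le> r" for r
    unfolding K_def by (rule slots_for_tendsto[OF that])
  have ev1: "\<forall>\<^sub>F m in sequentially. \<forall>\<sigma>\<in>\<Omega>. \<forall>A. measure_pmf.prob (law (1 / real m) (2 * K t m) \<sigma>) A
      - measure_pmf.prob (law (1 / real m) (2 * K T m) \<xi>) A < (1 - 2 * \<epsilon>) + \<epsilon>"
    using law_diff_eventually[OF _ x t e le K[OF t(1)] K[OF t(2)]]
    by (intro eventually_ball_finite finite_\<Omega>) blast
  let ?E = "\<lambda>r m. real (card V) * exp (1 / real m * real (2 * K r m) * (\<Delta> * exp 1) - L)"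
  let ?C = "\<lambda>m. real (card V) * (\<Delta> / gap * (1 - 1 / real m * gap) ^ (2 * K T m))"
  have E: "?E r \<longlonglongrightarrow> escape_rate r L" if "0 \<le> r" for r by (rule esc_tendsto[OF K[OF that]])
  have C: "?C \<longlonglongrightarrow> card V * merge_rate T" by (intro tendsto_mult tendsto_const merge_tendsto K t)
  have P: "(\<lambda>m. (1 - 1 / real m)\<^sup>2 ^ K t m) \<longlonglongrightarrow> exp (- t)"
  proof -
    have "(\<lambda>m. (1 - 1 / real m) ^ (2 * K t m)) \<longlonglongrightarrow> exp (- t)"
      using K[OF t(1)] lim_1_over_n by (intro one_minus_power_tendsto) simp_all
    then show ?thesis by (simp add: power_mult)
  qed
  have "(\<lambda>m. real (card V) * (1 - 1 / real m)\<^sup>2 ^ K t m / 2 - (2 * s + card V * (?C m + ?E t m + ?E T m))) \<longlonglongrightarrow>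
      card V * exp (- t) / 2 - (2 * s + card V * (card V * merge_rate T + escape_rate t L + escape_rate T L))"
    by (intro tendsto_intros P C E t) simp
  from order_tendstoD(1)[OF this, of 0]
  have ev2: "\<forall>\<^sub>F m in sequentially. 2 * s + card V * (?C m + ?E t m + ?E T m) \<le> card V * (1 - 1 / real m)\<^sup>2 ^ K t m / 2"
    using far by (auto elim!: eventually_mono)
  have "(\<lambda>m. (real (2 * K t m) / real m + real (2 * K T m) / real m) * card V * (\<beta> L)\<^sup>2 / s\<^sup>2 + ?E t m + ?E T m)
      \<longlonglongrightarrow> (t + T) * card V * (\<beta> L)\<^sup>2 / s\<^sup>2 + escape_rate t L + escape_rate T L"
    using s by (intro tendsto_intros E K t) simp
  from order_tendstoD(2)[OF this small]
  have ev3: "\<forall>\<^sub>F m in sequentially. (real (2 * K t m) / real m + real (2 * K T m) / real m) * card V * (\<beta> L)\<^sup>2 / s\<^sup>2 + ?E t m + ?E T m < \<epsilon>" .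
  have "\<forall>\<^sub>F m in sequentially. False"
    using metric_eventually ev1 ev2 ev3
  proof eventually_elim
    case (elim m)
    interpret M: coloring_metric V nbr forb q \<Delta> dst \<beta> "1 / real m" by (rule elim(1))
    obtain \<sigma> A where s0: "\<sigma> \<in> \<Omega>" and A: "1 - ((real (2 * K t m) + real (2 * K T m)) * (card V * (1 / real m)) * (\<beta> L)\<^sup>2 / s\<^sup>2 + ?E t m + ?E T m)
        \<le> measure_pmf.prob (law (1 / real m) (2 * K t m) \<sigma>) A - measure_pmf.prob (law (1 / real m) (2 * K T m) \<xi>) A"
      using M.slot_law_apart[OF x s, of "2 * K T m" "K t m" L] elim(3)
      unfolding M.esc_def M.coal_def by blast
    have "(real (2 * K t m) + real (2 * K T m)) * (card V * (1 / real m)) = (real (2 * K t m) / real m + real (2 * K T m) / real m) * card V"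
      by (simp add: add_divide_distrib[symmetric])
    then have "(real (2 * K t m) + real (2 * K T m)) * (card V * (1 / real m)) * (\<beta> L)\<^sup>2 / s\<^sup>2 + ?E t m + ?E T m < \<epsilon>"
      using elim(4) by simp
    moreover have "measure_pmf.prob (law (1 / real m) (2 * K t m) \<sigma>) A
      - measure_pmf.prob (law (1 / real m) (2 * K T m) \<xi>) A < (1 - 2 * \<epsilon>) + \<epsilon>"
      using elim(2) s0 by blast
    ultimately show False using A by linarith
  qed
  then show False by simp
qed

end

section \<open>Boxes of the lattice\<close>

lemma tv_dist_pmf_le:
  assumes "\<And>A. \<bar>measure_pmf.prob p A - measure_pmf.prob r A\<bar> \<le> b"
  shows "tv_dist (measure_pmf p) (measure_pmf r) \<le> b"
  unfolding tv_dist_def by (rule cSUP_least) (use assms in auto)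

lemma tv_dist_pmf_ge: "\<bar>measure_pmf.prob p A - measure_pmf.prob r A\<bar> \<le> tv_dist (measure_pmf p) (measure_pmf r)"
  unfolding tv_dist_def
proof (rule cSUP_upper)
  show "bdd_above ((\<lambda>A. \<bar>measure_pmf.prob p A - measure_pmf.prob r A\<bar>) ` sets (measure_pmf p))"
  proof (rule bdd_aboveI2)
    fix A show "\<bar>measure_pmf.prob p A - measure_pmf.prob r A\<bar> \<le> 1"
      using measure_pmf.prob_le_1[of p A] measure_pmf.prob_le_1[of r A]
        measure_nonneg[of "measure_pmf p" A] measure_nonneg[of "measure_pmf r" A]
      unfolding abs_le_iff by linarith
  qed
qed simp

lemma card_lattice_box: "card (lattice_box (b :: int ^ 'd) n) = n ^ CARD('d)"
proof -
  have "bij_betw vec_lambda (UNIV \<rightarrow>\<^sub>E {0..<int n}) {v :: int ^ 'd. \<forall>i. 0 \<le> v $ i \<and> v $ i < int n}"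
    by (rule bij_betw_byWitness[where f'=vec_nth]) (auto simp: PiE_iff)
  then have "card {v :: int ^ 'd. \<forall>i. 0 \<le> v $ i \<and> v $ i < int n} = n ^ CARD('d)"
    by (auto dest!: bij_betw_same_card simp: card_PiE)
  moreover have "bij_betw (\<lambda>v. v + b) {v :: int ^ 'd. \<forall>i. 0 \<le> v $ i \<and> v $ i < int n} (lattice_box b n)"
    by (rule bij_betw_byWitness[where f'="\<lambda>v. v - b"]) (auto simp: lattice_box_def algebra_simps)
  ultimately show ?thesis by (auto dest: bij_betw_same_card)
qed

lemma finite_lattice_box: "finite (lattice_box (b :: int ^ 'd) n)"
proof (cases "n = 0")
  case True
  then have "lattice_box b n = {}" by (auto simp: lattice_box_def dest: spec[where x=undefined])
  then show ?thesis by simp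
next
  case False
  then have "card (lattice_box b n) \<noteq> 0" by (simp add: card_lattice_box)
  then show ?thesis by (rule card_ge_0_finite[OF neq0_conv[THEN iffD1]])
qed

lemma lattice_adj_sym: "lattice_adj x y \<longleftrightarrow> lattice_adj y x"
  by (simp add: lattice_adj_def abs_minus_commute)

text \<open>Nonnegative integers with sum 1 are a single 1 and zeros, so a neighbour differs by a
  unit in one coordinate.\<close>

lemma lattice_adj_subset:
  "{y. lattice_adj (x :: int ^ 'd) y} \<subseteq> (\<lambda>(i, s). \<chi> j. x $ j + (if j = i then s else 0)) ` (UNIV \<times> {1, -1})"
proof
  fix y assume "y \<in> {y. lattice_adj x y}"
  then have s: "(\<Sum>i\<in>UNIV. \<bar>x $ i - y $ i\<bar>) = 1" by (simp add: lattice_adj_def)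
  have "\<exists>i. \<bar>x $ i - y $ i\<bar> \<noteq> 0"
  proof (rule ccontr)
    assume "\<nexists>i. \<bar>x $ i - y $ i\<bar> \<noteq> 0"
    then have "(\<Sum>i\<in>UNIV. \<bar>x $ i - y $ i\<bar>) = 0" by (intro sum.neutral) blast
    then show False using s by linarith
  qed
  then obtain i where i: "\<bar>x $ i - y $ i\<bar> \<noteq> 0" by blast
  have "\<bar>x $ i - y $ i\<bar> + (\<Sum>j\<in>UNIV - {i}. \<bar>x $ j - y $ j\<bar>) = 1"
    using s by (subst sum.remove[of UNIV i, symmetric]) auto
  moreover have "0 \<le> (\<Sum>j\<in>UNIV - {i}. \<bar>x $ j - y $ j\<bar>)" by (intro sum_nonneg) simp
  ultimately have 1: "\<bar>x $ i - y $ i\<bar> = 1" "(\<Sum>j\<in>UNIV - {i}. \<bar>x $ j - y $ j\<bar>) = 0" using i by linarith+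
  then have 0: "y $ j = x $ j" if "j \<noteq> i" for j using that by (simp add: sum_nonneg_eq_0_iff)
  then have "y = (\<lambda>(i, s). \<chi> j. x $ j + (if j = i then s else 0)) (i, y $ i - x $ i)"
    by (auto simp: vec_eq_iff)
  moreover have "y $ i - x $ i \<in> {1, -1}" using 1 by auto
  ultimately show "y \<in> (\<lambda>(i, s). \<chi> j. x $ j + (if j = i then s else 0)) ` (UNIV \<times> {1, -1})"
    by blast
qed

lemma lattice_degree: "finite {y. lattice_adj (x :: int ^ 'd) y}" "card {y. lattice_adj (x :: int ^ 'd) y} \<le> 2 * CARD('d)"
proof -
  show "finite {y. lattice_adj x y}" by (rule finite_subset[OF lattice_adj_subset]) simp
  have "card {y. lattice_adj x y} \<le> card ((UNIV :: 'd set) \<times> {1, -1 :: int})"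
    by (rule order_trans[OF card_mono[OF _ lattice_adj_subset[of x]] card_image_le]) simp_all
  then show "card {y. lattice_adj x y} \<le> 2 * CARD('d)" by (simp add: card_cartesian_product)
qed

definition box_nbr :: "(int ^ 'd) set \<Rightarrow> int ^ 'd \<Rightarrow> (int ^ 'd) set" where
  "box_nbr \<Lambda> x = {y \<in> \<Lambda>. lattice_adj x y}"

text \<open>Colours rather than sites: equal colours count once and free sites contribute none, so
  the size is at most the number of neighbours in the boundary.\<close>

definition boundary_colors :: "(int ^ 'd) set \<Rightarrow> (int ^ 'd \<rightharpoonup> nat) \<Rightarrow> int ^ 'd \<Rightarrow> nat set" where
  "boundary_colors \<Lambda> \<tau> x = {c. \<exists>y\<in>outer_boundary \<Lambda>. lattice_adj x y \<and> \<tau> y = Some c}"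

definition l1_dist :: "int ^ 'd \<Rightarrow> int ^ 'd \<Rightarrow> nat" where
  "l1_dist x y = nat (\<Sum>i\<in>UNIV. \<bar>x $ i - y $ i\<bar>)"

lemma lattice_coloring_geometry:
  fixes b :: "int ^ 'd"
  assumes "0 < n" and q: "4 * CARD('d) * (CARD('d) + 1) \<le> q"
  defines "\<Lambda> \<equiv> lattice_box b n"
  shows "coloring_geometry \<Lambda> (box_nbr \<Lambda>) (boundary_colors \<Lambda> \<tau>) q (2 * CARD('d)) l1_dist (\<lambda>L. (2 * real L + 1) ^ CARD('d))"
proof
  show "finite \<Lambda>" unfolding \<Lambda>_def by (rule finite_lattice_box)
  have "card \<Lambda> \<noteq> 0" using assms by (simp add: \<Lambda>_def card_lattice_box)
  then show "\<Lambda> \<noteq> {}" by auto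
  show "2 * CARD('d) * (2 * CARD('d) + 2) \<le> q" using q by (simp add: algebra_simps)
  show "0 < 2 * CARD('d)" by simp
next
  fix x assume x: "x \<in> \<Lambda>"
  show "box_nbr \<Lambda> x \<subseteq> \<Lambda>" by (auto simp: box_nbr_def)
  show "x \<notin> box_nbr \<Lambda> x" by (simp add: box_nbr_def lattice_adj_def)
  show "l1_dist x x = 0" by (simp add: l1_dist_def)
  let ?O = "{y \<in> outer_boundary \<Lambda>. lattice_adj x y}"
  have fO: "finite ?O" by (rule finite_subset[OF _ lattice_degree(1)[of x]]) auto
  have sub: "boundary_colors \<Lambda> \<tau> x \<subseteq> (\<lambda>y. the (\<tau> y)) ` ?O"
    by (force simp: boundary_colors_def)
  then show "finite (boundary_colors \<Lambda> \<tau> x)" using fO finite_subset by blast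
  have "card (boundary_colors \<Lambda> \<tau> x) \<le> card ?O"
    using card_mono[OF _ sub] card_image_le[OF fO, of "\<lambda>y. the (\<tau> y)"] fO by (meson finite_imageI order_trans)
  moreover have "card (box_nbr \<Lambda> x) + card ?O = card (box_nbr \<Lambda> x \<union> ?O)"
    using fO finite_subset[OF _ lattice_degree(1)[of x], of "box_nbr \<Lambda> x"]
    by (intro card_Un_disjoint[symmetric]) (auto simp: box_nbr_def outer_boundary_def)
  moreover have "card (box_nbr \<Lambda> x \<union> ?O) \<le> card {y. lattice_adj x y}"
    by (intro card_mono lattice_degree) (auto simp: box_nbr_def)
  ultimately show "card (box_nbr \<Lambda> x) + card (boundary_colors \<Lambda> \<tau> x) \<le> 2 * CARD('d)"
    using lattice_degree(2)[of x] by linarith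
next
  fix x y assume "x \<in> \<Lambda>" "y \<in> box_nbr \<Lambda> x"
  then show "x \<in> box_nbr \<Lambda> y" by (simp add: box_nbr_def lattice_adj_sym)
next
  fix x z y assume "x \<in> \<Lambda>" "z \<in> \<Lambda>" "y \<in> box_nbr \<Lambda> z"
  then have zy: "(\<Sum>i\<in>UNIV. \<bar>z $ i - y $ i\<bar>) = 1" by (simp add: box_nbr_def lattice_adj_def)
  have "(\<Sum>i\<in>UNIV. \<bar>x $ i - y $ i\<bar>) \<le> (\<Sum>i\<in>UNIV. \<bar>x $ i - z $ i\<bar> + \<bar>z $ i - y $ i\<bar>)"
    by (intro sum_mono) linarith
  then show "l1_dist x y \<le> Suc (l1_dist x z)"
    unfolding l1_dist_def using zy by (simp add: sum.distrib)
next
  fix z :: "int ^ 'd" and L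
  have "{x \<in> \<Lambda>. l1_dist x z \<le> L} \<subseteq> lattice_box (\<chi> i. z $ i - int L) (2 * L + 1)"
  proof
    fix x assume "x \<in> {x \<in> \<Lambda>. l1_dist x z \<le> L}"
    then have s: "(\<Sum>i\<in>UNIV. \<bar>x $ i - z $ i\<bar>) \<le> int L"
      unfolding l1_dist_def by (simp add: nat_le_iff)
    have "\<bar>x $ i - z $ i\<bar> \<le> int L" for i
    proof -
      have "\<bar>x $ i - z $ i\<bar> \<le> (\<Sum>i\<in>UNIV. \<bar>x $ i - z $ i\<bar>)" by (intro member_le_sum) auto
      then show ?thesis using s by simp
    qed
    note le = this
    have "z $ i - int L \<le> x $ i \<and> x $ i < z $ i - int L + int (2 * L + 1)" for i
      using le[of i] by (simp add: abs_le_iff)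
    then show "x \<in> lattice_box (\<chi> i. z $ i - int L) (2 * L + 1)" by (simp add: lattice_box_def)
  qed
  from card_mono[OF finite_lattice_box this]
  have "card {x \<in> \<Lambda>. l1_dist x z \<le> L} \<le> (2 * L + 1) ^ CARD('d)"
    unfolding card_lattice_box .
  then have "real (card {x \<in> \<Lambda>. l1_dist x z \<le> L}) \<le> real ((2 * L + 1) ^ CARD('d))"
    by (simp only: of_nat_le_iff)
  then show "real (card {x \<in> \<Lambda>. l1_dist x z \<le> L}) \<le> (2 * real L + 1) ^ CARD('d)"
    by (simp add: add.commute)
qed

lemma \<Omega>_eq_proper_colorings:
  assumes "coloring_system V (box_nbr V) (boundary_colors V \<tau>) q \<Delta>"
  shows "coloring_system.\<Omega> V (box_nbr V) (boundary_colors V \<tau>) q = proper_colorings q V \<tau>"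
proof -
  have "(\<forall>x\<in>V. \<sigma> x \<notin> boundary_colors V \<tau> x \<and> (\<forall>y\<in>box_nbr V x. \<sigma> y \<noteq> \<sigma> x)) \<longleftrightarrow>
    (\<forall>x\<in>V. \<forall>y\<in>V. lattice_adj x y \<longrightarrow> \<sigma> x \<noteq> \<sigma> y) \<and>
    (\<forall>x\<in>V. \<forall>y\<in>outer_boundary V. lattice_adj x y \<longrightarrow> \<tau> y \<noteq> Some (\<sigma> x))" for \<sigma>
    unfolding box_nbr_def boundary_colors_def mem_Collect_eq by (safe; force)
  then show ?thesis unfolding coloring_system.\<Omega>_def[OF assms] proper_colorings_def by blast
qed

text \<open>The infimum defining \<open>tmix\<close> need not be attained, so \<open>drop\<close> is
  applied to a time that exceeds it by less than 1; hence the \<open>+ 1\<close> in that hypothesis,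
  and the extra 1 is absorbed by the window. The lower bound of order log n then makes the window
  negligible.\<close>

lemma cutoff_criterion:
  fixes D :: "nat \<Rightarrow> real \<Rightarrow> real" and tmix :: "nat \<Rightarrow> real \<Rightarrow> real"
  assumes tmix: "\<And>n \<epsilon>. tmix n \<epsilon> = Inf {t. 0 \<le> t \<and> D n t \<le> \<epsilon>}"
    and C: "0 < C" and c: "0 < c"
    and upper: "\<And>\<epsilon>. 0 < \<epsilon> \<Longrightarrow> \<forall>\<^sub>F n in sequentially. D n (C * ln (real n)) \<le> \<epsilon>"
    and lower: "\<And>\<epsilon>. 0 < \<epsilon> \<Longrightarrow> \<epsilon> < 1 \<Longrightarrow>
      \<forall>\<^sub>F n in sequentially. \<forall>t. 0 \<le> t \<and> t \<le> c * ln (real n) \<longrightarrow> \<epsilon> < D n t"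
    and drop: "\<And>\<epsilon>. 0 < \<epsilon> \<Longrightarrow> \<epsilon> < 1 \<Longrightarrow> \<forall>\<^sub>F n in sequentially. \<forall>t. 0 \<le> t \<and> t \<le> C * ln (real n) + 1 \<and> D n t \<le> 1 - \<epsilon> \<longrightarrow>
        D n (t + B * ln (ln (real n))) \<le> \<epsilon>"
    and B: "0 \<le> B"
  shows "has_cutoff tmix \<and> has_cutoff_window tmix (\<lambda>n. ln (ln (real n)))"
proof -
  let ?l = "\<lambda>n. ln (real n)" and ?w = "\<lambda>n. ln (ln (real n))"
  have bdd: "bdd_below {t. 0 \<le> t \<and> D n t \<le> \<epsilon>}" for n \<epsilon> by (rule bdd_belowI[of _ 0]) simp
  have big: "\<forall>\<^sub>F n in sequentially. 1 \<le> ?w n" by real_asymp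
  have big': "\<forall>\<^sub>F n in sequentially. 1 \<le> ?l n" by real_asymp
  have low: "\<forall>\<^sub>F n in sequentially. c * ?l n \<le> tmix n \<epsilon>" if e: "0 < \<epsilon>" "\<epsilon> < 1" for \<epsilon>
    using lower[OF e] upper[OF e(1)] big'
  proof eventually_elim
    case (elim n)
    show ?case unfolding tmix
    proof (rule cInf_greatest)
      have "0 \<le> C * ?l n" using C elim by simp
      then show "{t. 0 \<le> t \<and> D n t \<le> \<epsilon>} \<noteq> {}" using elim by blast
      fix t assume "t \<in> {t. 0 \<le> t \<and> D n t \<le> \<epsilon>}"
      then have t: "0 \<le> t" "D n t \<le> \<epsilon>" by auto
      show "c * ?l n \<le> t"
      proof (rule ccontr)
        assume "\<not> c * ?l n \<le> t"
        then have "\<epsilon> < D n t" using elim(1) t(1) by simp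
        then show False using t(2) by simp
      qed
    qed
  qed
  have win: "\<forall>\<^sub>F n in sequentially. \<bar>tmix n \<epsilon> - tmix n (1 - \<epsilon>)\<bar> \<le> (1 + B) * ?w n"
    if e: "0 < \<epsilon>" "\<epsilon> \<le> 1 / 2" for \<epsilon>
  proof -
    have e1: "\<epsilon> < 1" "0 < 1 - \<epsilon>" using e by auto
    show ?thesis using drop[OF e(1) e1(1)] upper[OF e(1)] upper[OF e1(2)] big big'
    proof eventually_elim
      case (elim n)
      let ?S = "\<lambda>\<epsilon>. {t. 0 \<le> t \<and> D n t \<le> \<epsilon>}"
      have T0: "0 \<le> C * ?l n" using C elim by simp
      then have ne: "C * ?l n \<in> ?S \<epsilon>" "C * ?l n \<in> ?S (1 - \<epsilon>)" using elim by auto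
      have "tmix n (1 - \<epsilon>) \<le> tmix n \<epsilon>"
        unfolding tmix using e ne by (intro cInf_superset_mono bdd) auto
      moreover have "tmix n \<epsilon> \<le> tmix n (1 - \<epsilon>) + 1 + B * ?w n"
      proof -
        have "Inf (?S (1 - \<epsilon>)) < Inf (?S (1 - \<epsilon>)) + 1" by simp
        then obtain t where t: "t \<in> ?S (1 - \<epsilon>)" "t < Inf (?S (1 - \<epsilon>)) + 1"
          using cInf_lessD[of "?S (1 - \<epsilon>)"] ne(2) by blast
        have "Inf (?S (1 - \<epsilon>)) \<le> C * ?l n" by (rule cInf_lower[OF ne(2) bdd])
        then have "D n (t + B * ?w n) \<le> \<epsilon>" using t elim(1) by auto
        moreover have "0 \<le> B * ?w n" using B elim by simp
        ultimately have "t + B * ?w n \<in> ?S \<epsilon>" using t by simp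
        then have "tmix n \<epsilon> \<le> t + B * ?w n" unfolding tmix by (rule cInf_lower[OF _ bdd])
        then show ?thesis using t(2) unfolding tmix by linarith
      qed
      ultimately show ?case using elim(4) by (simp add: distrib_right)
    qed
  qed
  have win': "\<forall>\<^sub>F n in sequentially. \<bar>tmix n \<epsilon> - tmix n (1 - \<epsilon>)\<bar> \<le> (1 + B) * ?w n"
    if e: "0 < \<epsilon>" "\<epsilon> < 1" for \<epsilon>
  proof (cases "\<epsilon> \<le> 1 / 2")
    case False
    then have "\<forall>\<^sub>F n in sequentially. \<bar>tmix n (1 - \<epsilon>) - tmix n (1 - (1 - \<epsilon>))\<bar> \<le> (1 + B) * ?w n"
      using e by (intro win) auto
    then show ?thesis by (simp add: abs_minus_commute)
  qed (use win e in auto)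
  have "has_cutoff tmix"
    unfolding has_cutoff_def
  proof (intro allI impI)
    fix \<epsilon> :: real assume e: "0 < \<epsilon> \<and> \<epsilon> < 1"
    have "(\<lambda>n. tmix n \<epsilon> / tmix n (1 - \<epsilon>) - 1) \<longlonglongrightarrow> 0"
    proof (rule tendsto_0_le[where K="1" and f="\<lambda>n. (1 + B) * ?w n / (c * ?l n)"])
      show "(\<lambda>n. (1 + B) * ?w n / (c * ?l n)) \<longlonglongrightarrow> 0" using c B by real_asymp
      have ev: "\<forall>\<^sub>F n in sequentially. c * ?l n \<le> tmix n (1 - \<epsilon>)" using e by (intro low) auto
      show "\<forall>\<^sub>F n in sequentially. norm (tmix n \<epsilon> / tmix n (1 - \<epsilon>) - 1) \<le> norm ((1 + B) * ?w n / (c * ?l n)) * 1"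
        using win'[OF e[THEN conjunct1] e[THEN conjunct2]] ev big'
      proof eventually_elim
        case (elim n)
        have p: "0 < c * ?l n" using c elim by simp
        then have q: "0 < tmix n (1 - \<epsilon>)" using elim by simp
        then have "norm (tmix n \<epsilon> / tmix n (1 - \<epsilon>) - 1) = \<bar>tmix n \<epsilon> - tmix n (1 - \<epsilon>)\<bar> / tmix n (1 - \<epsilon>)"
          by (simp add: field_simps abs_divide)
        also have "\<dots> \<le> ((1 + B) * ?w n) / (c * ?l n)"
          using elim p by (intro frac_le) auto
        also have "\<dots> \<le> norm ((1 + B) * ?w n / (c * ?l n)) * 1"
          unfolding real_norm_def mult_1_right by (rule abs_ge_self)
        finally show ?case .
      qed
    qed
    then have "(\<lambda>n. (tmix n \<epsilon> / tmix n (1 - \<epsilon>) - 1) + 1) \<longlonglongrightarrow> 0 + 1" by (intro tendsto_intros)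
    then show "(\<lambda>n. tmix n \<epsilon> / tmix n (1 - \<epsilon>)) \<longlonglongrightarrow> 1" by simp
  qed
  moreover have "has_cutoff_window tmix ?w"
    unfolding has_cutoff_window_def
  proof (intro conjI allI impI)
    have "?w \<in> o(\<lambda>n. c * ?l n)" using c by real_asymp
    moreover have "(\<lambda>n. c * ?l n) \<in> O(\<lambda>n. tmix n (exp (- 1)))"
    proof (rule bigoI[where c=1])
      have ev: "\<forall>\<^sub>F n in sequentially. c * ?l n \<le> tmix n (exp (- 1))" by (intro low) auto
      show "\<forall>\<^sub>F n in sequentially. norm (c * ?l n) \<le> 1 * norm (tmix n (exp (- 1)))"
        using ev big'
      proof eventually_elim
        case (elim n)
        then have "0 \<le> c * ?l n" using c by simp
        then show ?case using elim by simp
      qed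
    qed
    ultimately show "?w \<in> o(\<lambda>n. tmix n (exp (- 1)))" by (rule landau_o.small_big_trans)
  next
    fix \<epsilon> :: real assume e: "0 < \<epsilon> \<and> \<epsilon> < 1"
    show "(\<lambda>n. tmix n \<epsilon> - tmix n (1 - \<epsilon>)) \<in> O(?w)"
    proof (rule bigoI[where c="1 + B"])
      show "\<forall>\<^sub>F n in sequentially. norm (tmix n \<epsilon> - tmix n (1 - \<epsilon>)) \<le> (1 + B) * norm (?w n)"
        using win'[OF e[THEN conjunct1] e[THEN conjunct2]] big by eventually_elim simp
    qed
  qed
  ultimately show ?thesis ..
qed

section \<open>Cutoff\<close>

context coloring_geometry
begin

definition worst :: "real \<Rightarrow> real" where
  "worst t = (MAX \<sigma>\<in>\<Omega>. tv_dist (measure_pmf (heat_pmf t \<sigma>)) (measure_pmf \<mu>))"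

lemma worst_le:
  assumes "\<And>\<sigma> A. \<sigma> \<in> \<Omega> \<Longrightarrow> \<bar>measure_pmf.prob (heat_pmf t \<sigma>) A - measure_pmf.prob \<mu> A\<bar> \<le> b"
  shows "worst t \<le> b"
  unfolding worst_def using finite_\<Omega> \<Omega>_nonempty assms by (intro Max.boundedI) (auto intro!: tv_dist_pmf_le)

lemma worst_ge:
  assumes "\<sigma> \<in> \<Omega>"
  shows "\<bar>measure_pmf.prob (heat_pmf t \<sigma>) A - measure_pmf.prob \<mu> A\<bar> \<le> worst t"
proof -
  have "tv_dist (measure_pmf (heat_pmf t \<sigma>)) (measure_pmf \<mu>) \<le> worst t"
    unfolding worst_def using finite_\<Omega> assms by (intro Max_ge) auto
  then show ?thesis using tv_dist_pmf_ge[of "heat_pmf t \<sigma>" A \<mu>] by linarith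
qed

lemma worst_upper: "0 \<le> t \<Longrightarrow> worst t \<le> card V * merge_rate t"
  by (intro worst_le heat_near_\<mu>)

text \<open>The law at time \<open>T\<close> stands for \<open>\<mu>\<close> both before and after
  the further time \<open>s\<close>. This costs \<open>\<epsilon> / 2\<close> in the hypothesis,
  leaving \<open>2 * (\<epsilon> / 4)\<close> for \<open>heat_contract\<close>, and
  \<open>card V * merge_rate (T + s)\<close> in the conclusion.\<close>

lemma worst_drop:
  fixes t T s \<epsilon> :: real
  assumes t: "0 \<le> t" "0 \<le> T" "0 \<le> s" and e: "0 < \<epsilon>"
    and w: "worst t \<le> 1 - \<epsilon>" and T: "card V * merge_rate T \<le> \<epsilon> / 2"
  shows "worst (t + s) \<le> 2 * sqrt (8 * (\<beta> L * merge_rate s) / \<epsilon>)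
    + (1 + 4 / \<epsilon>) * (escape_rate (t + s) L + escape_rate (T + s) L) + card V * merge_rate (T + s)"
proof (rule worst_le)
  fix \<sigma> A assume s: "\<sigma> \<in> \<Omega>"
  have e4: "0 < \<epsilon> / 4" using e by simp
  have tv: "measure_pmf.prob (heat_pmf t \<sigma>) A - measure_pmf.prob (heat_pmf T \<sigma>) A \<le> 1 - 2 * (\<epsilon> / 4)" for A
    using worst_ge[OF s, of t A] heat_near_\<mu>[OF s t(2), of A] w T unfolding abs_le_iff by linarith
  have "\<bar>measure_pmf.prob (heat_pmf (t + s) \<sigma>) A - measure_pmf.prob (heat_pmf (T + s) \<sigma>) A\<bar>
    \<le> 2 * sqrt (2 * (\<beta> L * merge_rate s) / (\<epsilon> / 4)) + (1 + 1 / (\<epsilon> / 4)) * (escape_rate (t + s) L + escape_rate (T + s) L)"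
    by (rule heat_contract[OF s s t e4 tv])
  moreover have "\<bar>measure_pmf.prob (heat_pmf (T + s) \<sigma>) A - measure_pmf.prob \<mu> A\<bar> \<le> card V * merge_rate (T + s)"
    using t by (intro heat_near_\<mu> s) simp
  moreover have "2 * (\<beta> L * merge_rate s) / (\<epsilon> / 4) = 8 * (\<beta> L * merge_rate s) / \<epsilon>" "1 + 1 / (\<epsilon> / 4) = 1 + 4 / \<epsilon>"
    using e by (simp_all add: field_simps)
  ultimately show "\<bar>measure_pmf.prob (heat_pmf (t + s) \<sigma>) A - measure_pmf.prob \<mu> A\<bar> \<le> 2 * sqrt (8 * (\<beta> L * merge_rate s) / \<epsilon>)
    + (1 + 4 / \<epsilon>) * (escape_rate (t + s) L + escape_rate (T + s) L) + card V * merge_rate (T + s)"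
    by (simp only:)
qed

lemma worst_apart:
  fixes t T s \<epsilon> :: real
  assumes t: "0 \<le> t" "0 \<le> T" and s: "0 < s" and e: "0 < \<epsilon>"
    and far: "2 * s + card V * (card V * merge_rate T + escape_rate t L + escape_rate T L) < card V * exp (- t) / 2"
    and small: "(t + T) * card V * (\<beta> L)\<^sup>2 / s\<^sup>2 + escape_rate t L + escape_rate T L < \<epsilon>"
  shows "1 - 2 * \<epsilon> - card V * merge_rate T < worst t"
proof -
  obtain \<xi> where x: "\<xi> \<in> \<Omega>" using \<Omega>_nonempty by auto
  obtain \<sigma> A where s: "\<sigma> \<in> \<Omega>" "1 - 2 * \<epsilon> < measure_pmf.prob (heat_pmf t \<sigma>) A - measure_pmf.prob (heat_pmf T \<xi>) A"
    using heat_apart[OF x t s e far small] by blast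
  show ?thesis using worst_ge[OF s(1), of t A] heat_near_\<mu>[OF x t(2), of A] s(2) unfolding abs_le_iff by linarith
qed

text \<open>With l = ln n the exponent is at most
  \<open>(d + b * (\<Delta> * exp 1) - c) * l\<close>, and \<open>c\<close> makes this
  \<open>- 2 * l\<close>.\<close>

lemma escape_le:
  assumes "real (card V) = exp (d * l)" "t \<le> b * l" "c * l \<le> real L" "c = d + 2 + b * (\<Delta> * exp 1)"
  shows "escape_rate t L \<le> exp (- 2 * l)"
proof -
  have "t * (\<Delta> * exp 1) \<le> b * l * (\<Delta> * exp 1)" using assms(2) by (intro mult_right_mono) auto
  then have "d * l + (t * (\<Delta> * exp 1) - real L) \<le> d * l + (b * l * (\<Delta> * exp 1) - c * l)" using assms(3) by linarith
  also have "\<dots> = - 2 * l" unfolding assms(4) by (simp add: algebra_simps)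
  finally show ?thesis unfolding escape_rate_def assms(1) by (simp flip: exp_add)
qed

text \<open>With l = ln n, the decay n^-(d+1) beats the volume n^d by one power of n.\<close>

lemma card_merge_rate:
  assumes "real (card V) = exp (d * l)" "gap * b = d + 1"
  shows "card V * merge_rate (b * l) = \<Delta> / gap * exp (- l)"
proof -
  have "gap * (b * l) = (d + 1) * l" unfolding assms(2)[symmetric] by simp
  then have "d * l + - (gap * (b * l)) = - l" by (simp add: algebra_simps)
  moreover have "card V * merge_rate (b * l) = \<Delta> / gap * exp (d * l + - (gap * (b * l)))"
    unfolding merge_rate_def assms(1) exp_add by simp
  ultimately show ?thesis by simp
qed

lemma merge_rate_mono: "s \<le> t \<Longrightarrow> merge_rate t \<le> merge_rate s"
  unfolding merge_rate_def using gap_pos by (intro mult_left_mono) auto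

end

theorem theorem5:
  fixes q :: nat
    and a :: "nat \<Rightarrow> int ^ 'd"
    and \<tau> :: "nat \<Rightarrow> int ^ 'd \<rightharpoonup> nat"
  assumes "q \<ge> 4 * CARD('d) * (CARD('d) + 1)"
    and "\<And>n. boundary_condition q (lattice_box (a n) n) (\<tau> n)"
  shows "has_cutoff (\<lambda>n. coloring_mixing_time q (lattice_box (a n) n) (\<tau> n)) \<and>
    has_cutoff_window (\<lambda>n. coloring_mixing_time q (lattice_box (a n) n) (\<tau> n))
      (\<lambda>n. ln (ln (real n)))"
proof -
  note q = assms(1)
  define \<Lambda> where "\<Lambda> n = lattice_box (a n) n" for n
  define d where "d = real CARD('d)"
  define \<Delta> where "\<Delta> = 2 * CARD('d)"
  define g where "g = coloring_system.gap q \<Delta>"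
  define \<beta> where "\<beta> L = (2 * real L + 1) ^ CARD('d)" for L
  define D where "D n t = (MAX \<sigma>\<in>proper_colorings q (\<Lambda> n) (\<tau> n). tv_dist
      (heat_bath_law (coloring_measure q (\<Lambda> n) (\<tau> n)) (\<Lambda> n) t \<sigma>)
      (measure_pmf (coloring_measure q (\<Lambda> n) (\<tau> n))))" for n t
  define W where "W n = coloring_geometry.worst (\<Lambda> n) (box_nbr (\<Lambda> n)) (boundary_colors (\<Lambda> n) (\<tau> n)) q" for n
  have geo: "coloring_geometry (\<Lambda> n) (box_nbr (\<Lambda> n)) (boundary_colors (\<Lambda> n) (\<tau> n)) q \<Delta> l1_dist \<beta>" if "0 < n" for n
    using lattice_coloring_geometry[OF that q] unfolding \<Lambda>_def \<Delta>_def \<beta>_def .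
  have g: "0 < g" unfolding g_def by (rule coloring_system.gap_pos[OF coloring_geometry.axioms(1)[OF geo[of 1]]]) simp
  have d: "1 \<le> d" by (simp add: d_def Suc_leI)
  define K where "K = real \<Delta> / g"
  have K: "0 < K" using g by (simp add: K_def \<Delta>_def)
  \<comment> \<open>Serves twice. Up to constants, the merge rate is n^-(d+1) at time B ln n,
    against the volume n^d, and (ln n)^-(d+1) at time B ln ln n, against balls of size (ln
    n)^d.\<close>
  define B where "B = (d + 1) / g"
  have B: "0 < B" and gB: "g * B = d + 1" using g d by (simp_all add: B_def)
  \<comment> \<open>All times in use are at most b ln n: a time up to B ln n + 1, followed by B ln
    ln n, which is at most B ln n.\<close>
  define b where "b = B + 1 + B"
  \<comment> \<open>By \<open>escape_le\<close>, histories of age up to b ln n leave radius c ln n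
    with a bound of n^-2.\<close>
  define c where "c = d + 2 + b * (\<Delta> * exp 1)"
  have b: "0 < b" and c: "0 < c" using d B by (auto simp: b_def c_def intro!: add_pos_nonneg)
  \<comment> \<open>From 2 (c l + 1) + 1 \<le> (2 c + 3) l for l \<ge> 1, where the inner 1 allows
    for the rounding in \<open>L\<close>.\<close>
  define M where "M = 2 * c + 3"
  have M: "0 < M" using c by (simp add: M_def)
  define L where "L n = nat \<lceil>c * ln (real n)\<rceil>" for n
  \<comment> \<open>Positive \<open>n\<close> makes the box nonempty, as the abstract setting
    requires.\<close>
  have DW: "D n t = W n t" if n: "0 < n" and t: "0 \<le> t" for n t
  proof -
    interpret G: coloring_geometry "\<Lambda> n" "box_nbr (\<Lambda> n)" "boundary_colors (\<Lambda> n) (\<tau> n)" q \<Delta> l1_dist \<beta>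
      by (rule geo[OF n])
    have \<Omega>: "G.\<Omega> = proper_colorings q (\<Lambda> n) (\<tau> n)"
      by (rule \<Omega>_eq_proper_colorings[OF G.coloring_system_axioms])
    then have \<mu>: "G.\<mu> = coloring_measure q (\<Lambda> n) (\<tau> n)"
      by (simp add: G.\<mu>_def coloring_measure_def)
    show ?thesis
      unfolding D_def W_def G.worst_def \<Omega> \<mu>[symmetric] heat_bath_law_eq[OF G.finite_V G.V_nonempty t] G.heat_pmf_def ..
  qed
  have big: "\<forall>\<^sub>F n in sequentially. 0 < n \<and> 1 \<le> ln (real n) \<and> 1 \<le> ln (ln (real n))"
    by (intro eventually_conj eventually_gt_at_top) real_asymp+
  have card: "real (card (\<Lambda> n)) = exp (d * ln (real n))" if "0 < n" for n
    using that by (simp add: \<Lambda>_def card_lattice_box d_def exp_of_nat_mult)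
  have cL: "c * ln (real n) \<le> real (L n)" for n
    unfolding L_def by (rule real_nat_ceiling_ge)
  have \<beta>_le: "\<beta> (L n) \<le> (M * ln (real n)) ^ CARD('d)" if "1 \<le> ln (real n)" for n
  proof -
    have "real (L n) \<le> c * ln (real n) + 1"
      unfolding L_def using c that by (simp add: of_nat_nat)
    then have "2 * real (L n) + 1 \<le> 2 * (c * ln (real n)) + 3 * 1" by simp
    also have "\<dots> \<le> 2 * (c * ln (real n)) + 3 * ln (real n)" using that by (intro add_left_mono mult_left_mono) auto
    also have "\<dots> = M * ln (real n)" by (simp add: M_def algebra_simps)
    finally show ?thesis unfolding \<beta>_def by (intro power_mono) auto
  qed
  have \<beta>0: "0 \<le> \<beta> L" for L by (simp add: \<beta>_def)
  show ?thesis
  proof (rule cutoff_criterion[where D=D and C=B and c="1/4" and B=B])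
    show "coloring_mixing_time q (lattice_box (a n) n) (\<tau> n) \<epsilon> = Inf {t. 0 \<le> t \<and> D n t \<le> \<epsilon>}" for n \<epsilon>
      unfolding coloring_mixing_time_def mixing_time_def D_def \<Lambda>_def ..
    fix \<epsilon> :: real assume e: "0 < \<epsilon>"
    have "\<forall>\<^sub>F n in sequentially. K * exp (- ln (real n)) < \<epsilon>"
      using e by real_asymp
    then show "\<forall>\<^sub>F n in sequentially. D n (B * ln (real n)) \<le> \<epsilon>"
      using big
    proof eventually_elim
      case (elim n)
      then have n: "0 < n" by simp
      interpret G: coloring_geometry "\<Lambda> n" "box_nbr (\<Lambda> n)" "boundary_colors (\<Lambda> n) (\<tau> n)" q \<Delta> l1_dist \<beta>
        by (rule geo[OF n])
      have T: "0 \<le> B * ln (real n)" using B elim by simp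
      have "D n (B * ln (real n)) \<le> card (\<Lambda> n) * G.merge_rate (B * ln (real n))"
        unfolding DW[OF n T] W_def by (rule G.worst_upper[OF T])
      also have "\<dots> = K * exp (- ln (real n))"
        using G.card_merge_rate[OF card[OF n]] gB unfolding K_def g_def by blast
      finally show ?case using elim by linarith
    qed
  next
    fix \<epsilon> :: real assume e: "0 < \<epsilon>" "\<epsilon> < 1"
    \<comment> \<open>Two of the three parts of 1 - eps go to the separation by events, the third to
      the distance between the law at time B ln n and equilibrium.\<close>
    define \<epsilon>' where "\<epsilon>' = (1 - \<epsilon>) / 3"
    have e': "0 < \<epsilon>'" using e by (simp add: \<epsilon>'_def)
    let ?l = "\<lambda>n. ln (real n)"
    have 1: "\<forall>\<^sub>F n in sequentially. K * exp (- ?l n) < \<epsilon>'" using e' by real_asymp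
    \<comment> \<open>Room between the means: up to time (ln n) / 4 the excess agreement is at least
      N n^(-1/4) / 2. Half of this is \<open>2 * s\<close>, and the other errors are of smaller
      order.\<close>
    have 2: "\<forall>\<^sub>F n in sequentially. exp (- ?l n / 4) / 4 + (K * exp (- ?l n) + 2 * exp (- 2 * ?l n)) < exp (- ?l n / 4) / 2"
      using K by real_asymp
    have 3: "\<forall>\<^sub>F n in sequentially. (1 / 4 + B) * ?l n * ((M * ?l n) ^ CARD('d))\<^sup>2 * (64 * exp (- ?l n / 2)) + 2 * exp (- 2 * ?l n) < \<epsilon>'"
    proof (rule order_tendstoD(2)[OF _ e'])
      \<comment> \<open>One power of ln n comes from the time, the others from the squared ball
        size.\<close>
      let ?k = "Suc (2 * CARD('d))"
      have "filterlim (\<lambda>n. ?l n / 2) at_top sequentially" by real_asymp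
      from filterlim_compose[OF tendsto_power_div_exp_0[of ?k] this]
      have lim1: "(\<lambda>n. (?l n / 2) ^ ?k / exp (?l n / 2)) \<longlonglongrightarrow> 0" .
      have lim2: "(\<lambda>n. 2 * exp (- 2 * ?l n)) \<longlonglongrightarrow> 0" by real_asymp
      have "(\<lambda>n. ((1 / 4 + B) * M ^ (2 * CARD('d)) * 64 * 2 ^ ?k) * ((?l n / 2) ^ ?k / exp (?l n / 2)) + 2 * exp (- 2 * ?l n))
          \<longlonglongrightarrow> ((1 / 4 + B) * M ^ (2 * CARD('d)) * 64 * 2 ^ ?k) * 0 + 0"
        by (intro tendsto_add tendsto_mult tendsto_const lim1 lim2)
      moreover have "(1 / 4 + B) * ?l n * ((M * ?l n) ^ CARD('d))\<^sup>2 * (64 * exp (- ?l n / 2)) =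
          ((1 / 4 + B) * M ^ (2 * CARD('d)) * 64 * 2 ^ ?k) * ((?l n / 2) ^ ?k / exp (?l n / 2))" for n
      proof -
        have p: "((M * ?l n) ^ CARD('d))\<^sup>2 = M ^ (2 * CARD('d)) * ?l n ^ (2 * CARD('d))"
          by (simp add: power_even_eq power_mult_distrib)
        have h: "(?l n / 2) ^ ?k = ?l n * ?l n ^ (2 * CARD('d)) / 2 ^ ?k"
          unfolding power_divide by simp
        have E: "exp (- ?l n / 2) = inverse (exp (?l n / 2))"
          using exp_minus[of "?l n / 2"] by simp
        have "u * x * (v * X) * (64 * inverse E) = (u * v * 64 * P) * (x * X / P / E)" if "P \<noteq> 0" for u x v X E P :: real
          using that by (simp add: divide_inverse)
        note identity = this
        show ?thesis unfolding p h E by (rule identity) simp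
      qed
      ultimately show "(\<lambda>n. (1 / 4 + B) * ?l n * ((M * ?l n) ^ CARD('d))\<^sup>2 * (64 * exp (- ?l n / 2)) + 2 * exp (- 2 * ?l n)) \<longlonglongrightarrow> 0"
        by simp
    qed
    show "\<forall>\<^sub>F n in sequentially. \<forall>t. 0 \<le> t \<and> t \<le> 1 / 4 * ?l n \<longrightarrow> \<epsilon> < D n t"
      using 1 2 3 big
    proof eventually_elim
      case (elim n)
      then have n: "0 < n" and l: "1 \<le> ?l n" by simp_all
      interpret G: coloring_geometry "\<Lambda> n" "box_nbr (\<Lambda> n)" "boundary_colors (\<Lambda> n) (\<tau> n)" q \<Delta> l1_dist \<beta>
        by (rule geo[OF n])
      let ?N = "real (card (\<Lambda> n))" and ?T = "B * ?l n"
      have T: "0 \<le> ?T" using B l by simp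
      have N0: "0 < ?N" unfolding card[OF n] by simp
      have merge: "?N * G.merge_rate ?T = K * exp (- ?l n)"
        using G.card_merge_rate[OF card[OF n]] gB unfolding K_def g_def by blast
      show ?case
      proof (intro allI impI)
        fix t assume t: "0 \<le> t \<and> t \<le> 1 / 4 * ?l n"
        \<comment> \<open>The means are asked to be N n^(-1/4) / 4 apart, while fluctuations are of
          order N^(1/2) up to logarithms; this is smaller since N \<ge> n.\<close>
        define s where "s = ?N * (exp (- ?l n / 4) / 8)"
        have s: "0 < s" using N0 by (simp add: s_def)
        have "1 / 4 * ?l n \<le> b * ?l n" using l B by (intro mult_right_mono) (auto simp: b_def)
        then have et: "G.escape_rate t (L n) \<le> exp (- 2 * ?l n)"
          using t by (intro G.escape_le[OF card[OF n] _ cL c_def]) linarith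
        have eT: "G.escape_rate ?T (L n) \<le> exp (- 2 * ?l n)"
          using l B by (intro G.escape_le[OF card[OF n] _ cL c_def] mult_right_mono) (auto simp: b_def)
        have "1 - 2 * \<epsilon>' - ?N * G.merge_rate ?T < W n t"
          unfolding W_def
        proof (rule G.worst_apart[OF _ T s e', where L="L n"])
          show "0 \<le> t" using t by simp
          have "2 * s + ?N * (?N * G.merge_rate ?T + G.escape_rate t (L n) + G.escape_rate ?T (L n))
              \<le> ?N * (exp (- ?l n / 4) / 4 + (K * exp (- ?l n) + 2 * exp (- 2 * ?l n)))"
            unfolding s_def merge using mult_left_mono[OF add_mono[OF et eT], of ?N] N0
            by (simp add: algebra_simps)
          also have "\<dots> < ?N * (exp (- ?l n / 4) / 2)" using elim(2) N0 by (intro mult_strict_left_mono)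
          also have "\<dots> \<le> ?N * (exp (- t) / 2)" using t N0 by (intro mult_left_mono divide_right_mono) auto
          finally show "2 * s + ?N * (?N * G.merge_rate ?T + G.escape_rate t (L n) + G.escape_rate ?T (L n)) < ?N * exp (- t) / 2"
            by simp
          have s2: "?N / s\<^sup>2 \<le> 64 * exp (- ?l n / 2)"
          proof -
            have "?N / s\<^sup>2 = 64 * exp (?l n / 2) / ?N"
              using N0 unfolding s_def by (simp add: power2_eq_square field_simps flip: exp_add)
            also have "\<dots> = 64 * exp (?l n / 2 - d * ?l n)" unfolding card[OF n] by (simp add: exp_diff)
            also have "\<dots> \<le> 64 * exp (- ?l n / 2)"
            proof -
              have "1 * ?l n \<le> d * ?l n" using d l by (intro mult_right_mono) auto
              then show ?thesis by simp
            qed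
            finally show ?thesis .
          qed
          have "(t + ?T) * ?N * (\<beta> (L n))\<^sup>2 / s\<^sup>2 = (t + ?T) * (\<beta> (L n))\<^sup>2 * (?N / s\<^sup>2)" by simp
          also have "\<dots> \<le> ((1 / 4 + B) * ?l n) * ((M * ?l n) ^ CARD('d))\<^sup>2 * (64 * exp (- ?l n / 2))"
            using t T l B N0 by (intro mult_mono s2 power_mono \<beta>_le \<beta>0 mult_nonneg_nonneg) (auto simp: distrib_right)
          finally show "(t + ?T) * ?N * (\<beta> (L n))\<^sup>2 / s\<^sup>2 + G.escape_rate t (L n) + G.escape_rate ?T (L n) < \<epsilon>'"
            using elim(3) et eT by linarith
        qed
        moreover have "D n t = W n t" using t by (intro DW n) simp
        moreover have "1 = \<epsilon> + 3 * \<epsilon>'" by (simp add: \<epsilon>'_def field_simps)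
        ultimately show "\<epsilon> < D n t" using elim(1) unfolding merge by linarith
      qed
    qed
  next
    fix \<epsilon> :: real assume e: "0 < \<epsilon>" "\<epsilon> < 1"
    let ?l = "\<lambda>n. ln (real n)"
    define K2 where "K2 = K * M ^ CARD('d)"
    have K2: "0 < K2" using K M by (simp add: K2_def)
    have 1: "\<forall>\<^sub>F n in sequentially. K * exp (- ?l n) < \<epsilon> / 2" using e by real_asymp
    have 2: "\<forall>\<^sub>F n in sequentially. 2 * sqrt (8 * (K2 / ?l n) / \<epsilon>) + (1 + 4 / \<epsilon>) * (2 * exp (- 2 * ?l n)) + K * exp (- ?l n) < \<epsilon>"
      using e K2 by real_asymp
    show "\<forall>\<^sub>F n in sequentially. \<forall>t. 0 \<le> t \<and> t \<le> B * ?l n + 1 \<and> D n t \<le> 1 - \<epsilon> \<longrightarrow> D n (t + B * ln (?l n)) \<le> \<epsilon>"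
      using 1 2 big
    proof eventually_elim
      case (elim n)
      then have n: "0 < n" and l: "1 \<le> ?l n" "1 \<le> ln (?l n)" by simp_all
      interpret G: coloring_geometry "\<Lambda> n" "box_nbr (\<Lambda> n)" "boundary_colors (\<Lambda> n) (\<tau> n)" q \<Delta> l1_dist \<beta>
        by (rule geo[OF n])
      let ?N = "real (card (\<Lambda> n))" and ?T = "B * ?l n" and ?s = "B * ln (?l n)"
      have T: "0 \<le> ?T" and s: "0 \<le> ?s" using B l by simp_all
      have merge: "?N * G.merge_rate ?T = K * exp (- ?l n)"
        using G.card_merge_rate[OF card[OF n]] gB unfolding K_def g_def by blast
      have "?N * G.merge_rate (?T + ?s) \<le> ?N * G.merge_rate ?T"
        using s by (intro mult_left_mono G.merge_rate_mono) auto
      note merge' = this[unfolded merge]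
      have ms: "G.merge_rate ?s = K * (1 / ?l n ^ Suc CARD('d))"
      proof -
        have "(d + 1) * ln (?l n) = ln (?l n ^ Suc CARD('d))"
          using l by (simp add: ln_realpow d_def algebra_simps del: power_Suc)
        then have "exp (- ((d + 1) * ln (?l n))) = 1 / ?l n ^ Suc CARD('d)"
          using l by (simp add: exp_minus inverse_eq_divide del: power_Suc)
        moreover have "G.merge_rate ?s = K * exp (- ((d + 1) * ln (?l n)))"
          unfolding G.merge_rate_def K_def gB[symmetric] g_def by simp
        ultimately show ?thesis by simp
      qed
      \<comment> \<open>The exponent d + 1 of the merge rate beats the ball size by one factor ln n,
        so the main term of the drop is of order (ln n)^(-1/2).\<close>
      have bm: "\<beta> (L n) * G.merge_rate ?s \<le> K2 / ?l n"
      proof -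
        have "\<beta> (L n) * G.merge_rate ?s \<le> (M * ?l n) ^ CARD('d) * G.merge_rate ?s"
          using K l unfolding ms by (intro mult_right_mono \<beta>_le) auto
        also have "\<dots> = K2 / ?l n"
          using l unfolding ms by (simp add: K2_def power_mult_distrib)
        finally show ?thesis .
      qed
      have sl: "?s \<le> B * ?l n" using B l ln_le_minus_one[of "?l n"] by (intro mult_left_mono) auto
      show ?case
      proof (intro allI impI)
        fix t assume t: "0 \<le> t \<and> t \<le> B * ?l n + 1 \<and> D n t \<le> 1 - \<epsilon>"
        have bl: "B * ?l n + 1 + B * ?l n \<le> b * ?l n" using l by (simp add: b_def algebra_simps)
        have et: "G.escape_rate (t + ?s) (L n) \<le> exp (- 2 * ?l n)"
          using t sl bl by (intro G.escape_le[OF card[OF n] _ cL c_def]) linarith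
        have eT: "G.escape_rate (?T + ?s) (L n) \<le> exp (- 2 * ?l n)"
          using sl bl by (intro G.escape_le[OF card[OF n] _ cL c_def]) linarith
        have w: "G.worst t \<le> 1 - \<epsilon>" using t DW[OF n, of t] by (simp add: W_def)
        have "D n (t + ?s) \<le> 2 * sqrt (8 * (\<beta> (L n) * G.merge_rate ?s) / \<epsilon>)
          + (1 + 4 / \<epsilon>) * (G.escape_rate (t + ?s) (L n) + G.escape_rate (?T + ?s) (L n)) + ?N * G.merge_rate (?T + ?s)"
        proof -
          have ts: "0 \<le> t + ?s" using t s by simp
          show ?thesis
            unfolding DW[OF n ts] W_def
            using t elim(1) by (intro G.worst_drop T s e w) (simp_all add: merge)
        qed
        also have "\<dots> \<le> 2 * sqrt (8 * (K2 / ?l n) / \<epsilon>) + (1 + 4 / \<epsilon>) * (2 * exp (- 2 * ?l n)) + K * exp (- ?l n)"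
          using e et eT by (intro add_mono mult_left_mono merge' real_sqrt_le_mono divide_right_mono bm) auto
        finally show "D n (t + ?s) \<le> \<epsilon>" using elim(2) by linarith
      qed
    qed
  qed (use B in auto)
qed

end
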